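(* Let $G$ be a locally compact Abelian group with arcwise connected dual group $\hat G$. Let $\mu$ be a probability measure on $G$ which is not admissible and such that $\hat\mu(\gamma)\neq0$ for all $\gamma\in\hat G$, so that $\hat\mu$ is a continuous map of pointed spaces $(\hat G,1)\to(\mathbb{C}^*,1)$, where $\mathbb{C}^*=\mathbb{C}\setminus\{0\}$. Identify $\pi(\mathbb{C}^*,1)$ with $\mathbb{Z}$, and for $n\in\mathbb{N}$ write $n\mid\hat\mu_*(\pi(\hat G,1))$ if for every $z\in\hat\mu_*(\pi(\hat G,1))$ there exists $l\in\mathbb{Z}$ with $z=nl$. Then: (i) $$\Lambda^{\mathrm{alg}}(\mu)\subseteq\bigcup_{n\in\mathbb{N}:\,n\mid\hat\mu_*(\pi(\hat G,1))}\frac1n\mathbb{N}.$$ (ii) $$\Lambda^{\mathrm{alg}}(\mu)\subseteq\bigcap_{z\in\hat\mu_*(\pi(\hat G,1))\setminus\{0\}}\frac{1}{|z|}\mathbb{N}.$$ (iii) $\Lambda^{\mathrm{alg}}(\mu)$ is bounded from below by $1/\min\{|z|:z\in\hat\mu_*(\pi(\hat G,1))\setminus\{0\}\}$.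
   Context: For a locally compact Abelian group $(G,+)$, $(\hat G,\cdot)$ denotes its dual group (continuous characters) with identity element $1$, and $\hat\mu:\hat G\to\mathbb{C}$ denotes the Fourier transform of a probability measure $\mu$ on (the Borel $\sigma$-algebra of) $G$; in particular $\hat\mu(1)=1$. A characteristic function on $\hat G$ is the Fourier transform of a probability measure on $G$. A probability measure $\mu$ on $G$ is called admissible if there is a continuous function $\psi:\hat G\to\mathbb{C}$ with $\psi(1)=0$ such that $\hat\mu=e^{\psi}$. For a pointed topological space $(X,x_0)$, $\pi(X,x_0)$ is the fundamental group based at $x_0$, and $\phi_*:\pi(X,x_0)\to\pi(Y,y_0)$ is the homomorphism induced by a continuous map $\phi:(X,x_0)\to(Y,y_0)$. $\mathbb{N}=\{1,2,3,\dots\}$, and for a positive integer $k$, $\frac1k\mathbb{N}=\{j/k: j\in\mathbb{N}\}$. For a probability measure $\mu$ on $G$, $$\Lambda^{\mathrm{alg}}(\mu)=\Big\{q=\tfrac{m}{n}: n,m\in\mathbb{N}\text{ mutually prime, and there exists a characteristic function }\widehat{\mu_{m/n}}\text{ with }(\hat\mu)^m=(\widehat{\mu_{m/n}})^n\Big\}.$$ *)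

theory Defs
  imports "HOL-Complex_Analysis.Complex_Analysis" "HOL-Probability.Probability_Measure"
    "HOL-Algebra.Elementary_Groups"
begin

definition compact_open_topology :: "('a::topological_space \<Rightarrow> 'b::topological_space) topology" where
  "compact_open_topology =
     topology_generated_by
       {{f. continuous_on UNIV f \<and> f ` K \<subseteq> U} | K U. compact K \<and> open U}"

definition characters :: "('a::topological_ab_group_add \<Rightarrow> complex) set" where
  "characters = {\<gamma>. continuous_on UNIV \<gamma> \<and> (\<forall>x. norm (\<gamma> x) = 1) \<and>
                     (\<forall>x y. \<gamma> (x + y) = \<gamma> x * \<gamma> y)}"

definition trivial_character :: "'a \<Rightarrow> complex" where
  "trivial_character = (\<lambda>x. 1)"

definition dual_topology :: "('a::topological_ab_group_add \<Rightarrow> complex) topology" where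
  "dual_topology = subtopology compact_open_topology characters"

text \<open>
  On a general locally compact group a probability measure is understood to be carried by compact
  sets up to arbitrarily small mass. This follows from the usual regularity (Radon) convention, it
  is automatic for every Borel probability measure on a \<open>\<sigma>\<close>-compact group, and it is what makes the
  Fourier transform continuous for the compact-open topology.
\<close>
definition borel_probability :: "'a::topological_space measure \<Rightarrow> bool" where
  "borel_probability M \<longleftrightarrow> prob_space M \<and> sets M = sets borel \<and>
     (\<forall>e>0. \<exists>K. compact K \<and> measure M (space M - K) < e)"

definition fourier :: "'a measure \<Rightarrow> ('a \<Rightarrow> complex) \<Rightarrow> complex" where
  "fourier M \<gamma> = (\<integral>x. \<gamma> x \<partial>M)"

definition characteristic_function ::
    "(('a::topological_ab_group_add \<Rightarrow> complex) \<Rightarrow> complex) \<Rightarrow> bool" where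
  "characteristic_function g \<longleftrightarrow>
     (\<exists>N. borel_probability N \<and> (\<forall>\<gamma>\<in>characters. g \<gamma> = fourier N \<gamma>))"

definition admissible :: "'a::topological_ab_group_add measure \<Rightarrow> bool" where
  "admissible M \<longleftrightarrow>
     (\<exists>\<psi>. continuous_map dual_topology euclidean \<psi> \<and> \<psi> trivial_character = 0 \<and>
          (\<forall>\<gamma>\<in>characters. fourier M \<gamma> = exp (\<psi> \<gamma>)))"

definition Lambda_alg :: "'a::topological_ab_group_add measure \<Rightarrow> real set" where
  "Lambda_alg M =
     {real m / real n | m n. m \<ge> 1 \<and> n \<ge> 1 \<and> coprime m n \<and>
        (\<exists>g. characteristic_function g \<and> (\<forall>\<gamma>\<in>characters. fourier M \<gamma> ^ m = g \<gamma> ^ n))}"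

text \<open>\<open>unit_multiples k\<close> is the set written \<open>(1/k)\<nat>\<close>, where \<open>\<nat>\<close> starts at 1.\<close>
definition unit_multiples :: "nat \<Rightarrow> real set" where
  "unit_multiples k = {real j / real k | j. j \<ge> 1}"

definition loops :: "'b topology \<Rightarrow> 'b \<Rightarrow> (real \<Rightarrow> 'b) set" where
  "loops X x0 = {p. pathin X p \<and> p 0 = x0 \<and> p 1 = x0}"

definition loop_homotopy :: "'b topology \<Rightarrow> 'b \<Rightarrow> ((real \<Rightarrow> 'b) \<times> (real \<Rightarrow> 'b)) set" where
  "loop_homotopy X x0 =
     {(p, q). homotopic_with (\<lambda>r. r 0 = x0 \<and> r 1 = x0) (top_of_set {0..1}) X p q}"

text \<open>The type class constraint is only the one carried by \<open>+++\<close>: continuity refers to \<open>X\<close> throughout.\<close>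
definition fundamental_group ::
    "'b::topological_space topology \<Rightarrow> 'b \<Rightarrow> (real \<Rightarrow> 'b) set monoid" where
  "fundamental_group X x0 =
     \<lparr>carrier = loops X x0 // loop_homotopy X x0,
      monoid.mult = (\<lambda>A B. loop_homotopy X x0 `` {p +++ q | p q. p \<in> A \<and> q \<in> B}),
      one = loop_homotopy X x0 `` {\<lambda>t. x0}\<rparr>"

definition induced_map ::
    "'c topology \<Rightarrow> 'c \<Rightarrow> ('b \<Rightarrow> 'c) \<Rightarrow> (real \<Rightarrow> 'b) set \<Rightarrow> (real \<Rightarrow> 'c) set" where
  "induced_map Y y0 \<phi> A = loop_homotopy Y y0 `` ((\<lambda>p. \<phi> \<circ> p) ` A)"

abbreviation punctured_plane :: "complex topology" where
  "punctured_plane \<equiv> top_of_set (- {0})"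

text \<open>
  The identification of the fundamental group of the punctured plane with the integers; see
  \<open>winding_class_iso\<close> below.
\<close>
definition winding_class :: "(real \<Rightarrow> complex) set \<Rightarrow> int" where
  "winding_class A = (THE k. \<forall>p\<in>A. winding_number p 0 = of_int k)"

definition fourier_pi1_image :: "'a::topological_ab_group_add measure \<Rightarrow> int set" where
  "fourier_pi1_image M =
     (\<lambda>A. winding_class (induced_map punctured_plane 1 (fourier M) A)) `
       carrier (fundamental_group dual_topology trivial_character)"

lemma topspace_dual_topology [simp]: "topspace dual_topology = characters"
proof -
  have "{f. continuous_on UNIV f} \<in>
      {{f. continuous_on UNIV f \<and> f ` K \<subseteq> U} | K U. compact K \<and> open (U :: complex set)}"
    by (rule CollectI, rule exI[of _ "{}"], rule exI[of _ UNIV]) auto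
  then have "{f::'a \<Rightarrow> complex. continuous_on UNIV f} \<subseteq> topspace compact_open_topology"
    unfolding compact_open_topology_def topology_generated_by_topspace by blast
  then show ?thesis
    by (auto simp: dual_topology_def characters_def)
qed

lemma loops_punctured_plane:
  "p \<in> loops punctured_plane 1 \<longleftrightarrow>
     path p \<and> 0 \<notin> path_image p \<and> pathstart p = 1 \<and> pathfinish p = 1"
  by (auto simp: loops_def pathin_def path_def path_image_def pathstart_def pathfinish_def)

lemma loop_homotopy_punctured_plane:
  "(p, q) \<in> loop_homotopy punctured_plane 1 \<longleftrightarrow>
     p \<in> loops punctured_plane 1 \<and> q \<in> loops punctured_plane 1 \<and>
     winding_number p 0 = winding_number q 0"
proof -
  let ?L = "loops punctured_plane 1"
  have eq: "(p, q) \<in> loop_homotopy punctured_plane 1 \<longleftrightarrow> homotopic_paths (- {0}) p q"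
    if "pathstart p = 1" "pathfinish p = 1"
    using that by (simp add: loop_homotopy_def homotopic_paths_def pathstart_def pathfinish_def)
  have *: "p \<in> loops punctured_plane 1 \<and> q \<in> loops punctured_plane 1"
    if pq: "(p, q) \<in> loop_homotopy punctured_plane 1"
  proof -
    have h: "homotopic_with (\<lambda>r. r 0 = 1 \<and> r 1 = 1) (top_of_set {0..1}) punctured_plane p q"
      using pq by (simp add: loop_homotopy_def)
    from homotopic_with_imp_continuous_maps[OF h] homotopic_with_imp_property[OF h]
    show ?thesis by (simp add: loops_def pathin_def)
  qed
  show ?thesis
  proof (cases "p \<in> ?L \<and> q \<in> ?L")
    case True
    then have "winding_number p 0 = winding_number q 0 \<longleftrightarrow> homotopic_paths (- {0}) p q"
      by (intro winding_number_homotopic_paths_eq) (simp_all add: loops_punctured_plane)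
    with True eq show ?thesis
      by (simp add: loops_punctured_plane)
  next
    case False
    with * show ?thesis by blast
  qed
qed

lemma winding_class_Image:
  assumes "p \<in> loops punctured_plane 1"
  shows "of_int (winding_class (loop_homotopy punctured_plane 1 `` {p})) = winding_number p 0"
proof -
  obtain k where k: "winding_number p 0 = of_int k"
    using assms integer_winding_number[of p 0] by (auto simp: loops_punctured_plane Ints_def)
  have "winding_class (loop_homotopy punctured_plane 1 `` {p}) = k"
    unfolding winding_class_def
  proof (rule the_equality)
    show "\<forall>q\<in>loop_homotopy punctured_plane 1 `` {p}. winding_number q 0 = of_int k"
      using k by (auto simp: loop_homotopy_punctured_plane)
    show "l = k" if "\<forall>q\<in>loop_homotopy punctured_plane 1 `` {p}. winding_number q 0 = of_int l" for l
    proof -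
      have "p \<in> loop_homotopy punctured_plane 1 `` {p}"
        using assms by (simp add: loop_homotopy_punctured_plane)
      with that k have "complex_of_int l = of_int k" by metis
      then show ?thesis by simp
    qed
  qed
  with k show ?thesis by simp
qed

lemma winding_class_iso:
  "winding_class \<in> iso (fundamental_group punctured_plane 1) integer_group"
proof -
  let ?L = "loops punctured_plane 1" and ?R = "loop_homotopy punctured_plane 1"
  have join: "p +++ q \<in> ?L \<and> winding_number (p +++ q) 0 = winding_number p 0 + winding_number q 0"
    if "p \<in> ?L" "q \<in> ?L" for p q
    using that by (auto simp: loops_punctured_plane winding_number_join not_in_path_image_join)
  have mult: "?R `` {p' +++ q' | p' q'. p' \<in> ?R `` {p} \<and> q' \<in> ?R `` {q}} = ?R `` {p +++ q}"
    if pq: "p \<in> ?L" "q \<in> ?L" for p q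
  proof -
    have *: "(p +++ q, r) \<in> ?R \<longleftrightarrow> (p' +++ q', r) \<in> ?R"
      if "p' \<in> ?R `` {p}" "q' \<in> ?R `` {q}" for p' q' r
    proof -
      have "p' \<in> ?L" "q' \<in> ?L" "winding_number p' 0 = winding_number p 0"
        "winding_number q' 0 = winding_number q 0"
        using that by (simp_all add: loop_homotopy_punctured_plane)
      with join[of p q] join[of p' q'] pq show ?thesis
        by (simp add: loop_homotopy_punctured_plane)
    qed
    have self: "p \<in> ?R `` {p}" "q \<in> ?R `` {q}"
      using pq by (simp_all add: loop_homotopy_punctured_plane)
    have image: "Rel `` {p' +++ q' | p' q'. p' \<in> A \<and> q' \<in> B} = Rel `` {p +++ q}"
      if "\<And>p' q' r. p' \<in> A \<Longrightarrow> q' \<in> B \<Longrightarrow> (p +++ q, r) \<in> Rel \<longleftrightarrow> (p' +++ q', r) \<in> Rel"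
        and "p \<in> A" "q \<in> B" for Rel and A B :: "(real \<Rightarrow> complex) set"
      using that by blast
    show ?thesis
      using * self by (rule image)
  qed
  have surj: "\<exists>p\<in>?L. winding_number p 0 = of_int k" for k
  proof
    let ?p = "exp \<circ> linepath 0 (2 * of_real pi * \<i> * of_int k)"
    have fin: "exp (2 * complex_of_real pi * \<i> * of_int k) = 1"
      using exp_integer_2pi[of "of_int k"] by (simp add: mult_ac)
    have "path ?p"
      by (intro path_continuous_image continuous_intros) auto
    with fin show "?p \<in> ?L"
      by (auto simp: loops_punctured_plane pathstart_compose pathfinish_compose path_image_compose)
    show "winding_number ?p 0 = of_int k"
      by (subst winding_number_compose_exp) auto
  qed
  show ?thesis
  proof (rule isoI)
    show "winding_class \<in> hom (fundamental_group punctured_plane 1) integer_group"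
    proof (rule homI)
      fix A B
      assume "A \<in> carrier (fundamental_group punctured_plane 1)"
        and "B \<in> carrier (fundamental_group punctured_plane 1)"
      then obtain p q where p: "p \<in> ?L" "A = ?R `` {p}" and q: "q \<in> ?L" "B = ?R `` {q}"
        by (auto simp: fundamental_group_def elim!: quotientE)
      have "complex_of_int (winding_class (?R `` {p +++ q})) =
            of_int (winding_class (?R `` {p}) + winding_class (?R `` {q}))"
        using p q join by (simp add: winding_class_Image)
      then have "winding_class (?R `` {p +++ q}) = winding_class A + winding_class B"
        using p q of_int_eq_iff by blast
      moreover have "A \<otimes>\<^bsub>fundamental_group punctured_plane 1\<^esub> B = ?R `` {p +++ q}"
        using mult[OF p(1) q(1)] p(2) q(2) by (simp add: fundamental_group_def)
      ultimately show "winding_class (A \<otimes>\<^bsub>fundamental_group punctured_plane 1\<^esub> B) =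
          winding_class A \<otimes>\<^bsub>integer_group\<^esub> winding_class B"
        by simp
    qed simp
    show "bij_betw winding_class (carrier (fundamental_group punctured_plane 1))
        (carrier integer_group)"
    proof (rule bij_betw_imageI)
      show "inj_on winding_class (carrier (fundamental_group punctured_plane 1))"
      proof (rule inj_onI)
        fix A B
        assume "A \<in> carrier (fundamental_group punctured_plane 1)"
          and "B \<in> carrier (fundamental_group punctured_plane 1)"
          and eq: "winding_class A = winding_class B"
        then obtain p q where p: "p \<in> ?L" "A = ?R `` {p}" and q: "q \<in> ?L" "B = ?R `` {q}"
          by (auto simp: fundamental_group_def elim!: quotientE)
        then have "winding_number p 0 = winding_number q 0"
          using eq by (metis winding_class_Image)
        with p q show "A = B"
          by (auto simp: loop_homotopy_punctured_plane)
      qed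
      have "k \<in> winding_class ` (?L // ?R)" for k
      proof -
        obtain p where p: "p \<in> ?L" "winding_number p 0 = of_int k"
          using surj by blast
        then have "winding_class (?R `` {p}) = k"
          using winding_class_Image[OF p(1)] by simp
        with quotientI[OF p(1)] show ?thesis by blast
      qed
      then show "winding_class ` carrier (fundamental_group punctured_plane 1) =
          carrier integer_group"
        by (auto simp: fundamental_group_def)
    qed
  qed
qed

end

theory Submission
  imports Defs
begin

text \<open>
  Suppose that \<open>m / n\<close> in lowest terms belongs to the algebraic powers of \<open>\<mu>\<close>, so that the \<open>m\<close>-th power
  of the Fourier transform of \<open>\<mu>\<close> is the \<open>n\<close>-th power of another Fourier transform. Along a loop in
  the dual group both transforms have a winding number around 0, and \<open>m z = n k\<close> for these numbers.
  As \<open>m\<close> and \<open>n\<close> are coprime, \<open>n\<close> divides every element \<open>z\<close> of the image of the fundamental group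
  (\<open>denominator_dvd_winding\<close>). This gives (i) and (ii), and (iii) follows from (ii) as soon as this
  image contains a nonzero element.

  That it does is the main point: if all loops have winding number 0, then \<open>\<mu>\<close> is admissible
  (\<open>admissible_if_no_winding\<close>). A logarithm of the Fourier transform is obtained at \<open>\<gamma>\<close> from any path
  from 1 to \<open>\<gamma>\<close>. Its continuity requires that nearby characters are joined by short paths, and the
  dual group is only assumed to be path connected. For dual groups this is enough, and the proof
  avoids the structure theory and the duality theory of locally compact abelian groups.

  By \<open>characters_lift_if_path_connected\<close> every character has the form \<open>cis \<circ> \<phi>\<close> with a continuous
  homomorphism \<open>\<phi>\<close> to the reals. It has to be shown that a character that is close to 1 on a large
  compact set has a lift that is small on a given compact set \<open>K\<close> (\<open>small_lifts\<close>). Three facts are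
  combined. On the group \<open>H\<close> generated by \<open>K\<close>, a lift \<open>\<phi>\<close> of such a character is close on \<open>K\<close> to \<open>2 pi g\<close>
  for a homomorphism \<open>g\<close> from \<open>H\<close> to the integers (\<open>small_character_integer_part\<close>). If \<open>H\<close> is pure,
  then \<open>g\<close> extends to the whole group (\<open>integer_homs_extend\<close>), and \<open>2 pi\<close> times the extension can be
  subtracted from \<open>\<phi>\<close>. Finally, \<open>K\<close> can be enlarged so that \<open>H\<close> is pure (\<open>enlarge_to_pure\<close>).

  For a discrete group \<open>A\<close> the existence of lifts means that \<open>Hom(A, \<real>) \<rightarrow> Hom(A, \<real>/\<int>)\<close> is onto,
  that is, \<open>A\<close> is a Whitehead group. The last two facts are then the classical statements that finite-rank
  pure subgroups of a Whitehead group are direct summands and are free. The circle group is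
  injective (\<open>extend_character\<close>), which supplies the characters to which the lifting property is applied.
\<close>

section \<open>Characters of abstract abelian groups\<close>

definition additive_subgroup :: "'a::ab_group_add set \<Rightarrow> bool" where
  "additive_subgroup H \<longleftrightarrow> 0 \<in> H \<and> (\<forall>x\<in>H. \<forall>y\<in>H. x - y \<in> H)"

text \<open>
  Repeated addition, so that abelian groups of the type class serve as modules over the natural
  numbers; integer multiples are written as differences.
\<close>
primrec multiple :: "nat \<Rightarrow> 'a::ab_group_add \<Rightarrow> 'a" where
  "multiple 0 x = 0"
| "multiple (Suc n) x = x + multiple n x"

definition character_on :: "'a::ab_group_add set \<Rightarrow> ('a \<Rightarrow> complex) \<Rightarrow> bool" where
  "character_on H \<gamma> \<longleftrightarrow> additive_subgroup H \<and> (\<forall>x\<in>H. norm (\<gamma> x) = 1) \<and>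
     (\<forall>x\<in>H. \<forall>y\<in>H. \<gamma> (x + y) = \<gamma> x * \<gamma> y)"

lemma additive_subgroup_0: "additive_subgroup H \<Longrightarrow> 0 \<in> H"
  and additive_subgroup_diff: "additive_subgroup H \<Longrightarrow> x \<in> H \<Longrightarrow> y \<in> H \<Longrightarrow> x - y \<in> H"
  by (auto simp: additive_subgroup_def)

lemma additive_subgroup_minus: "additive_subgroup H \<Longrightarrow> x \<in> H \<Longrightarrow> - x \<in> H"
  using additive_subgroup_diff[of H 0 x] additive_subgroup_0[of H] by simp

lemma additive_subgroup_add:
  assumes "additive_subgroup H" "x \<in> H" "y \<in> H" shows "x + y \<in> H"
  using additive_subgroup_diff[OF assms(1,2) additive_subgroup_minus[OF assms(1,3)]] by simp

lemma multiple_add: "multiple (m + n) x = multiple m x + multiple n x"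
  by (induction m) (simp_all add: add.assoc)

lemma multiple_mult: "multiple (m * n) x = multiple m (multiple n x)"
  by (induction m) (simp_all add: multiple_add)

lemma multiple_distrib: "multiple n (x + y) = multiple n x + multiple n y"
  by (induction n) (simp_all add: algebra_simps)

lemma multiple_zero: "multiple n 0 = 0"
  by (induction n) auto

lemma multiple_minus: "multiple n (- x) = - multiple n x"
  using multiple_distrib[of n x "- x"] by (simp add: multiple_zero minus_unique)

lemma multiple_distrib_diff: "multiple n (x - y) = multiple n x - multiple n y"
  using multiple_distrib[of n x "- y"] by (simp add: multiple_minus)

lemma additive_subgroup_multiple: "additive_subgroup H \<Longrightarrow> x \<in> H \<Longrightarrow> multiple n x \<in> H"
  by (induction n) (auto simp: additive_subgroup_0 additive_subgroup_add)

lemma character_onD: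
  assumes "character_on H \<gamma>"
  shows "additive_subgroup H" "x \<in> H \<Longrightarrow> norm (\<gamma> x) = 1"
    "x \<in> H \<Longrightarrow> y \<in> H \<Longrightarrow> \<gamma> (x + y) = \<gamma> x * \<gamma> y"
  using assms by (auto simp: character_on_def)

lemma character_on_0:
  assumes "character_on H \<gamma>" shows "\<gamma> 0 = 1"
proof -
  have "0 \<in> H" using assms by (simp add: character_on_def additive_subgroup_def)
  then have "\<gamma> 0 = \<gamma> 0 * \<gamma> 0" "norm (\<gamma> 0) = 1"
    using character_onD[OF assms] by (metis add.right_neutral, simp)
  then show ?thesis by (metis mult_cancel_right1 norm_zero zero_neq_one)
qed

lemma character_on_diff:
  assumes "character_on H \<gamma>" "x \<in> H" "y \<in> H" shows "\<gamma> (x - y) = \<gamma> x / \<gamma> y"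
proof -
  have "\<gamma> x = \<gamma> (x - y) * \<gamma> y"
    using character_onD(3)[OF assms(1), of "x - y" y] additive_subgroup_diff character_onD(1) assms
    by (metis diff_add_cancel)
  moreover have "\<gamma> y \<noteq> 0" using character_onD(2)[OF assms(1,3)] by auto
  ultimately show ?thesis by simp
qed

lemma character_on_multiple:
  assumes "character_on H \<gamma>" "x \<in> H" shows "\<gamma> (multiple n x) = \<gamma> x ^ n"
  by (induction n)
    (auto simp: character_on_0[OF assms(1)] character_onD[OF assms(1)] assms(2)
      additive_subgroup_multiple[OF character_onD(1)[OF assms(1)]])

text \<open>
  The elements of the group generated by \<open>H\<close> and \<open>x\<close> are written as \<open>u + a x - b x\<close> with \<open>u\<close> in \<open>H\<close> and
  natural numbers \<open>a\<close> and \<open>b\<close>. Compatibility with the relations \<open>k x \<in> H\<close> is exactly what makes the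
  value \<open>\<gamma>(u) c\<^sup>a / c\<^sup>b\<close> independent of the representation.
\<close>
lemma extend_character_adjoin:
  assumes \<gamma>: "character_on H \<gamma>" and c: "norm c = 1"
    and compat: "\<And>k. multiple k x \<in> H \<Longrightarrow> \<gamma> (multiple k x) = c ^ k"
  obtains H' \<gamma>' where "character_on H' \<gamma>'" "H \<subseteq> H'" "x \<in> H'" "\<gamma>' x = c" "\<And>y. y \<in> H \<Longrightarrow> \<gamma>' y = \<gamma> y"
proof -
  note H = character_onD(1)[OF \<gamma>]
  have c0: "c \<noteq> 0" using c by auto
  have key: "\<gamma> u * c ^ m = \<gamma> v * c ^ n"
    if "u \<in> H" "v \<in> H" "u + multiple m x = v + multiple n x" "m \<le> n" for u v m n
  proof -
    have "multiple n x = multiple (n - m) x + multiple m x"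
      using \<open>m \<le> n\<close> by (simp flip: multiple_add)
    then have eq: "multiple (n - m) x = u - v" using that(3) by (simp add: algebra_simps)
    then have "c ^ (n - m) = \<gamma> (u - v)"
      using compat[of "n - m"] additive_subgroup_diff[OF H that(1,2)] by metis
    also have "\<dots> = \<gamma> u / \<gamma> v" by (rule character_on_diff[OF \<gamma> that(1,2)])
    finally have "\<gamma> u = \<gamma> v * c ^ (n - m)"
      using character_onD(2)[OF \<gamma> that(2)] by (auto simp: field_simps)
    then show ?thesis using \<open>m \<le> n\<close> by (simp add: mult.assoc flip: power_add)
  qed
  have wd: "\<gamma> u * c ^ a / c ^ b = \<gamma> u' * c ^ a' / c ^ b'"
    if "u \<in> H" "u' \<in> H"
      "u + multiple a x - multiple b x = u' + multiple a' x - multiple b' x" for u u' a b a' b'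
  proof -
    have "u + multiple (a + b') x = u' + multiple (a' + b) x"
      using that(3) by (simp add: multiple_add algebra_simps)
    then have "\<gamma> u * c ^ (a + b') = \<gamma> u' * c ^ (a' + b)"
      using key[of u u' "a + b'" "a' + b"] key[of u' u "a' + b" "a + b'"] that(1,2)
      by (metis nle_le)
    then show ?thesis using c0 by (simp add: field_simps power_add)
  qed
  define H' where "H' = {u + multiple a x - multiple b x | u a b. u \<in> H}"
  define \<gamma>' where "\<gamma>' z = (THE w. \<exists>u a b. u \<in> H \<and> z = u + multiple a x - multiple b x \<and>
      w = \<gamma> u * c ^ a / c ^ b)" for z
  have val: "\<gamma>' (u + multiple a x - multiple b x) = \<gamma> u * c ^ a / c ^ b" if "u \<in> H" for u a b
    unfolding \<gamma>'_def
  proof (rule the_equality)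
    show "\<exists>v i j. v \<in> H \<and> u + multiple a x - multiple b x = v + multiple i x - multiple j x \<and>
        \<gamma> u * c ^ a / c ^ b = \<gamma> v * c ^ i / c ^ j"
      using that by blast
  next
    fix w assume "\<exists>v i j. v \<in> H \<and> u + multiple a x - multiple b x = v + multiple i x - multiple j x \<and>
        w = \<gamma> v * c ^ i / c ^ j"
    then obtain v i j where "v \<in> H" "w = \<gamma> v * c ^ i / c ^ j"
      "u + multiple a x - multiple b x = v + multiple i x - multiple j x" by blast
    with wd[OF that this(1,3)] show "w = \<gamma> u * c ^ a / c ^ b" by simp
  qed
  have H': "additive_subgroup H'"
    unfolding additive_subgroup_def
  proof (intro conjI ballI)
    have "0 = 0 + multiple 0 x - multiple 0 x" by simp
    then show "0 \<in> H'" unfolding H'_def using additive_subgroup_0[OF H] by blast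
    fix y z assume "y \<in> H'" "z \<in> H'"
    then obtain u a b u' a' b' where *: "u \<in> H" "u' \<in> H" "y = u + multiple a x - multiple b x"
      "z = u' + multiple a' x - multiple b' x" unfolding H'_def by blast
    have "y - z = (u - u') + multiple (a + b') x - multiple (b + a') x"
      unfolding *(3,4) multiple_add by (simp add: algebra_simps)
    then show "y - z \<in> H'" unfolding H'_def using additive_subgroup_diff[OF H *(1,2)] by blast
  qed
  have "character_on H' \<gamma>'"
    unfolding character_on_def
  proof (intro conjI ballI H')
    fix y assume "y \<in> H'"
    then show "norm (\<gamma>' y) = 1"
      using val c character_onD(2)[OF \<gamma>]
      by (auto simp: H'_def norm_divide norm_mult norm_power)
  next
    fix y z assume "y \<in> H'" "z \<in> H'"
    then obtain u a b u' a' b' where *: "u \<in> H" "u' \<in> H" "y = u + multiple a x - multiple b x"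
      "z = u' + multiple a' x - multiple b' x" unfolding H'_def by blast
    have yz: "y + z = (u + u') + multiple (a + a') x - multiple (b + b') x"
      unfolding *(3,4) multiple_add by (simp add: algebra_simps)
    show "\<gamma>' (y + z) = \<gamma>' y * \<gamma>' z"
      unfolding yz unfolding *(3,4) val[OF *(1)] val[OF *(2)] val[OF additive_subgroup_add[OF H *(1,2)]]
        character_onD(3)[OF \<gamma> *(1,2)]
      by (simp add: power_add)
  qed
  moreover have in_H: "\<gamma>' y = \<gamma> y" "y \<in> H'" if "y \<in> H" for y
    using val[OF that, of 0 0] that unfolding H'_def
    by (simp, metis (mono_tags, lifting) add_cancel_right_right diff_zero mem_Collect_eq multiple.simps(1))
  moreover have "\<gamma>' x = c" "x \<in> H'"
  proof -
    have x: "x = 0 + multiple 1 x - multiple 0 x" by simp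
    then show "x \<in> H'" unfolding H'_def using additive_subgroup_0[OF H] by blast
    show "\<gamma>' x = c" using val[of 0 1 0] additive_subgroup_0[OF H] character_on_0[OF \<gamma>] by simp
  qed
  ultimately show ?thesis using that by blast
qed

text \<open>
  The relations \<open>k x \<in> H\<close> are the multiples of a single one, so \<open>c\<close> only has to be a root of the
  corresponding order of a number on the unit circle. As \<open>x\<close> lies outside \<open>H\<close>, this order is at
  least 2 (or there is no relation at all), which leaves two choices and makes it possible to avoid
  a prescribed value \<open>d\<close>.
\<close>
lemma value_for_adjoined_element:
  assumes \<gamma>: "character_on H \<gamma>" and x: "x \<notin> H"
  obtains c where "c \<noteq> d" "norm c = 1" "\<And>k. multiple k x \<in> H \<Longrightarrow> \<gamma> (multiple k x) = c ^ k"
proof (cases "\<exists>k>0. multiple k x \<in> H")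
  case False
  have "\<gamma> (multiple k x) = c ^ k" if "multiple k x \<in> H" for k c
  proof -
    have "k = 0" using False that by auto
    then show ?thesis by (simp add: character_on_0[OF \<gamma>])
  qed
  then show ?thesis using that[of "if d = 1 then -1 else 1"] by auto
next
  case True
  note H = character_onD(1)[OF \<gamma>]
  define k where "k = (LEAST k. k > 0 \<and> multiple k x \<in> H)"
  have k: "k > 0" "multiple k x \<in> H" using LeastI_ex[OF True] unfolding k_def by auto
  have k_min: "\<not> (0 < j \<and> multiple j x \<in> H)" if "j < k" for j
    using not_less_Least[OF that[unfolded k_def]] .
  have "k \<noteq> 1" using k x by auto
  with k have k2: "k \<ge> 2" by linarith
  obtain \<theta> where \<theta>: "\<gamma> (multiple k x) = cis \<theta>"
    using character_onD(2)[OF \<gamma> k(2)] by (metis complex_norm_eq_1_exp cis_conv_exp)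
  have dvd: "k dvd j" if "multiple j x \<in> H" for j
  proof -
    have "multiple j x = multiple (j div k) (multiple k x) + multiple (j mod k) x"
      by (simp flip: multiple_mult multiple_add)
    then have "multiple (j mod k) x = multiple j x - multiple (j div k) (multiple k x)" by simp
    then have "multiple (j mod k) x \<in> H"
      using that k(2) additive_subgroup_diff[OF H] additive_subgroup_multiple[OF H] by metis
    then show ?thesis using k_min[of "j mod k"] k(1) by auto
  qed
  have compat: "\<gamma> (multiple j x) = c ^ j" if c: "c ^ k = cis \<theta>" and j: "multiple j x \<in> H" for c j
  proof -
    obtain i where i: "j = i * k" using dvd[OF j] by (metis dvd_def mult.commute)
    have "\<gamma> (multiple j x) = cis \<theta> ^ i"
      unfolding i multiple_mult character_on_multiple[OF \<gamma> k(2)] \<theta> ..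
    then show ?thesis by (simp add: i c mult.commute[of i] power_mult)
  qed
  \<comment> \<open>\<open>c 0\<close> and \<open>c (2 * pi)\<close> are two neighbouring roots of order \<open>k\<close> of \<open>cis \<theta>\<close>.\<close>
  define c where "c t = cis ((\<theta> + t) / k)" for t
  have pow: "c 0 ^ k = cis \<theta>" "c (2 * pi) ^ k = cis \<theta>"
    using k(1) by (simp_all add: c_def Complex.DeMoivre cis_mult[symmetric])
  have "c (2 * pi) = c 0 * cis (2 * pi / k)" by (simp add: c_def cis_mult add_divide_distrib)
  moreover have "cis (2 * pi / k) \<noteq> 1"
  proof
    assume "cis (2 * pi / k) = 1"
    then have "cos (2 * pi / k) = 1" by (metis cis.simps(1) one_complex.simps(1))
    then obtain n :: int where n: "2 * pi / k = n * 2 * pi" by (auto simp: cos_one_2pi_int)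
    then have "1 = n * real k" using k(1) by (simp add: field_simps)
    then have "1 = n * int k" by (metis of_int_1 of_int_eq_iff of_int_mult of_int_of_nat_eq)
    then show False using k2 by (metis dvd_triv_right int_dvd_int_iff nat_dvd_1_iff_1 numeral_le_one_iff of_nat_1 semiring_norm(69))
  qed
  moreover have "c 0 \<noteq> 0" by (simp add: c_def)
  ultimately have ne: "c (2 * pi) \<noteq> c 0" by auto
  show ?thesis
  proof (cases "c 0 = d")
    case True
    then show ?thesis using that[of "c (2 * pi)"] ne compat[OF pow(2)] by (auto simp: c_def)
  next
    case False
    then show ?thesis using that[of "c 0"] compat[OF pow(1)] by (auto simp: c_def)
  qed
qed

text \<open>
  The circle group is divisible, hence injective: a maximal extension of a character, obtained from
  Zorn's lemma for graphs of extensions, is defined everywhere.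
\<close>
lemma extend_character:
  assumes \<gamma>: "character_on H \<gamma>"
  obtains \<gamma>' where "character_on UNIV \<gamma>'" "\<And>x. x \<in> H \<Longrightarrow> \<gamma>' x = \<gamma> x"
proof -
  define graph where "graph K \<kappa> = (\<lambda>x. (x, \<kappa> x)) ` K" for K and \<kappa> :: "'a \<Rightarrow> complex"
  define \<A> where "\<A> = {graph K \<kappa> | K \<kappa>. character_on K \<kappa> \<and> graph H \<gamma> \<subseteq> graph K \<kappa>}"
  have graph_iff: "(x, c) \<in> graph K \<kappa> \<longleftrightarrow> x \<in> K \<and> c = \<kappa> x" for x c K \<kappa> by (auto simp: graph_def)
  have "\<exists>R\<in>\<A>. \<forall>S\<in>\<A>. R \<subseteq> S \<longrightarrow> S = R"
  proof (rule subset_Zorn_nonempty)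
    show "\<A> \<noteq> {}" using \<gamma> by (auto simp: \<A>_def)
    fix \<C> assume "\<C> \<noteq> {}" and ch: "subset.chain \<A> \<C>"
    have lin: "R \<subseteq> S \<or> S \<subseteq> R" if "R \<in> \<C>" "S \<in> \<C>" for R S
      using ch that by (auto simp: subset.chain_def)
    have sub: "\<C> \<subseteq> \<A>" using ch by (auto simp: subset.chain_def)
    have joint: "\<exists>K \<kappa>. graph K \<kappa> \<in> \<C> \<and> character_on K \<kappa> \<and> x \<in> K \<and> y \<in> K \<and> c = \<kappa> x \<and> d = \<kappa> y"
      if "(x, c) \<in> \<Union>\<C>" "(y, d) \<in> \<Union>\<C>" for x c y d
    proof -
      from that obtain R S where "R \<in> \<C>" "(x, c) \<in> R" "S \<in> \<C>" "(y, d) \<in> S" by blast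
      with lin[of R S] obtain R where "R \<in> \<C>" "(x, c) \<in> R" "(y, d) \<in> R" by blast
      moreover then obtain K \<kappa> where "R = graph K \<kappa>" "character_on K \<kappa>" using sub by (auto simp: \<A>_def)
      ultimately show ?thesis by (auto simp: graph_iff)
    qed
    define K where "K = fst ` \<Union>\<C>"
    define \<kappa> where "\<kappa> x = (THE c. (x, c) \<in> \<Union>\<C>)" for x
    have \<kappa>: "\<kappa> x = c" if "(x, c) \<in> \<Union>\<C>" for x c
      unfolding \<kappa>_def using that joint by (intro the_equality) (auto, metis UnionI)
    have K: "(x, \<kappa> x) \<in> \<Union>\<C>" if "x \<in> K" for x
    proof -
      from that obtain p where p: "p \<in> \<Union>\<C>" "x = fst p" unfolding K_def by blast
      then have "(x, snd p) \<in> \<Union>\<C>" by simp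
      with \<kappa>[OF this] show ?thesis by simp
    qed
    have un: "graph K \<kappa> = \<Union>\<C>"
    proof (rule subset_antisym; rule subrelI)
      fix x c assume "(x, c) \<in> graph K \<kappa>"
      then show "(x, c) \<in> \<Union>\<C>" using K by (simp add: graph_iff)
    next
      fix x c assume R: "(x, c) \<in> \<Union>\<C>"
      then have "x \<in> K" unfolding K_def by (metis fst_conv image_eqI)
      then show "(x, c) \<in> graph K \<kappa>" using \<kappa>[OF R] by (simp add: graph_iff)
    qed
    have two: "\<exists>L l. graph L l \<in> \<C> \<and> character_on L l \<and> x \<in> L \<and> y \<in> L \<and> L \<subseteq> K \<and> (\<forall>z\<in>L. \<kappa> z = l z)"
      if xy: "x \<in> K" "y \<in> K" for x y
    proof -
      obtain L l where L: "graph L l \<in> \<C>" "character_on L l" "x \<in> L" "y \<in> L"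
        using joint[OF K K, OF xy] by blast
      moreover have "L \<subseteq> K \<and> (\<forall>z\<in>L. \<kappa> z = l z)"
        using L(1) un \<kappa> by (metis Union_upper graph_iff subset_iff)
      ultimately show ?thesis by blast
    qed
    obtain R where R: "R \<in> \<C>" using \<open>\<C> \<noteq> {}\<close> by blast
    then obtain L l where L: "R = graph L l" "character_on L l" "graph H \<gamma> \<subseteq> R"
      using sub by (auto simp: \<A>_def)
    have "0 \<in> K"
      using un R L(1) additive_subgroup_0[OF character_onD(1)[OF L(2)]] by (metis UnionI graph_iff)
    have "character_on K \<kappa>"
      unfolding character_on_def additive_subgroup_def
    proof (intro conjI ballI \<open>0 \<in> K\<close>)
      fix x assume "x \<in> K"
      then show "norm (\<kappa> x) = 1" using two[of x x] character_onD(2) by metis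
    next
      fix x y assume "x \<in> K" "y \<in> K"
      from two[OF this] obtain L l where L: "character_on L l" "x \<in> L" "y \<in> L" "L \<subseteq> K" "\<forall>z\<in>L. \<kappa> z = l z"
        by blast
      show "x - y \<in> K" using L additive_subgroup_diff[OF character_onD(1)] by blast
      show "\<kappa> (x + y) = \<kappa> x * \<kappa> y"
        using L additive_subgroup_add[OF character_onD(1)[OF L(1)] L(2,3)] character_onD(3)[OF L(1-3)]
        by simp
    qed
    moreover have "graph H \<gamma> \<subseteq> graph K \<kappa>" using un R L(3) by blast
    ultimately have "graph K \<kappa> \<in> \<A>" unfolding \<A>_def by (intro CollectI exI[of _ K] exI[of _ \<kappa>] conjI refl)
    then show "\<Union>\<C> \<in> \<A>" by (simp only: un)
  qed
  then obtain R where R: "R \<in> \<A>" and maxR: "\<And>S. S \<in> \<A> \<Longrightarrow> R \<subseteq> S \<Longrightarrow> S = R" by blast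
  from R obtain K \<kappa> where K: "character_on K \<kappa>" "graph H \<gamma> \<subseteq> graph K \<kappa>" and R_eq: "R = graph K \<kappa>"
    by (auto simp: \<A>_def)
  have max: "graph L l = graph K \<kappa>"
    if "character_on L l" "graph H \<gamma> \<subseteq> graph L l" "graph K \<kappa> \<subseteq> graph L l" for L l
  proof -
    have "graph L l \<in> \<A>"
      unfolding \<A>_def by (intro CollectI exI[of _ L] exI[of _ l] conjI refl that)
    with maxR R_eq that(3) show ?thesis by blast
  qed
  have "K = UNIV"
  proof (rule ccontr)
    assume "K \<noteq> UNIV"
    then obtain x where x: "x \<notin> K" by blast
    obtain c where c: "norm c = 1" "\<And>k. multiple k x \<in> K \<Longrightarrow> \<kappa> (multiple k x) = c ^ k"
      using value_for_adjoined_element[OF K(1) x] by metis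
    obtain L l where L: "character_on L l" "K \<subseteq> L" "x \<in> L" "\<And>y. y \<in> K \<Longrightarrow> l y = \<kappa> y"
      using extend_character_adjoin[OF K(1) c] by metis
    have "graph K \<kappa> \<subseteq> graph L l" using L by (auto simp: graph_def)
    with max[OF L(1)] K(2) have "graph L l = graph K \<kappa>" by blast
    then show False using L(3) x by (metis graph_iff)
  qed
  then show ?thesis using that K by (metis graph_iff subsetD)
qed

text \<open>
  The freedom to avoid a value is what the diagonal argument in \<open>enlarge_to_pure\<close> uses.
\<close>
lemma extend_character_avoiding_value:
  assumes \<gamma>: "character_on H \<gamma>" and x: "x \<notin> H"
  obtains \<gamma>' where "character_on UNIV \<gamma>'" "\<And>y. y \<in> H \<Longrightarrow> \<gamma>' y = \<gamma> y" "\<gamma>' x \<noteq> d"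
proof -
  obtain c where c: "c \<noteq> d" "norm c = 1" "\<And>k. multiple k x \<in> H \<Longrightarrow> \<gamma> (multiple k x) = c ^ k"
    using value_for_adjoined_element[OF \<gamma> x] by metis
  obtain L l where L: "character_on L l" "H \<subseteq> L" "x \<in> L" "l x = c" "\<And>y. y \<in> H \<Longrightarrow> l y = \<gamma> y"
    using extend_character_adjoin[OF \<gamma> c(2,3)] by metis
  obtain \<gamma>' where "character_on UNIV \<gamma>'" "\<And>x. x \<in> L \<Longrightarrow> \<gamma>' x = l x"
    using extend_character[OF L(1)] by metis
  moreover then have "\<gamma>' y = \<gamma> y" if "y \<in> H" for y using that L(2,5) by auto
  ultimately show ?thesis using that[of \<gamma>'] L(3,4) c(1) by metis
qed

text \<open>
  The extension is first made trivial on the subgroup of all \<open>k y\<close>; the hypothesis says that this is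
  consistent on the intersection with \<open>H\<close>. Its values are then \<open>k\<close>-th roots of unity everywhere.
\<close>
lemma extend_character_trivial_on_multiples:
  assumes \<kappa>: "character_on H \<kappa>" and triv: "\<And>y. multiple k y \<in> H \<Longrightarrow> \<kappa> (multiple k y) = 1"
  obtains \<gamma> where "character_on UNIV \<gamma>" "\<And>x. x \<in> H \<Longrightarrow> \<gamma> x = \<kappa> x" "\<And>y. \<gamma> y ^ k = 1"
proof -
  note H = character_onD(1)[OF \<kappa>]
  have wd: "\<kappa> u = \<kappa> v" if "u \<in> H" "v \<in> H" "u + multiple k y = v + multiple k z" for u v y z
  proof -
    have eq: "u - v = multiple k (z - y)"
      using that(3) by (simp add: multiple_distrib_diff algebra_simps)
    then have "\<kappa> (u - v) = 1" using triv additive_subgroup_diff[OF H that(1,2)] by metis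
    then show ?thesis
      using character_on_diff[OF \<kappa> that(1,2)] character_onD(2)[OF \<kappa> that(2)] by (auto simp: field_simps)
  qed
  define L where "L = {u + multiple k y | u y. u \<in> H}"
  define l where "l z = \<kappa> (SOME u. u \<in> H \<and> (\<exists>y. z = u + multiple k y))" for z
  have val: "l (u + multiple k y) = \<kappa> u" if "u \<in> H" for u y
  proof -
    have ex: "\<exists>v. v \<in> H \<and> (\<exists>z. u + multiple k y = v + multiple k z)" using that by blast
    define v where "v = (SOME v. v \<in> H \<and> (\<exists>z. u + multiple k y = v + multiple k z))"
    obtain z where "v \<in> H" "u + multiple k y = v + multiple k z"
      using someI_ex[OF ex] unfolding v_def[symmetric] by blast
    from wd[OF that this] show ?thesis unfolding l_def v_def[symmetric] by simp
  qed
  have L: "additive_subgroup L"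
    unfolding additive_subgroup_def
  proof (intro conjI ballI)
    have "0 = 0 + multiple k 0" by (simp add: multiple_zero)
    then show "0 \<in> L" unfolding L_def using additive_subgroup_0[OF H] by blast
    fix x y assume "x \<in> L" "y \<in> L"
    then obtain u v a b where *: "u \<in> H" "v \<in> H" "x = u + multiple k a" "y = v + multiple k b"
      unfolding L_def by blast
    have "x - y = (u - v) + multiple k (a - b)"
      unfolding *(3,4) by (simp add: multiple_distrib_diff algebra_simps)
    then show "x - y \<in> L" unfolding L_def using additive_subgroup_diff[OF H *(1,2)] by blast
  qed
  have "character_on L l"
    unfolding character_on_def
  proof (intro conjI ballI L)
    fix x assume "x \<in> L"
    then show "norm (l x) = 1" using val character_onD(2)[OF \<kappa>] by (auto simp: L_def)
  next
    fix x y assume "x \<in> L" "y \<in> L"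
    then obtain u v a b where *: "u \<in> H" "v \<in> H" "x = u + multiple k a" "y = v + multiple k b"
      unfolding L_def by blast
    have xy: "x + y = (u + v) + multiple k (a + b)"
      unfolding *(3,4) by (simp add: multiple_distrib algebra_simps)
    show "l (x + y) = l x * l y"
      unfolding xy unfolding *(3,4) val[OF *(1)] val[OF *(2)] val[OF additive_subgroup_add[OF H *(1,2)]]
      by (rule character_onD(3)[OF \<kappa> *(1,2)])
  qed
  then obtain \<gamma> where \<gamma>: "character_on UNIV \<gamma>" "\<And>x. x \<in> L \<Longrightarrow> \<gamma> x = l x"
    using extend_character by metis
  have "\<gamma> u = \<kappa> u" if "u \<in> H" for u
  proof -
    have "u = u + multiple k 0" by (simp add: multiple_zero)
    then have "u \<in> L" "l u = \<kappa> u" unfolding L_def using that val[OF that, of 0] by (blast, simp)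
    with \<gamma>(2) show ?thesis by simp
  qed
  moreover have "\<gamma> y ^ k = 1" for y
  proof -
    have "multiple k y = 0 + multiple k y" by simp
    then have "multiple k y \<in> L" "l (multiple k y) = \<kappa> 0"
      unfolding L_def using additive_subgroup_0[OF H] val[of 0 y] by (blast, simp)
    then show ?thesis
      using \<gamma>(2) character_on_0[OF \<kappa>] character_on_multiple[OF \<gamma>(1), of y k] by simp
  qed
  ultimately show ?thesis using that \<gamma>(1) by blast
qed

section \<open>Compactly generated subgroups\<close>

primrec sumset :: "'a::ab_group_add set \<Rightarrow> nat \<Rightarrow> 'a set" where
  "sumset K 0 = {0}"
| "sumset K (Suc n) = (\<lambda>(x, y). x + y) ` (sumset K n \<times> K)"

definition symmetric_set :: "'a::ab_group_add set \<Rightarrow> bool" where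
  "symmetric_set K \<longleftrightarrow> 0 \<in> K \<and> (\<forall>x\<in>K. - x \<in> K)"

text \<open>
  For a symmetric set this is the subgroup generated by \<open>K\<close>, exhibited as an increasing union of sets
  that are compact if \<open>K\<close> is.
\<close>
definition generated :: "'a::ab_group_add set \<Rightarrow> 'a set" where
  "generated K = (\<Union>n. sumset K n)"

text \<open>
  The set \<open>A\<close> need not be a subgroup: on \<open>sumset K n\<close> this is the notion of a local homomorphism.
\<close>
definition additive_on :: "'a::ab_group_add set \<Rightarrow> ('a \<Rightarrow> real) \<Rightarrow> bool" where
  "additive_on A h \<longleftrightarrow> (\<forall>x\<in>A. \<forall>y\<in>A. x + y \<in> A \<longrightarrow> h (x + y) = h x + h y)"

lemma additive_onD: "additive_on A h \<Longrightarrow> x \<in> A \<Longrightarrow> y \<in> A \<Longrightarrow> x + y \<in> A \<Longrightarrow> h (x + y) = h x + h y"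
  by (auto simp: additive_on_def)

lemma sumset_Suc_iff: "z \<in> sumset K (Suc n) \<longleftrightarrow> (\<exists>x\<in>sumset K n. \<exists>y\<in>K. z = x + y)"
  by auto

declare sumset.simps(2) [simp del]

lemma sumset_1 [simp]: "sumset K (Suc 0) = K"
  using sumset_Suc_iff[of _ K 0] by auto

lemma sumset_mono:
  assumes "0 \<in> K" "m \<le> n" shows "sumset K m \<subseteq> sumset K n"
  using assms(2)
proof (induction rule: dec_induct)
  case (step n)
  have "sumset K n \<subseteq> sumset K (Suc n)"
  proof
    fix x assume "x \<in> sumset K n"
    then have "\<exists>y\<in>sumset K n. \<exists>z\<in>K. x = y + z"
      by (intro bexI[of _ x] bexI[of _ 0]) (simp_all add: assms(1))
    then show "x \<in> sumset K (Suc n)" unfolding sumset_Suc_iff .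
  qed
  with step show ?case by blast
qed simp

lemma sumset_add: "x \<in> sumset K m \<Longrightarrow> y \<in> sumset K n \<Longrightarrow> x + y \<in> sumset K (m + n)"
proof (induction n arbitrary: y)
  case (Suc n)
  then obtain z w where z: "z \<in> sumset K n" "w \<in> K" "y = z + w" unfolding sumset_Suc_iff by blast
  then have "x + z \<in> sumset K (m + n)" using Suc by blast
  then have "\<exists>a\<in>sumset K (m + n). \<exists>b\<in>K. x + y = a + b"
    using z by (intro bexI[of _ "x + z"] bexI[of _ w]) (simp_all add: add.assoc)
  then show ?case unfolding add_Suc_right sumset_Suc_iff .
qed simp

lemma sumset_minus:
  assumes "symmetric_set K" shows "x \<in> sumset K n \<Longrightarrow> - x \<in> sumset K n"
proof (induction n arbitrary: x)
  case (Suc n)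
  then obtain z w where z: "z \<in> sumset K n" "w \<in> K" "x = z + w" unfolding sumset_Suc_iff by blast
  then have "- z \<in> sumset K n" "- w \<in> K" "- x = - z + - w"
    using Suc assms by (auto simp: symmetric_set_def)
  then show ?case unfolding sumset_Suc_iff by blast
qed simp

lemma sumset_subset_generated: "sumset K n \<subseteq> generated K"
  by (auto simp: generated_def)

lemma subset_generated: "K \<subseteq> generated K"
  using sumset_subset_generated[of K "Suc 0"] by simp

lemma additive_subgroup_generated:
  assumes "symmetric_set K" shows "additive_subgroup (generated K)"
  unfolding additive_subgroup_def
proof (intro conjI ballI)
  show "0 \<in> generated K" using sumset_subset_generated[of K 0] by simp
  fix x y assume "x \<in> generated K" "y \<in> generated K"
  then obtain m n where "x \<in> sumset K m" "y \<in> sumset K n" by (auto simp: generated_def)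
  then have "x + - y \<in> sumset K (m + n)" by (intro sumset_add sumset_minus[OF assms])
  then show "x - y \<in> generated K" using sumset_subset_generated by auto
qed

lemma generated_minimal:
  assumes "additive_subgroup H" "K \<subseteq> H" shows "generated K \<subseteq> H"
proof -
  have "sumset K n \<subseteq> H" for n
  proof (induction n)
    case (Suc n)
    then show ?case using additive_subgroup_add[OF assms(1)] assms(2) by (auto simp: sumset.simps(2))
  qed (simp add: additive_subgroup_0 assms)
  then show ?thesis by (auto simp: generated_def)
qed

lemma compact_sumset:
  fixes K :: "'a::topological_ab_group_add set"
  assumes "compact K" shows "compact (sumset K n)"
proof (induction n)
  case (Suc n)
  have "continuous_on (sumset K n \<times> K) (\<lambda>(x, y). x + y)"
    unfolding case_prod_unfold by (intro continuous_intros)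
  then show ?case using compact_continuous_image compact_Times[OF Suc assms] by (auto simp: sumset.simps(2))
qed simp

text \<open>
  A finite set \<open>F\<close> with \<open>K + K \<subseteq> F + K\<close> exists for a compact neighbourhood \<open>K\<close> of 0. By
  \<open>additive_on_zero\<close>, a bounded homomorphism on the group generated by \<open>K\<close> is determined by its values
  on \<open>F\<close>, so the real homomorphisms on a compactly generated group form a finite-dimensional space.
  The elements of \<open>F\<close> are taken from \<open>K + K\<close> to keep the argument valid for local homomorphisms.
\<close>
definition doubling_net :: "'a::ab_group_add set \<Rightarrow> 'a set \<Rightarrow> bool" where
  "doubling_net K F \<longleftrightarrow> finite F \<and> F \<subseteq> sumset K 2 \<and> (\<forall>x\<in>K. \<forall>y\<in>K. \<exists>f\<in>F. x + y - f \<in> K)"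

lemma doubling_net_exists:
  fixes K :: "'a::topological_ab_group_add set"
  assumes "compact K" "0 \<in> interior K"
  obtains F where "doubling_net K F"
proof -
  have "compact (sumset K 2)" by (rule compact_sumset[OF assms(1)])
  moreover have "open ((\<lambda>z. z - f) -` interior K)" for f
    by (intro open_vimage continuous_intros) auto
  moreover have "sumset K 2 \<subseteq> (\<Union>f\<in>sumset K 2. (\<lambda>z. z - f) -` interior K)"
    using assms(2) by auto
  ultimately obtain F where F: "F \<subseteq> sumset K 2" "finite F"
    "sumset K 2 \<subseteq> (\<Union>f\<in>F. (\<lambda>z. z - f) -` interior K)"
    by (rule compactE_image)
  have "\<exists>f\<in>F. x + y - f \<in> K" if "x \<in> K" "y \<in> K" for x y
  proof -
    have "x + y \<in> sumset K 2" using sumset_add[of x K 1 y 1] that by (simp add: numeral_2_eq_2)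
    with F(3) show ?thesis using interior_subset by blast
  qed
  with F have "doubling_net K F" unfolding doubling_net_def by blast
  then show ?thesis by (rule that)
qed

text \<open>
  For \<open>x\<close> in \<open>K\<close> write \<open>2x = f + k\<close> with \<open>f\<close> in \<open>F\<close>. Then \<open>2 h(x) = h(k)\<close>, so the supremum of
  \<open>\<bar>h\<bar>\<close> on \<open>K\<close> is at most half of itself.
\<close>
lemma additive_on_zero:
  assumes F: "doubling_net K F" and K: "0 \<in> K" and j: "j \<ge> 3"
    and add: "additive_on (sumset K j) h" and bdd: "\<And>x. x \<in> K \<Longrightarrow> \<bar>h x\<bar> \<le> B"
    and zero: "\<And>f. f \<in> F \<Longrightarrow> h f = 0"
    and x: "x \<in> sumset K j"
  shows "h x = 0"
proof -
  have sub: "sumset K i \<subseteq> sumset K j" if "i \<le> j" for i using sumset_mono[OF K that] .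
  have K1: "K \<subseteq> sumset K j" using sub[of "Suc 0"] j by simp
  have K2: "sumset K 2 \<subseteq> sumset K j" by (rule sub) (use j in simp)
  define s where "s = (SUP x\<in>K. \<bar>h x\<bar>)"
  have bd: "bdd_above ((\<lambda>x. \<bar>h x\<bar>) ` K)" using bdd by (auto intro!: bdd_aboveI2)
  have le: "\<bar>h x\<bar> \<le> s" if "x \<in> K" for x unfolding s_def using cSUP_upper[OF that bd] .
  have half: "\<bar>h x\<bar> \<le> s / 2" if x: "x \<in> K" for x
  proof -
    have "\<exists>f\<in>F. x + x - f \<in> K" using F x unfolding doubling_net_def by blast
    then obtain f where f: "f \<in> F" "x + x - f \<in> K" by blast
    let ?k = "x + x - f"
    have xx: "x + x \<in> sumset K j"
      using sumset_add[of x K 1 x 1] x K2 by (auto simp: numeral_2_eq_2)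
    have "f \<in> sumset K j" using F f K2 by (auto simp: doubling_net_def)
    then have "h (f + ?k) = h f + h ?k"
      using additive_onD[OF add, of f ?k] f(2) K1 xx by auto
    moreover have "h (x + x) = h x + h x" using additive_onD[OF add, of x x] x K1 xx by auto
    ultimately have "2 * h x = h ?k" using zero[OF f(1)] by simp
    with le[OF f(2)] show ?thesis by simp
  qed
  have "s \<le> s / 2" unfolding s_def using half K by (intro cSUP_least) (auto simp: s_def)
  moreover have "0 \<le> s" using le[OF K] by linarith
  ultimately have "s = 0" by linarith
  with le have hK: "h x = 0" if "x \<in> K" for x using that by fastforce
  have "h x = 0" if "i \<le> j" "x \<in> sumset K i" for i
    using that
  proof (induction i arbitrary: x)
    case 0
    then show ?case using hK[OF K] by simp
  next
    case (Suc i)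
    then obtain z w where z: "z \<in> sumset K i" "w \<in> K" "x = z + w" unfolding sumset_Suc_iff by blast
    have "z \<in> sumset K j" "w \<in> sumset K j" "z + w \<in> sumset K j"
      using z Suc.prems sub[of i] sub[of "Suc i"] K1 by auto
    then have "h x = h z + h w" using additive_onD[OF add] z(3) by simp
    with Suc z hK show ?case by simp
  qed
  with x show ?thesis by blast
qed

lemma additive_on_subset: "additive_on A h \<Longrightarrow> B \<subseteq> A \<Longrightarrow> additive_on B h"
  by (auto simp: additive_on_def)

lemma additive_on_lincomb:
  "additive_on A h \<Longrightarrow> additive_on A g \<Longrightarrow> additive_on A (\<lambda>x. a * h x + b * g x)"
  by (auto simp: additive_on_def algebra_simps)

lemma additive_on_diff: "additive_on A h \<Longrightarrow> additive_on A g \<Longrightarrow> additive_on A (\<lambda>x. h x - g x)"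
  using additive_on_lincomb[of A h g 1 "-1"] by simp

lemma additive_on_generated_zero:
  assumes F: "doubling_net K F" and K: "0 \<in> K"
    and add: "additive_on (generated K) h" and bdd: "\<And>x. x \<in> K \<Longrightarrow> \<bar>h x\<bar> \<le> B"
    and zero: "\<And>f. f \<in> F \<Longrightarrow> h f = 0"
    and x: "x \<in> generated K"
  shows "h x = 0"
proof -
  obtain n where "x \<in> sumset K n" using x by (auto simp: generated_def)
  then have "x \<in> sumset K (max n 3)" using sumset_mono[OF K, of n "max n 3"] by auto
  then show ?thesis
    by (intro additive_on_zero[OF F K max.cobounded2 additive_on_subset[OF add sumset_subset_generated] bdd zero])
qed

lemma additive_on_multiple:
  assumes H: "additive_subgroup H" and h: "additive_on H h" and x: "x \<in> H"
  shows "h (multiple n x) = real n * h x"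
proof (induction n)
  case 0
  have "h (0 + 0) = h 0 + h 0" using additive_onD[OF h, of 0 0] additive_subgroup_0[OF H] by simp
  then show ?case by simp
next
  case (Suc n)
  have "h (x + multiple n x) = h x + h (multiple n x)"
    using additive_onD[OF h x] additive_subgroup_multiple[OF H x] additive_subgroup_add[OF H x] by simp
  with Suc show ?case by (simp add: algebra_simps)
qed

lemma continuous_on_additive_on:
  fixes h :: "'a::{topological_ab_group_add, t2_space} \<Rightarrow> real"
  assumes H: "additive_subgroup H" "0 \<in> interior H" and h: "additive_on H h" and c: "isCont h 0"
  shows "continuous_on H h"
proof (rule continuous_at_imp_continuous_on, intro ballI)
  fix x assume x: "x \<in> H"
  have "isCont (\<lambda>y. y - x) x" by (intro continuous_intros)
  then have "isCont (\<lambda>y. h (y - x)) x"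
    using isCont_o2[where f = "\<lambda>y. y - x" and g = h and a = x] c by simp
  then have "isCont (\<lambda>y. h x + h (y - x)) x" by (intro continuous_intros)
  moreover have "\<forall>\<^sub>F y in nhds x. h y = h x + h (y - x)"
  proof -
    have "open ((\<lambda>y. y - x) -` interior H)" by (intro open_vimage continuous_intros) auto
    moreover have "x \<in> (\<lambda>y. y - x) -` interior H" using H by simp
    moreover have "h y = h x + h (y - x)" if "y \<in> (\<lambda>y. y - x) -` interior H" for y
    proof -
      have "y - x \<in> H" using that interior_subset by blast
      moreover have "y = (y - x) + x" by simp
      ultimately show ?thesis
        using h x additive_subgroup_add[OF H(1)] unfolding additive_on_def by (metis add.commute)
    qed
    ultimately show ?thesis unfolding eventually_nhds by blast
  qed
  ultimately show "isCont h x" using isCont_cong by metis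
qed

section \<open>Real homomorphisms and characters\<close>

definition real_homs :: "('a::topological_ab_group_add \<Rightarrow> real) set" where
  "real_homs = {\<phi>. continuous_on UNIV \<phi> \<and> (\<forall>x y. \<phi> (x + y) = \<phi> x + \<phi> y)}"

lemma real_homs_additive_on: "\<phi> \<in> real_homs \<Longrightarrow> additive_on A \<phi>"
  by (auto simp: real_homs_def additive_on_def)

lemma real_homs_lincomb:
  "\<phi> \<in> real_homs \<Longrightarrow> \<psi> \<in> real_homs \<Longrightarrow> (\<lambda>x. a * \<phi> x + b * \<psi> x) \<in> real_homs"
  by (auto simp: real_homs_def algebra_simps intro!: continuous_intros)

lemma real_homs_bounded:
  assumes "\<phi> \<in> real_homs" "compact K"
  obtains B where "\<And>x. x \<in> K \<Longrightarrow> \<bar>\<phi> x\<bar> \<le> B"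
proof -
  have "continuous_on K \<phi>"
    using assms(1) continuous_on_subset[of UNIV \<phi> K] by (simp add: real_homs_def)
  then have "compact (\<phi> ` K)" by (rule compact_continuous_image) (rule assms(2))
  then obtain B where "\<forall>y\<in>\<phi> ` K. norm y \<le> B" using compact_imp_bounded bounded_iff by blast
  then show ?thesis using that[of B] by simp
qed

lemma characters_iff: "\<gamma> \<in> characters \<longleftrightarrow> continuous_on UNIV \<gamma> \<and> character_on UNIV \<gamma>"
  by (auto simp: characters_def character_on_def additive_subgroup_def)

lemma character_continuousI:
  fixes \<gamma> :: "'a::{topological_ab_group_add, t2_space} \<Rightarrow> complex"
  assumes "character_on UNIV \<gamma>" "isCont \<gamma> 0"
  shows "\<gamma> \<in> characters"
proof -
  have "isCont \<gamma> x" for x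
  proof -
    have eq: "\<gamma> = (\<lambda>y. \<gamma> x * \<gamma> (y - x))"
    proof
      fix y
      show "\<gamma> y = \<gamma> x * \<gamma> (y - x)" using character_onD(3)[OF assms(1), of x "y - x"] by simp
    qed
    have "isCont (\<lambda>y. y - x) x" by (intro continuous_intros)
    then have "isCont (\<lambda>y. \<gamma> (y - x)) x"
      using isCont_o2[where f = "\<lambda>y. y - x" and g = \<gamma> and a = x] assms(2) by simp
    then have "isCont (\<lambda>y. \<gamma> x * \<gamma> (y - x)) x" by (intro continuous_intros)
    then show ?thesis by (subst eq)
  qed
  then show ?thesis using assms(1) by (simp add: characters_iff continuous_at_imp_continuous_on)
qed

lemma cis_real_homs: "\<phi> \<in> real_homs \<Longrightarrow> (\<lambda>x. cis (\<phi> x)) \<in> characters"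
  by (auto simp: real_homs_def characters_def cis_mult intro!: continuous_intros)

lemma characters_mult: "\<gamma> \<in> characters \<Longrightarrow> \<kappa> \<in> characters \<Longrightarrow> (\<lambda>x. \<gamma> x * \<kappa> x) \<in> characters"
  by (auto simp: characters_def norm_mult intro!: continuous_intros)

lemma characters_divide: "\<gamma> \<in> characters \<Longrightarrow> \<kappa> \<in> characters \<Longrightarrow> (\<lambda>x. \<gamma> x / \<kappa> x) \<in> characters"
proof -
  assume \<gamma>: "\<gamma> \<in> characters" and \<kappa>: "\<kappa> \<in> characters"
  have "\<kappa> x \<noteq> 0" for x
  proof
    assume "\<kappa> x = 0"
    moreover have "norm (\<kappa> x) = 1" using \<kappa> by (simp add: characters_def)
    ultimately show False by simp
  qed
  then show ?thesis
    using \<gamma> \<kappa> by (auto simp: characters_def norm_divide intro!: continuous_intros)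
qed

section \<open>Integer-valued homomorphisms\<close>

text \<open>
  The restrictions to the finite set \<open>F\<close> of the members of \<open>S j\<close> form a decreasing sequence of subspaces
  of a finite-dimensional space, so the sequence is eventually constant. The induction removes one
  point \<open>x\<close> of \<open>F\<close> and passes to the members that vanish at \<open>x\<close>.
\<close>
lemma stable_restrictions:
  fixes S :: "nat \<Rightarrow> ('b \<Rightarrow> real) set"
  assumes "finite F"
    and "\<And>j h g a. h \<in> S j \<Longrightarrow> g \<in> S j \<Longrightarrow> (\<lambda>x. h x + a * g x) \<in> S j"
    and "\<And>i j. i \<le> j \<Longrightarrow> S j \<subseteq> S i" and "\<And>j. (\<lambda>x. 0) \<in> S j"
  shows "\<exists>J. \<forall>j\<ge>J. \<forall>h\<in>S J. \<exists>g\<in>S j. \<forall>x\<in>F. g x = h x"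
  using assms
proof (induction F arbitrary: S rule: finite_induct)
  case empty
  then show ?case by blast
next
  case (insert x F)
  note lin = insert.prems(1) and dec = insert.prems(2) and zero = insert.prems(3)
  define S0 where "S0 j = {h \<in> S j. h x = 0}" for j
  have "\<exists>J. \<forall>j\<ge>J. \<forall>h\<in>S0 J. \<exists>g\<in>S0 j. \<forall>x\<in>F. g x = h x"
  proof (rule insert.IH)
    show "(\<lambda>x. h x + a * g x) \<in> S0 j" if "h \<in> S0 j" "g \<in> S0 j" for j h g a
      using lin that by (simp add: S0_def)
    show "S0 j \<subseteq> S0 i" if "i \<le> j" for i j
      using dec[OF that] by (auto simp: S0_def)
    show "(\<lambda>x. 0) \<in> S0 j" for j using zero by (simp add: S0_def)
  qed
  then obtain J where J: "\<And>j h. J \<le> j \<Longrightarrow> h \<in> S0 J \<Longrightarrow> \<exists>g\<in>S0 j. \<forall>x\<in>F. g x = h x" by blast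
  show ?case
  proof (cases "\<forall>j. \<exists>u\<in>S j. u x \<noteq> 0")
    case True
    have "\<exists>g\<in>S j. \<forall>y\<in>insert x F. g y = h y" if j: "j \<ge> J" and h: "h \<in> S J" for j h
    proof -
      obtain u where u: "u \<in> S j" "u x \<noteq> 0" using True by blast
      define c where "c = h x / u x"
      have "(\<lambda>y. h y + (- c) * u y) \<in> S0 J"
        using lin[OF h, of u "- c"] u dec[OF j] by (auto simp: S0_def c_def)
      from J[OF j this] obtain g where g: "g \<in> S j" "g x = 0" "\<And>y. y \<in> F \<Longrightarrow> g y = h y + (- c) * u y"
        by (auto simp: S0_def)
      have "(\<lambda>y. g y + c * u y) \<in> S j" by (rule lin[OF g(1) u(1)])
      moreover have "g y + c * u y = h y" if "y \<in> insert x F" for y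
        using that g u by (auto simp: c_def)
      ultimately show ?thesis by (intro bexI[of _ "\<lambda>y. g y + c * u y"] ballI)
    qed
    then show ?thesis by (intro exI[of _ J] allI impI ballI)
  next
    case False
    then obtain i where i: "\<And>u. u \<in> S i \<Longrightarrow> u x = 0" by blast
    have "\<exists>g\<in>S j. \<forall>y\<in>insert x F. g y = h y" if j: "j \<ge> max i J" and h: "h \<in> S (max i J)" for j h
    proof -
      have "h \<in> S0 J" "h x = 0" using dec[of i "max i J"] dec[of J "max i J"] h i by (auto simp: S0_def)
      with J[of j h] j obtain g where "g \<in> S0 j" "\<forall>y\<in>F. g y = h y" by auto
      with \<open>h x = 0\<close> show ?thesis by (intro bexI[of _ g]) (auto simp: S0_def)
    qed
    then show ?thesis by (intro exI[of _ "max i J"] allI impI ballI)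
  qed
qed

text \<open>
  The members of \<open>E\<close> are determined modulo \<open>D\<close> by their integer values on \<open>F\<close>, so \<open>E / D\<close> is a finitely
  generated abelian group. The last hypothesis says that it is divisible, and a finitely generated
  divisible group is trivial. The induction on \<open>F\<close> settles the values at one point \<open>x\<close> and leaves the
  functions that vanish there.
\<close>
lemma divisible_lattice_quotient_trivial:
  fixes D E :: "('b \<Rightarrow> real) set"
  assumes "finite F" and "D \<subseteq> E"
    and "\<And>h g. h \<in> E \<Longrightarrow> g \<in> E \<Longrightarrow> (\<lambda>x. h x - g x) \<in> E"
    and "\<And>h g n. h \<in> D \<Longrightarrow> g \<in> D \<Longrightarrow> (\<lambda>x. h x + of_int n * g x) \<in> D"
    and "\<And>h x. h \<in> E \<Longrightarrow> x \<in> F \<Longrightarrow> h x \<in> \<int>"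
    and "\<And>h. h \<in> E \<Longrightarrow> (\<And>x. x \<in> F \<Longrightarrow> h x = 0) \<Longrightarrow> h \<in> D"
    and "\<And>h k. h \<in> E \<Longrightarrow> k \<ge> (1::nat) \<Longrightarrow> \<exists>d\<in>D. \<exists>e\<in>E. \<forall>x. h x = d x + real k * e x"
  shows "E \<subseteq> D"
  using assms
proof (induction F arbitrary: D E rule: finite_induct)
  case empty
  then show ?case by blast
next
  case (insert x F)
  note sub = insert.prems(1) and E = insert.prems(2) and D = insert.prems(3)
    and int = insert.prems(4) and zero = insert.prems(5) and div = insert.prems(6)
  have hit: "\<exists>d\<in>D. d x = h x" if h: "h \<in> E" for h
  proof (cases "\<forall>d\<in>D. d x = 0")
    case True
    obtain n :: int where n: "h x = of_int n" using int[OF h, of x] by (meson Ints_cases insertI1)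
    \<comment> \<open>Here \<open>h x\<close> is divisible by an integer that is larger than \<open>\<bar>h x\<bar>\<close>.\<close>
    obtain d e where de: "d \<in> D" "e \<in> E" "h x = d x + real (nat \<bar>n\<bar> + 1) * e x"
      using div[OF h, of "nat \<bar>n\<bar> + 1"] le_add2 by metis
    obtain m :: int where m: "e x = of_int m" using int[OF de(2), of x] by (meson Ints_cases insertI1)
    have "d x = 0" using True de(1) by blast
    then have "real_of_int n = of_int ((\<bar>n\<bar> + 1) * m)" using de(3) n m by (simp add: add.commute)
    then have "n = (\<bar>n\<bar> + 1) * m" using of_int_eq_iff by blast
    then have *: "\<bar>n\<bar> = (\<bar>n\<bar> + 1) * \<bar>m\<bar>"
      using abs_mult[of "\<bar>n\<bar> + 1" m] by simp
    have "m = 0"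
    proof (rule ccontr)
      assume "m \<noteq> 0"
      then have "(\<bar>n\<bar> + 1) * 1 \<le> (\<bar>n\<bar> + 1) * \<bar>m\<bar>" by (intro mult_left_mono) auto
      then have "\<bar>n\<bar> + 1 \<le> \<bar>n\<bar>" unfolding *[symmetric] by simp
      then show False by simp
    qed
    then have "h x = 0" using n \<open>n = (\<bar>n\<bar> + 1) * m\<close> by simp
    with \<open>d x = 0\<close> de(1) show ?thesis by (intro bexI[of _ d]) auto
  next
    case False
    then obtain d0 where d0: "d0 \<in> D" "d0 x \<noteq> 0" by blast
    obtain p :: int where p: "d0 x = of_int p" using int[of d0 x] d0 sub by (meson Ints_cases insertI1 subsetD)
    have "nat \<bar>p\<bar> \<ge> 1" using d0(2) p by auto
    \<comment> \<open>With \<open>k = \<bar>p\<bar>\<close> the term \<open>k * e x\<close> is an integer multiple of \<open>d0 x\<close>.\<close>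
    then obtain d e where de: "d \<in> D" "e \<in> E" "h x = d x + real (nat \<bar>p\<bar>) * e x"
      using div[OF h, of "nat \<bar>p\<bar>"] by blast
    obtain m :: int where m: "e x = of_int m" using int[OF de(2), of x] by (meson Ints_cases insertI1)
    have "real (nat \<bar>p\<bar>) = of_int (sgn p * p)" by (simp add: sgn_if)
    then have "real (nat \<bar>p\<bar>) * e x = of_int (sgn p * m) * d0 x" by (simp add: m p)
    then have "d x + of_int (sgn p * m) * d0 x = h x" using de(3) by simp
    then show ?thesis
      using D[OF de(1) d0(1), of "sgn p * m"]
      by (intro bexI[of _ "\<lambda>y. d y + of_int (sgn p * m) * d0 y"])
  qed
  define D0 E0 where "D0 = {h \<in> D. h x = 0}" and "E0 = {h \<in> E. h x = 0}"
  have "E0 \<subseteq> D0"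
  proof (rule insert.IH)
    show "D0 \<subseteq> E0" using sub by (auto simp: D0_def E0_def)
    show "(\<lambda>y. h y - g y) \<in> E0" if "h \<in> E0" "g \<in> E0" for h g using that E by (auto simp: E0_def)
    show "(\<lambda>y. h y + of_int n * g y) \<in> D0" if "h \<in> D0" "g \<in> D0" for h g n
      using that D by (auto simp: D0_def)
    show "h y \<in> \<int>" if "h \<in> E0" "y \<in> F" for h y using that int by (auto simp: E0_def)
    show "h \<in> D0" if "h \<in> E0" "\<And>y. y \<in> F \<Longrightarrow> h y = 0" for h
      using that zero[of h] by (auto simp: E0_def D0_def)
  next
    fix h :: "'b \<Rightarrow> real" and k :: nat assume h: "h \<in> E0" and k: "k \<ge> 1"
    then obtain d e where de: "d \<in> D" "e \<in> E" "\<And>y. h y = d y + real k * e y"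
      using div[of h k] by (auto simp: E0_def)
    obtain d' where d': "d' \<in> D" "d' x = e x" using hit[OF de(2)] by blast
    have "(\<lambda>y. d y + of_int (int k) * d' y) \<in> D" by (rule D[OF de(1) d'(1)])
    moreover have "(\<lambda>y. e y - d' y) \<in> E" using E[OF de(2)] d'(1) sub by auto
    moreover have "d x + real k * d' x = 0" using de(3)[of x] d'(2) h by (simp add: E0_def)
    ultimately have "(\<lambda>y. d y + of_int (int k) * d' y) \<in> D0" "(\<lambda>y. e y - d' y) \<in> E0"
      using d'(2) by (auto simp: D0_def E0_def)
    then show "\<exists>d\<in>D0. \<exists>e\<in>E0. \<forall>y. h y = d y + real k * e y"
      by (intro bexI[of _ "\<lambda>y. d y + of_int (int k) * d' y"] bexI[of _ "\<lambda>y. e y - d' y"])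
        (auto simp: de(3) algebra_simps)
  qed
  show ?case
  proof
    fix h assume h: "h \<in> E"
    obtain d where d: "d \<in> D" "d x = h x" using hit[OF h] by blast
    have "(\<lambda>y. h y - d y) \<in> E0" using E[OF h] d sub by (auto simp: E0_def)
    then have "(\<lambda>y. h y - d y) \<in> D" using \<open>E0 \<subseteq> D0\<close> by (auto simp: D0_def)
    from D[OF this d(1), of 1] show "h \<in> D" by simp
  qed
qed

text \<open>
  A compactly generated group is treated here as if it were finitely presented. Bounded local
  homomorphisms on \<open>sumset K j\<close> with \<open>j \<ge> 3\<close> are determined by their values on the finite set \<open>F\<close>. By
  \<open>stable_restrictions\<close> there is a stage from which on the possible values on \<open>F\<close> no longer change; a
  local homomorphism of that stage therefore extends to all later sumsets, uniquely, and the
  extensions fit together.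
\<close>
lemma local_hom_extends:
  assumes F: "doubling_net K F" and K: "0 \<in> K"
  obtains J where "J \<ge> 1" "\<And>h B. additive_on (sumset K J) h \<Longrightarrow> (\<And>x. x \<in> K \<Longrightarrow> \<bar>h x\<bar> \<le> B) \<Longrightarrow>
    \<exists>g. additive_on (generated K) g \<and> (\<forall>x\<in>sumset K J. g x = h x)"
proof -
  define S where "S j = {h. additive_on (sumset K (j + 3)) h \<and> (\<exists>B. \<forall>x\<in>K. \<bar>h x\<bar> \<le> B)}" for j
  have "\<exists>J. \<forall>j\<ge>J. \<forall>h\<in>S J. \<exists>g\<in>S j. \<forall>x\<in>F. g x = h x"
  proof (rule stable_restrictions)
    show "finite F" using F by (simp add: doubling_net_def)
    show "(\<lambda>x. h x + a * g x) \<in> S j" if hg: "h \<in> S j" "g \<in> S j" for h g a j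
    proof -
      obtain B C where BC: "\<And>x. x \<in> K \<Longrightarrow> \<bar>h x\<bar> \<le> B" "\<And>x. x \<in> K \<Longrightarrow> \<bar>g x\<bar> \<le> C"
        using hg unfolding S_def by blast
      have "\<bar>h x + a * g x\<bar> \<le> B + \<bar>a\<bar> * C" if "x \<in> K" for x
      proof -
        have "\<bar>a * g x\<bar> \<le> \<bar>a\<bar> * C" using BC(2)[OF that] by (simp add: abs_mult mult_left_mono)
        with BC(1)[OF that] show ?thesis by linarith
      qed
      moreover have "additive_on (sumset K (j + 3)) (\<lambda>x. h x + a * g x)"
        using additive_on_lincomb[of _ h g 1 a] hg by (simp add: S_def)
      ultimately show ?thesis unfolding S_def by (intro CollectI conjI exI[of _ "B + \<bar>a\<bar> * C"] ballI)
    qed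
    show "S j \<subseteq> S i" if "i \<le> j" for i j
      using additive_on_subset sumset_mono[OF K, of "i + 3" "j + 3"] that unfolding S_def by auto
    show "(\<lambda>x. 0) \<in> S j" for j by (auto simp: S_def additive_on_def)
  qed
  then obtain J where J: "\<And>j h. j \<ge> J \<Longrightarrow> h \<in> S J \<Longrightarrow> \<exists>g\<in>S j. \<forall>x\<in>F. g x = h x" by blast
  have uniq: "h x = g x"
    if "h \<in> S i" "g \<in> S j" "i \<le> j" "\<And>f. f \<in> F \<Longrightarrow> h f = g f" "x \<in> sumset K (i + 3)" for h g i j x
  proof -
    from that(1,2) obtain B C where BC: "\<And>x. x \<in> K \<Longrightarrow> \<bar>h x\<bar> \<le> B" "\<And>x. x \<in> K \<Longrightarrow> \<bar>g x\<bar> \<le> C"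
      unfolding S_def by blast
    have "additive_on (sumset K (i + 3)) g"
      using that(2,3) additive_on_subset[of "sumset K (j + 3)" g] sumset_mono[OF K, of "i + 3" "j + 3"]
      by (simp add: S_def)
    then have add: "additive_on (sumset K (i + 3)) (\<lambda>x. h x - g x)"
      using that(1) additive_on_diff[of "sumset K (i + 3)" h g] by (simp add: S_def)
    have bd: "\<bar>h x - g x\<bar> \<le> B + C" if "x \<in> K" for x using BC[OF that] by linarith
    have "h x - g x = 0"
      by (rule additive_on_zero[OF F K _ add bd _ that(5)]) (use that(4) in auto)
    then show ?thesis by simp
  qed
  show ?thesis
  proof (rule that[of "J + 3"])
    show "1 \<le> J + 3" by simp
  next
    fix h B assume h: "additive_on (sumset K (J + 3)) h" "\<And>x. x \<in> K \<Longrightarrow> \<bar>h x\<bar> \<le> (B::real)"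
    have hS: "h \<in> S J" using h unfolding S_def by blast
    have "\<forall>j. \<exists>g. J \<le> j \<longrightarrow> g \<in> S j \<and> (\<forall>x\<in>F. g x = h x)" using J[OF _ hS] by blast
    from choice[OF this] obtain g where g: "\<forall>j. J \<le> j \<longrightarrow> g j \<in> S j \<and> (\<forall>x\<in>F. g j x = h x)" by blast
    then have gS: "\<And>j. j \<ge> J \<Longrightarrow> g j \<in> S j" and gF: "\<And>j x. j \<ge> J \<Longrightarrow> x \<in> F \<Longrightarrow> g j x = h x"
      by blast+
    \<comment> \<open>The members \<open>g n\<close> agree wherever two of them are local homomorphisms, so taking the
      least index is only one possible choice.\<close>
    define G where "G x = g (LEAST n. J \<le> n \<and> x \<in> sumset K (n + 3)) x" for x
    have G: "G x = g n x" if n: "J \<le> n" "x \<in> sumset K (n + 3)" for x n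
    proof -
      let ?n = "LEAST n. J \<le> n \<and> x \<in> sumset K (n + 3)"
      have "J \<le> ?n" "x \<in> sumset K (?n + 3)" "?n \<le> n"
        using LeastI[of "\<lambda>n. J \<le> n \<and> x \<in> sumset K (n + 3)" n] n Least_le[of "\<lambda>n. J \<le> n \<and> x \<in> sumset K (n + 3)" n]
        by auto
      then show ?thesis unfolding G_def using n uniq[of "g ?n" ?n "g n" n x] gS gF by simp
    qed
    have "additive_on (generated K) G"
      unfolding additive_on_def
    proof (intro ballI impI)
      fix x y assume "x \<in> generated K" "y \<in> generated K" "x + y \<in> generated K"
      then obtain a b c where abc: "x \<in> sumset K a" "y \<in> sumset K b" "x + y \<in> sumset K c"
        by (auto simp: generated_def)
      define n where "n = J + a + b + c"
      have "x \<in> sumset K (n + 3)" "y \<in> sumset K (n + 3)" "x + y \<in> sumset K (n + 3)"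
        using abc sumset_mono[OF K, of a "n + 3"] sumset_mono[OF K, of b "n + 3"]
          sumset_mono[OF K, of c "n + 3"] by (auto simp: n_def)
      moreover have "J \<le> n" by (simp add: n_def)
      moreover have "additive_on (sumset K (n + 3)) (g n)" using gS[OF \<open>J \<le> n\<close>] by (simp add: S_def)
      ultimately show "G (x + y) = G x + G y" by (simp add: G additive_onD)
    qed
    moreover have "G x = h x" if "x \<in> sumset K (J + 3)" for x
      using G[OF order_refl that] uniq[of "g J" J h J x] gS gF hS that by simp
    ultimately show "\<exists>g. additive_on (generated K) g \<and> (\<forall>x\<in>sumset K (J + 3). g x = h x)" by blast
  qed
qed

section \<open>Small characters have small lifts\<close>

lemma cis_eq_imp_Ints: "cis a = cis b \<Longrightarrow> (a - b) / (2 * pi) \<in> \<int>"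
proof -
  assume "cis a = cis b"
  then have "cis (a - b) = 1" by (simp flip: cis_divide)
  then have "cos (a - b) = 1" by (metis cis.simps(1) one_complex.simps(1))
  then obtain n :: int where "a - b = n * 2 * pi" by (auto simp: cos_one_2pi_int)
  then show ?thesis by simp
qed

lemma cis_add_Ints: "n \<in> \<int> \<Longrightarrow> cis (a + 2 * pi * n) = cis a"
  using cis_mult[of a "2 * pi * n"] by (simp add: cis_multiple_2pi)

lemma norm_cis_minus_1_le: "norm (cis t - 1) \<le> \<bar>t\<bar>"
proof -
  have "norm (cis t - 1) = 2 * \<bar>sin (t / 2)\<bar>"
    using dist_exp_i_1[of t] by (simp add: cis_conv_exp mult.commute)
  also have "\<dots> \<le> \<bar>t\<bar>" using abs_sin_x_le_abs_x[of "t / 2"] by simp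
  finally show ?thesis .
qed

lemma cis_Arg_of_cis: "cis (Arg (cis t)) = cis t"
proof -
  have "cis (Arg (cis t)) = sgn (cis t)" by (rule cis_Arg) simp
  also have "sgn (cis t) = cis t" by (simp only: sgn_eq norm_cis) simp
  finally show ?thesis .
qed

lemma abs_Arg_cis_le:
  assumes "norm (cis t - 1) < 1 / 2" shows "\<bar>Arg (cis t)\<bar> \<le> 2 * norm (cis t - 1)"
proof -
  have "\<bar>Arg (cis t)\<bar> \<le> norm (Ln (1 + (cis t - 1)))"
    using abs_Im_le_cmod[of "Ln (cis t)"] by (simp add: Arg_eq_Im_Ln)
  also have "\<dots> \<le> 2 * norm (cis t - 1)" by (rule norm_Ln_le[OF assms])
  finally show ?thesis .
qed

lemma interior_generated:
  "0 \<in> interior K \<Longrightarrow> 0 \<in> interior (generated K)"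
  using subsetD[OF interior_mono[OF subset_generated[of K]]] .

lemma isCont_if_constant_near_0:
  fixes h :: "'a::{topological_ab_group_add, t2_space} \<Rightarrow> 'b::t2_space"
  assumes "0 \<in> interior H" "\<And>x. x \<in> H \<Longrightarrow> h x = c" shows "isCont h 0"
proof -
  have "\<forall>\<^sub>F x in nhds 0. h x = c"
    using assms interior_subset unfolding eventually_nhds by (intro exI[of _ "interior H"]) auto
  from isCont_cong[OF this] show ?thesis by simp
qed

text \<open>
  On \<open>sumset K J\<close> write \<open>\<phi> = \<theta> + 2 pi h\<close> with the small principal argument \<open>\<theta>\<close> of \<open>cis \<circ> \<phi>\<close> and an
  integer-valued \<open>h\<close>. As \<open>\<theta>\<close> is small, it is additive up to an error less than \<open>2 pi\<close>, hence \<open>h\<close> is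
  a local homomorphism. By \<open>local_hom_extends\<close> it comes from a homomorphism on the whole group
  generated by \<open>K\<close>. The bound 1 on \<open>\<epsilon>\<close> is there because \<open>3 < 2 pi\<close>.
\<close>
lemma small_character_integer_part:
  fixes K :: "'a::{topological_ab_group_add, t2_space} set"
  assumes K: "compact K" "symmetric_set K" "0 \<in> interior K" and \<epsilon>: "0 < \<epsilon>" "\<epsilon> \<le> 1"
  obtains J where "\<And>\<phi>. \<phi> \<in> real_homs \<Longrightarrow> (\<And>x. x \<in> sumset K J \<Longrightarrow> norm (cis (\<phi> x) - 1) < \<epsilon> / 2) \<Longrightarrow>
    \<exists>g. additive_on (generated K) g \<and> continuous_on (generated K) g \<and> (\<forall>x\<in>generated K. g x \<in> \<int>) \<and>
      (\<forall>x\<in>K. \<bar>\<phi> x - 2 * pi * g x\<bar> \<le> \<epsilon>)"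
proof -
  obtain F where F: "doubling_net K F" using doubling_net_exists[OF K(1,3)] .
  have K0: "0 \<in> K" using K(2) by (simp add: symmetric_set_def)
  note H = additive_subgroup_generated[OF K(2)]
  obtain J where J1: "J \<ge> 1" and J: "\<And>h B. additive_on (sumset K J) h \<Longrightarrow> (\<And>x. x \<in> K \<Longrightarrow> \<bar>h x\<bar> \<le> B) \<Longrightarrow>
    \<exists>g. additive_on (generated K) g \<and> (\<forall>x\<in>sumset K J. g x = h x)"
    using local_hom_extends[OF F K0] by metis
  have sub: "K \<subseteq> sumset K J"
    using sumset_mono[OF K0, of "Suc 0" J] J1 by simp
  show ?thesis
  proof (rule that[of J])
    fix \<phi> assume \<phi>: "\<phi> \<in> real_homs" and small: "\<And>x. x \<in> sumset K J \<Longrightarrow> norm (cis (\<phi> x) - 1) < \<epsilon> / 2"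
    define \<theta> where "\<theta> x = Arg (cis (\<phi> x))" for x
    define h where "h x = (\<phi> x - \<theta> x) / (2 * pi)" for x
    have \<phi>h: "\<phi> x = \<theta> x + 2 * pi * h x" for x by (simp add: h_def)
    have h_int: "h x \<in> \<int>" for x
      unfolding h_def \<theta>_def by (rule cis_eq_imp_Ints) (simp add: cis_Arg_of_cis)
    have \<theta>: "\<bar>\<theta> x\<bar> < \<epsilon>" if "x \<in> sumset K J" for x
      using abs_Arg_cis_le[of "\<phi> x"] small[OF that] \<epsilon> unfolding \<theta>_def by linarith
    have add: "additive_on (sumset K J) h"
      unfolding additive_on_def
    proof (intro ballI impI)
      fix x y assume xy: "x \<in> sumset K J" "y \<in> sumset K J" "x + y \<in> sumset K J"
      define m where "m = h (x + y) - h x - h y"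
      have "m \<in> \<int>" unfolding m_def by (intro Ints_diff h_int)
      have "\<phi> (x + y) = \<phi> x + \<phi> y" using \<phi> by (simp add: real_homs_def)
      then have "2 * pi * m = \<theta> x + \<theta> y - \<theta> (x + y)"
        unfolding \<phi>h m_def by (simp add: algebra_simps)
      then have "2 * pi * \<bar>m\<bar> = \<bar>\<theta> x + \<theta> y - \<theta> (x + y)\<bar>" by (metis abs_mult abs_of_pos pi_gt_zero zero_less_mult_iff zero_less_numeral)
      also have "\<dots> < 3" using \<theta>[OF xy(1)] \<theta>[OF xy(2)] \<theta>[OF xy(3)] \<epsilon> by linarith
      also have "3 < 2 * pi" using pi_gt3 by linarith
      finally have "\<bar>m\<bar> < 1" by simp
      with \<open>m \<in> \<int>\<close> have "m = 0" using Ints_nonzero_abs_less1 by blast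
      then show "h (x + y) = h x + h y" by (simp add: m_def)
    qed
    obtain B where B: "\<And>x. x \<in> K \<Longrightarrow> \<bar>\<phi> x\<bar> \<le> B" using real_homs_bounded[OF \<phi> K(1)] by blast
    have bd: "\<bar>h x\<bar> \<le> (B + 1) / (2 * pi)" if "x \<in> K" for x
    proof -
      have "\<bar>\<phi> x - \<theta> x\<bar> \<le> B + 1" using B[OF that] \<theta>[of x] sub that \<epsilon> by force
      then show ?thesis by (simp add: h_def divide_right_mono)
    qed
    obtain g where g: "additive_on (generated K) g" "\<And>x. x \<in> sumset K J \<Longrightarrow> g x = h x"
      using J[OF add bd] by blast
    have gK: "g x = h x" if "x \<in> K" for x using g(2) sub that by blast
    show "\<exists>g. additive_on (generated K) g \<and> continuous_on (generated K) g \<and> (\<forall>x\<in>generated K. g x \<in> \<int>) \<and>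
      (\<forall>x\<in>K. \<bar>\<phi> x - 2 * pi * g x\<bar> \<le> \<epsilon>)"
    proof (intro exI[of _ g] conjI ballI)
      show "additive_on (generated K) g" by (rule g(1))
      have cont: "isCont \<theta> 0"
      proof -
        have "isCont (\<lambda>x. cis (\<phi> x)) 0"
          using cis_real_homs[OF \<phi>] continuous_on_eq_continuous_at[of UNIV] by (auto simp: characters_def)
        moreover have "isCont Arg (cis (\<phi> 0))"
        proof -
          have "\<phi> (0 + 0) = \<phi> 0 + \<phi> 0" using \<phi> unfolding real_homs_def by blast
          then show ?thesis by (intro continuous_at_Arg) auto
        qed
        ultimately show ?thesis
          unfolding \<theta>_def using isCont_o2[where f = "\<lambda>x. cis (\<phi> x)" and g = Arg] by simp
      qed
      have "isCont h 0"
        unfolding h_def using cont \<phi> continuous_on_eq_continuous_at[of UNIV \<phi>]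
        by (intro continuous_intros) (auto simp: real_homs_def)
      moreover have "\<forall>\<^sub>F x in nhds 0. g x = h x"
        unfolding eventually_nhds using K(3) gK interior_subset by (intro exI[of _ "interior K"]) auto
      ultimately have "isCont g 0" using isCont_cong by metis
      then show "continuous_on (generated K) g"
        by (intro continuous_on_additive_on[OF H interior_generated[OF K(3)] g(1)])
    next
      fix x assume "x \<in> generated K"
      have "g x \<in> \<int>" if "x \<in> sumset K n" for x n
        using that
      proof (induction n arbitrary: x)
        case 0
        then show ?case using gK[OF K0] h_int by simp
      next
        case (Suc n)
        then obtain y z where yz: "y \<in> sumset K n" "z \<in> K" "x = y + z" unfolding sumset_Suc_iff by blast
        then have "y \<in> generated K" "z \<in> generated K"
          using sumset_subset_generated subset_generated by blast+
        then have "g x = g y + h z"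
          using additive_onD[OF g(1), of y z] additive_subgroup_add[OF H] yz gK by simp
        then show ?case using Suc.IH[OF yz(1)] h_int[of z] by simp
      qed
      with \<open>x \<in> generated K\<close> show "g x \<in> \<int>" by (auto simp: generated_def)
    next
      fix x assume x: "x \<in> K"
      then have "\<phi> x - 2 * pi * g x = \<theta> x" using gK[OF x] \<phi>h[of x] by simp
      then show "\<bar>\<phi> x - 2 * pi * g x\<bar> \<le> \<epsilon>" using \<theta>[of x] sub x by force
    qed
  qed
qed

text \<open>
  Purity of a subgroup \<open>H\<close> in the strong sense that the quotient by \<open>H\<close> is torsion-free.
\<close>
definition pure_subset :: "'a::ab_group_add set \<Rightarrow> bool" where
  "pure_subset H \<longleftrightarrow> (\<forall>n\<ge>1. \<forall>x. multiple n x \<in> H \<longrightarrow> x \<in> H)"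

lemma character_lift:
  fixes \<gamma> :: "'a::topological_ab_group_add \<Rightarrow> complex"
  assumes "characters \<subseteq> (\<lambda>\<phi> x. cis (\<phi> x)) ` (real_homs :: ('a \<Rightarrow> real) set)" "\<gamma> \<in> characters"
  obtains \<phi> where "\<phi> \<in> real_homs" "\<And>x. \<gamma> x = cis (\<phi> x)"
  using subsetD[OF assms] by auto

text \<open>
  Let \<open>h\<close> be an integer-valued homomorphism on the group generated by \<open>K\<close>. By purity and the
  injectivity of the circle group, the character \<open>cis (2 pi h / k)\<close> extends to a character of the
  whole group whose \<open>k\<close>-th power is trivial, and \<open>k / 2 pi\<close> times a lift of it is an integer-valued homomorphism congruent to \<open>h\<close>
  modulo \<open>k\<close>. So the obstruction group \<open>E / D\<close> below is divisible; since it is also finitely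
  generated, it vanishes. In the discrete case this is the argument that pure subgroups of finite
  rank of a Whitehead group, once they are free, are direct summands.
\<close>
lemma integer_homs_extend:
  fixes K :: "'a::{topological_ab_group_add, t2_space} set"
  assumes lift: "characters \<subseteq> (\<lambda>\<phi> x. cis (\<phi> x)) ` (real_homs :: ('a \<Rightarrow> real) set)"
    and K: "compact K" "symmetric_set K" "0 \<in> interior K"
    and pure: "pure_subset (generated K)"
    and g: "additive_on (generated K) g" "continuous_on (generated K) g" "\<forall>x\<in>generated K. g x \<in> \<int>"
  obtains \<nu> where "\<nu> \<in> real_homs" "\<And>x. \<nu> x \<in> \<int>" "\<And>x. x \<in> generated K \<Longrightarrow> \<nu> x = g x"
proof -
  obtain F where F: "doubling_net K F" using doubling_net_exists[OF K(1,3)] .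
  have K0: "0 \<in> K" using K(2) by (simp add: symmetric_set_def)
  note H = additive_subgroup_generated[OF K(2)]
  define E where "E = {h. additive_on (generated K) h \<and> continuous_on (generated K) h \<and> (\<forall>x\<in>generated K. h x \<in> \<int>)}"
  define D where "D = {h \<in> E. \<exists>\<nu>\<in>real_homs. (\<forall>x. \<nu> x \<in> \<int>) \<and> (\<forall>x\<in>generated K. \<nu> x = h x)}"
  have F_sub: "F \<subseteq> generated K" using F sumset_subset_generated unfolding doubling_net_def by blast
  have E_lin: "(\<lambda>x. h x + of_int n * k x) \<in> E" if "h \<in> E" "k \<in> E" for h k n
    using that additive_on_lincomb[of "generated K" h k 1 "of_int n"]
    by (auto simp: E_def intro!: continuous_intros)
  have "E \<subseteq> D"
  proof (rule divisible_lattice_quotient_trivial)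
    show "finite F" using F by (simp add: doubling_net_def)
    show "D \<subseteq> E" by (auto simp: D_def)
    show "(\<lambda>x. h x - k x) \<in> E" if "h \<in> E" "k \<in> E" for h k
      using E_lin[OF that, of "-1"] by simp
    show "(\<lambda>x. h x + of_int n * k x) \<in> D" if hk: "h \<in> D" "k \<in> D" for h k n
    proof -
      obtain \<nu> \<mu> where \<nu>: "\<nu> \<in> real_homs" "\<And>x. \<nu> x \<in> \<int>" "\<And>x. x \<in> generated K \<Longrightarrow> \<nu> x = h x"
        and \<mu>: "\<mu> \<in> real_homs" "\<And>x. \<mu> x \<in> \<int>" "\<And>x. x \<in> generated K \<Longrightarrow> \<mu> x = k x"
        using hk unfolding D_def by blast
      have "(\<lambda>x. \<nu> x + of_int n * \<mu> x) \<in> real_homs"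
        using real_homs_lincomb[OF \<nu>(1) \<mu>(1), of 1 "of_int n"] by simp
      moreover have "\<forall>x. \<nu> x + of_int n * \<mu> x \<in> \<int>" using \<nu>(2) \<mu>(2) by (simp add: Ints_mult)
      moreover have "\<forall>x\<in>generated K. \<nu> x + of_int n * \<mu> x = h x + of_int n * k x"
        using \<nu>(3) \<mu>(3) by simp
      moreover have "(\<lambda>x. h x + of_int n * k x) \<in> E" using E_lin hk by (simp add: D_def)
      ultimately show ?thesis
        unfolding D_def by (intro CollectI conjI bexI[of _ "\<lambda>x. \<nu> x + of_int n * \<mu> x"])
    qed
    show "h x \<in> \<int>" if "h \<in> E" "x \<in> F" for h x using that F_sub by (auto simp: E_def)
    show "h \<in> D" if h: "h \<in> E" "\<And>x. x \<in> F \<Longrightarrow> h x = 0" for h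
    proof -
      have add: "additive_on (generated K) h" using h(1) by (simp add: E_def)
      have "compact (h ` K)"
        using h(1) continuous_on_subset[OF _ subset_generated] K(1) by (auto simp: E_def intro: compact_continuous_image)
      then obtain B where "\<forall>y\<in>h ` K. norm y \<le> B" using compact_imp_bounded bounded_iff by blast
      then have B: "\<And>x. x \<in> K \<Longrightarrow> \<bar>h x\<bar> \<le> B" by simp
      have "h x = 0" if "x \<in> generated K" for x
        by (rule additive_on_generated_zero[OF F K0 add B h(2) that])
      moreover have "(\<lambda>x. 0) \<in> real_homs" by (simp add: real_homs_def)
      ultimately show ?thesis unfolding D_def using h(1) by (intro CollectI conjI bexI[of _ "\<lambda>x. 0"]) auto
    qed
  next
    fix h and k :: nat assume h: "h \<in> E" and k: "k \<ge> 1"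
    have add: "additive_on (generated K) h" using h by (simp add: E_def)
    define \<kappa> where "\<kappa> x = cis (2 * pi * (h x / k))" for x
    have \<kappa>: "character_on (generated K) \<kappa>"
      unfolding character_on_def \<kappa>_def
      using H additive_onD[OF add] additive_subgroup_add[OF H]
      by (simp add: cis_mult add_divide_distrib distrib_left)
    have "\<kappa> (multiple k y) = 1" if "multiple k y \<in> generated K" for y
    proof -
      have y: "y \<in> generated K" using pure k that unfolding pure_subset_def by blast
      have "h (multiple k y) / k = h y" using additive_on_multiple[OF H add y, of k] k by simp
      moreover have "h y \<in> \<int>" using h y by (simp add: E_def)
      ultimately show ?thesis using cis_add_Ints[of "h y" 0] by (simp add: \<kappa>_def)
    qed
    then obtain \<gamma> where \<gamma>: "character_on UNIV \<gamma>" "\<And>x. x \<in> generated K \<Longrightarrow> \<gamma> x = \<kappa> x" "\<And>y. \<gamma> y ^ k = 1"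
      using extend_character_trivial_on_multiples[OF \<kappa>, of k] by metis
    have "isCont \<gamma> 0"
    proof -
      have "continuous_on (interior (generated K)) \<kappa>"
        unfolding \<kappa>_def using h k continuous_on_subset[OF _ interior_subset[of "generated K"]]
        by (auto simp: E_def intro!: continuous_intros)
      then have "isCont \<kappa> 0"
        using continuous_on_eq_continuous_at[OF open_interior] interior_generated[OF K(3)] by blast
      moreover have "\<forall>\<^sub>F x in nhds 0. \<gamma> x = \<kappa> x"
        unfolding eventually_nhds using interior_generated[OF K(3)] \<gamma>(2) interior_subset
        by (intro exI[of _ "interior (generated K)"]) auto
      ultimately show ?thesis using isCont_cong by metis
    qed
    then obtain \<phi> where \<phi>: "\<phi> \<in> real_homs" "\<And>x. \<gamma> x = cis (\<phi> x)"
      using character_lift[OF lift character_continuousI[OF \<gamma>(1)]] by blast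
    define \<nu> where "\<nu> x = real k / (2 * pi) * \<phi> x" for x
    have \<nu>: "\<nu> \<in> real_homs"
      using real_homs_lincomb[OF \<phi>(1) \<phi>(1), of "real k / (2 * pi)" 0] by (simp add: \<nu>_def[abs_def])
    have \<nu>_int: "\<nu> x \<in> \<int>" for x
    proof -
      have "cis (real k * \<phi> x) = cis 0" using \<gamma>(3)[of x] by (simp add: \<phi>(2) Complex.DeMoivre)
      from cis_eq_imp_Ints[OF this] show ?thesis by (simp add: \<nu>_def)
    qed
    have "\<nu> \<in> D" unfolding D_def E_def using \<nu> \<nu>_int real_homs_additive_on[OF \<nu>]
      continuous_on_subset[of UNIV \<nu> "generated K"] by (auto simp: real_homs_def)
    moreover define e where "e x = (h x - \<nu> x) / k" for x
    moreover have "e \<in> E"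
    proof -
      have "e x \<in> \<int>" if x: "x \<in> generated K" for x
      proof -
        have "cis (2 * pi * (h x / k)) = cis (\<phi> x)" using \<gamma>(2)[OF x] \<phi>(2)[of x] by (simp add: \<kappa>_def)
        from cis_eq_imp_Ints[OF this] show ?thesis using k by (simp add: e_def \<nu>_def field_simps)
      qed
      moreover have "additive_on (generated K) e"
        using additive_on_lincomb[OF add real_homs_additive_on[OF \<nu>], of "1 / k" "- 1 / k"]
        by (simp add: e_def[abs_def] diff_divide_distrib)
      moreover have "continuous_on (generated K) e"
        unfolding e_def using h \<nu> k continuous_on_subset[of UNIV \<nu> "generated K"]
        by (auto simp: E_def real_homs_def intro!: continuous_intros)
      ultimately show ?thesis by (simp add: E_def)
    qed
    moreover have "\<forall>x. h x = \<nu> x + real k * e x" using k by (simp add: e_def)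
    ultimately show "\<exists>d\<in>D. \<exists>e\<in>E. \<forall>x. h x = d x + real k * e x" by blast
  qed
  moreover have "g \<in> E" using g by (simp add: E_def)
  ultimately show ?thesis using that unfolding D_def by blast
qed

text \<open>
  A real homomorphism with \<open>cis \<circ> \<phi> = 1\<close> on the group generated by \<open>K\<close> takes values in \<open>2 pi \<int>\<close> there,
  and it is determined there by the values on a finite set. So there are only countably many of
  them, up to their behaviour outside this group.
\<close>
lemma countable_trivial_phases:
  fixes K :: "'a::topological_ab_group_add set"
  assumes K: "compact K" "symmetric_set K" and F: "doubling_net K F"
  obtains e :: "nat \<Rightarrow> 'a \<Rightarrow> real" where
    "\<And>\<phi>. \<phi> \<in> real_homs \<Longrightarrow> (\<And>x. x \<in> generated K \<Longrightarrow> cis (\<phi> x) = 1) \<Longrightarrow>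
      \<exists>n. e n \<in> real_homs \<and> (\<forall>x\<in>generated K. \<phi> x = e n x)"
proof -
  have K0: "0 \<in> K" using K(2) by (simp add: symmetric_set_def)
  have F_sub: "F \<subseteq> generated K" using F sumset_subset_generated unfolding doubling_net_def by blast
  define P where "P = {\<phi> \<in> real_homs. \<forall>x\<in>generated K. cis (\<phi> x) = 1}"
  define r where "r \<phi> = restrict \<phi> F" for \<phi> :: "'a \<Rightarrow> real"
  have "countable (r ` P)"
  proof (rule countable_subset)
    show "r ` P \<subseteq> F \<rightarrow>\<^sub>E range (\<lambda>n::int. 2 * pi * of_int n)"
    proof
      fix h assume "h \<in> r ` P"
      then obtain \<phi> where \<phi>: "\<phi> \<in> P" "h = restrict \<phi> F" unfolding r_def by blast
      have "\<phi> x \<in> range (\<lambda>n::int. 2 * pi * of_int n)" if "x \<in> F" for x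
      proof -
        have "cis (\<phi> x) = cis 0" using \<phi>(1) F_sub that unfolding P_def by auto
        from cis_eq_imp_Ints[OF this] obtain n :: int where "\<phi> x / (2 * pi) = n"
          by (auto elim: Ints_cases)
        then have "\<phi> x = 2 * pi * of_int n" by (simp add: field_simps)
        then show ?thesis by blast
      qed
      then show "h \<in> F \<rightarrow>\<^sub>E range (\<lambda>n::int. 2 * pi * of_int n)" unfolding \<phi>(2) by simp
    qed
    show "countable (F \<rightarrow>\<^sub>E range (\<lambda>n::int. 2 * pi * of_int n))"
      using F by (intro countable_PiE) (simp_all add: doubling_net_def)
  qed
  define e where "e n = (SOME \<phi>. \<phi> \<in> P \<and> r \<phi> = from_nat_into (r ` P) n)" for n
  show ?thesis
  proof (rule that[of e])
    fix \<phi> :: "'a \<Rightarrow> real"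
    assume \<phi>: "\<phi> \<in> real_homs" "\<And>x. x \<in> generated K \<Longrightarrow> cis (\<phi> x) = 1"
    then have "\<phi> \<in> P" by (simp add: P_def)
    then obtain n where n: "from_nat_into (r ` P) n = r \<phi>"
      using from_nat_into_surj[OF \<open>countable (r ` P)\<close>] by (metis image_eqI)
    have "\<exists>\<phi>. \<phi> \<in> P \<and> r \<phi> = from_nat_into (r ` P) n" using \<open>\<phi> \<in> P\<close> n by metis
    from someI_ex[OF this] have "e n \<in> P \<and> r (e n) = from_nat_into (r ` P) n"
      unfolding e_def .
    then have e: "e n \<in> P" "r (e n) = r \<phi>" using n by auto
    have e_hom: "e n \<in> real_homs" using e(1) by (simp add: P_def)
    obtain B where B: "\<And>x. x \<in> K \<Longrightarrow> \<bar>\<phi> x\<bar> \<le> B" using real_homs_bounded[OF \<phi>(1) K(1)] by blast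
    obtain C where C: "\<And>x. x \<in> K \<Longrightarrow> \<bar>e n x\<bar> \<le> C" using real_homs_bounded[OF e_hom K(1)] by blast
    have bd: "\<bar>\<phi> x - e n x\<bar> \<le> B + C" if "x \<in> K" for x using B[OF that] C[OF that] by linarith
    have zero: "\<phi> f - e n f = 0" if "f \<in> F" for f
      using fun_cong[OF e(2), of f] that by (simp add: r_def)
    have "\<phi> x - e n x = 0" if "x \<in> generated K" for x
      by (rule additive_on_generated_zero[OF F K0 additive_on_diff[OF real_homs_additive_on[OF \<phi>(1)] real_homs_additive_on[OF e_hom]] bd zero that])
    with e_hom show "\<exists>n. e n \<in> real_homs \<and> (\<forall>x\<in>generated K. \<phi> x = e n x)"
      by (intro exI[of _ n] conjI ballI) auto
  qed
qed

lemma real_homs_multiple: "\<phi> \<in> real_homs \<Longrightarrow> \<phi> (multiple n x) = real n * \<phi> x"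
  using additive_on_multiple[OF _ real_homs_additive_on[of \<phi> UNIV], of x n]
  by (simp add: additive_subgroup_def)

lemma character_on_UNIV_subset: "character_on UNIV \<gamma> \<Longrightarrow> additive_subgroup H \<Longrightarrow> character_on H \<gamma>"
  by (simp add: character_on_def)

lemma additive_subgroup_pure_hull:
  assumes "additive_subgroup H" shows "additive_subgroup {x. \<exists>n\<ge>1. multiple n x \<in> H}"
  unfolding additive_subgroup_def
proof (intro conjI ballI)
  have "multiple 1 0 \<in> H" using additive_subgroup_0[OF assms] by simp
  then show "0 \<in> {x. \<exists>n\<ge>1. multiple n x \<in> H}" by blast
  fix x y assume "x \<in> {x. \<exists>n\<ge>1. multiple n x \<in> H}" "y \<in> {x. \<exists>n\<ge>1. multiple n x \<in> H}"
  then obtain m n where mn: "m \<ge> 1" "multiple m x \<in> H" "n \<ge> 1" "multiple n y \<in> H" by blast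
  have "multiple (m * n) (x - y) = multiple n (multiple m x) - multiple m (multiple n y)"
    by (simp add: multiple_distrib_diff flip: multiple_mult) (simp add: mult.commute)
  also have "\<dots> \<in> H"
    using additive_subgroup_diff[OF assms] additive_subgroup_multiple[OF assms] mn(2,4) by blast
  finally show "x - y \<in> {x. \<exists>n\<ge>1. multiple n x \<in> H}" using mn by (intro CollectI exI[of _ "m * n"]) simp
qed

text \<open>
  Let \<open>H\<close> be generated by \<open>K\<close> and let \<open>P\<close> be the group of all \<open>x\<close> that have a nonzero multiple in \<open>H\<close>.
  If finitely many elements of \<open>P\<close> generate \<open>P\<close> together with \<open>K\<close>, they can be added to \<open>K\<close>. Otherwise
  there is an infinite strictly increasing chain of subgroups between \<open>H\<close> and \<open>P\<close>. Along such a chain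
  the characters that are trivial on \<open>H\<close> can be extended in at least two ways at each stage, so there
  are uncountably many of them on \<open>P\<close>. But each of them lifts to a real homomorphism, which is
  determined on \<open>P\<close> by its values on \<open>H\<close>, and for these there are only countably many possibilities.
\<close>
lemma enlarge_to_pure:
  fixes K :: "'a::{topological_ab_group_add, t2_space} set"
  assumes lift: "characters \<subseteq> (\<lambda>\<phi> x. cis (\<phi> x)) ` (real_homs :: ('a \<Rightarrow> real) set)"
    and K: "compact K" "symmetric_set K" "0 \<in> interior K"
  obtains K' where "K \<subseteq> K'" "compact K'" "symmetric_set K'" "pure_subset (generated K')"
proof -
  define H where "H = generated K"
  define P where "P = {x. \<exists>n\<ge>1. multiple n x \<in> H}"
  define K' where "K' A = K \<union> A \<union> uminus ` A" for A
  define S where "S A = generated (K' A)" for A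
  have H: "additive_subgroup H" unfolding H_def by (rule additive_subgroup_generated[OF K(2)])
  have P: "additive_subgroup P" unfolding P_def by (rule additive_subgroup_pure_hull[OF H])
  have HP: "H \<subseteq> P"
  proof
    fix x assume "x \<in> H"
    then have "multiple 1 x \<in> H" by simp
    then show "x \<in> P" unfolding P_def by blast
  qed
  have K': "symmetric_set (K' A)" "K \<subseteq> K' A" for A
    using K(2) by (auto simp: K'_def symmetric_set_def)
  have S: "additive_subgroup (S A)" "H \<subseteq> S A" "A \<subseteq> S A" for A
  proof -
    show sub: "additive_subgroup (S A)" unfolding S_def by (rule additive_subgroup_generated[OF K'(1)])
    show "H \<subseteq> S A"
      unfolding H_def by (rule generated_minimal[OF sub]) (use K'(2) subset_generated in \<open>unfold S_def, blast\<close>)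
    show "A \<subseteq> S A" unfolding S_def using subset_generated[of "K' A"] by (auto simp: K'_def)
  qed
  have S_mono: "S A \<subseteq> S B" if "A \<subseteq> B" for A B
  proof -
    have "K' A \<subseteq> K' B" using that by (auto simp: K'_def)
    then have "K' A \<subseteq> S B" using subset_generated[of "K' B"] unfolding S_def by blast
    then show ?thesis unfolding S_def[of A] by (rule generated_minimal[OF S(1)])
  qed
  have SP: "S A \<subseteq> P" if "A \<subseteq> P" for A
    unfolding S_def
    by (rule generated_minimal[OF P])
      (use that HP subset_generated[of K] additive_subgroup_minus[OF P] in \<open>auto simp: K'_def H_def\<close>)
  have "\<exists>A. finite A \<and> A \<subseteq> P \<and> P \<subseteq> S A"
  proof (rule ccontr)
    assume "\<not> ?thesis"
    then have new: "\<exists>x. x \<in> P \<and> x \<notin> S A" if "finite A" "A \<subseteq> P" for A using that by blast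
    obtain F where F: "doubling_net K F" using doubling_net_exists[OF K(1,3)] .
    obtain e :: "nat \<Rightarrow> 'a \<Rightarrow> real" where e:
      "\<And>\<phi>. \<phi> \<in> real_homs \<Longrightarrow> (\<And>x. x \<in> H \<Longrightarrow> cis (\<phi> x) = 1) \<Longrightarrow>
        \<exists>n. e n \<in> real_homs \<and> (\<forall>x\<in>H. \<phi> x = e n x)"
      unfolding H_def using countable_trivial_phases[OF K(1,2) F] by blast
    define good where "good p \<longleftrightarrow> finite (fst p) \<and> fst p \<subseteq> P \<and> character_on UNIV (snd p) \<and> (\<forall>x\<in>H. snd p x = 1)"
      for p :: "'a set \<times> ('a \<Rightarrow> complex)"
    \<comment> \<open>The diagonal construction: the new character differs at the new element \<open>x\<close> from the \<open>n\<close>-th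
      member of the countable list.\<close>
    define step where "step n p q \<longleftrightarrow> (\<exists>x\<in>P. x \<notin> S (fst p) \<and> fst q = insert x (fst p) \<and>
        (\<forall>y\<in>S (fst p). snd q y = snd p y) \<and> snd q x \<noteq> cis (e n x))"
      for n and p q :: "'a set \<times> ('a \<Rightarrow> complex)"
    have "\<exists>f. \<forall>n. good (f n) \<and> step n (f n) (f (Suc n))"
    proof (rule dependent_nat_choice)
      have "character_on UNIV (\<lambda>x::'a. 1)" by (simp add: character_on_def additive_subgroup_def)
      then show "\<exists>p. good p" by (intro exI[of _ "({}, \<lambda>x. 1)"]) (simp add: good_def)
    next
      fix p n assume p: "good p"
      then have "\<exists>x. x \<in> P \<and> x \<notin> S (fst p)" using new[of "fst p"] by (simp add: good_def)
      then obtain x where x: "x \<in> P" "x \<notin> S (fst p)" by blast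
      have "character_on (S (fst p)) (snd p)"
        by (rule character_on_UNIV_subset[OF _ S(1)]) (use p in \<open>simp add: good_def\<close>)
      from extend_character_avoiding_value[OF this x(2), of "cis (e n x)"] obtain \<gamma> where
        \<gamma>: "character_on UNIV \<gamma>" "\<And>y. y \<in> S (fst p) \<Longrightarrow> \<gamma> y = snd p y" "\<gamma> x \<noteq> cis (e n x)"
        by metis
      have "\<forall>y\<in>H. \<gamma> y = 1" using \<gamma>(2) S(2)[of "fst p"] p unfolding good_def by (metis subsetD)
      then have "good (insert x (fst p), \<gamma>)" using p x(1) \<gamma>(1) by (simp add: good_def)
      moreover have "step n p (insert x (fst p), \<gamma>)"
        unfolding step_def using x \<gamma>(2,3) by (intro bexI[of _ x]) simp_all
      ultimately show "\<exists>q. good q \<and> step n p q" by blast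
    qed
    then obtain f where f: "\<And>n. good (f n)" "\<And>n. step n (f n) (f (Suc n))" by blast
    define T where "T n = S (fst (f n))" for n
    define \<kappa> where "\<kappa> n = snd (f n)" for n
    have T: "additive_subgroup (T n)" "H \<subseteq> T n" for n using S by (simp_all add: T_def)
    have \<kappa>: "character_on UNIV (\<kappa> n)" for n using f(1) by (simp add: \<kappa>_def good_def)
    have \<kappa>H: "\<kappa> n x = 1" if "x \<in> H" for n x using f(1)[of n] that by (simp add: \<kappa>_def good_def)
    have T_Suc: "T n \<subseteq> T (Suc n)" for n
      unfolding T_def using f(2)[of n] by (intro S_mono) (auto simp: step_def)
    have T_mono: "T m \<subseteq> T n" if "m \<le> n" for m n using lift_Suc_mono_le[of T, OF T_Suc that] .
    have \<kappa>_Suc: "\<kappa> (Suc n) y = \<kappa> n y" if "y \<in> T n" for n y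
      using f(2)[of n] that by (auto simp: step_def T_def \<kappa>_def)
    have \<kappa>_stable: "\<kappa> n y = \<kappa> m y" if "m \<le> n" "y \<in> T m" for m n y
      using that(1)
    proof (induction rule: dec_induct)
      case (step n)
      then show ?case using \<kappa>_Suc T_mono[OF step(1)] that(2) by auto
    qed simp
    define \<kappa>' where "\<kappa>' x = \<kappa> (LEAST n. x \<in> T n) x" for x
    have \<kappa>': "\<kappa>' x = \<kappa> n x" if "x \<in> T n" for x n
    proof -
      have "x \<in> T (LEAST n. x \<in> T n)" "(LEAST n. x \<in> T n) \<le> n"
        using that by (auto intro: LeastI Least_le)
      then show ?thesis unfolding \<kappa>'_def using \<kappa>_stable by metis
    qed
    define U where "U = (\<Union>n. T n)"
    have common: "\<exists>n. x \<in> T n \<and> y \<in> T n" if "x \<in> U" "y \<in> U" for x y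
    proof -
      from that obtain m n where "x \<in> T m" "y \<in> T n" unfolding U_def by blast
      then have "x \<in> T (max m n)" "y \<in> T (max m n)"
        using T_mono[of m "max m n"] T_mono[of n "max m n"] by auto
      then show ?thesis by blast
    qed
    have "character_on U \<kappa>'"
      unfolding character_on_def additive_subgroup_def
    proof (intro conjI ballI)
      show "0 \<in> U" unfolding U_def using additive_subgroup_0[OF T(1)] by blast
    next
      fix x assume "x \<in> U"
      then obtain n where "x \<in> T n" by (auto simp: U_def)
      then show "norm (\<kappa>' x) = 1" using \<kappa>' character_onD(2)[OF \<kappa>] by simp
    next
      fix x y assume "x \<in> U" "y \<in> U"
      then obtain n where n: "x \<in> T n" "y \<in> T n" using common by blast
      show "x - y \<in> U" unfolding U_def using additive_subgroup_diff[OF T(1) n] by blast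
      show "\<kappa>' (x + y) = \<kappa>' x * \<kappa>' y"
        using \<kappa>'[OF n(1)] \<kappa>'[OF n(2)] \<kappa>'[OF additive_subgroup_add[OF T(1) n]] character_onD(3)[OF \<kappa>]
        by simp
    qed
    from extend_character[OF this] obtain \<gamma> where \<gamma>: "character_on UNIV \<gamma>" "\<And>x. x \<in> U \<Longrightarrow> \<gamma> x = \<kappa>' x"
      by blast
    have \<gamma>T: "\<gamma> x = \<kappa> n x" if "x \<in> T n" for n x using \<gamma>(2)[of x] \<kappa>'[OF that] that unfolding U_def by auto
    have \<gamma>H: "\<gamma> x = 1" if "x \<in> H" for x using \<gamma>T[of x 0] \<kappa>H[OF that] T(2) that by auto
    have "isCont \<gamma> 0"
      using interior_generated[OF K(3)] \<gamma>H unfolding H_def by (rule isCont_if_constant_near_0)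
    then obtain \<phi> where \<phi>: "\<phi> \<in> real_homs" "\<And>x. \<gamma> x = cis (\<phi> x)"
      using character_lift[OF lift character_continuousI[OF \<gamma>(1)]] by blast
    have "\<And>x. x \<in> H \<Longrightarrow> cis (\<phi> x) = 1" using \<phi>(2) \<gamma>H by simp
    from e[OF \<phi>(1) this] obtain n where n: "e n \<in> real_homs" "\<And>x. x \<in> H \<Longrightarrow> \<phi> x = e n x" by blast
    have eP: "\<phi> x = e n x" if "x \<in> P" for x
    proof -
      from that obtain k where k: "k \<ge> 1" "multiple k x \<in> H" unfolding P_def by blast
      have "real k * \<phi> x = real k * e n x"
        using n(2)[OF k(2)] real_homs_multiple[OF \<phi>(1)] real_homs_multiple[OF n(1)] by simp
      then show ?thesis using k(1) by simp
    qed
    from f(2)[of n] obtain x where x: "x \<in> P" "fst (f (Suc n)) = insert x (fst (f n))" "\<kappa> (Suc n) x \<noteq> cis (e n x)"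
      unfolding step_def \<kappa>_def by blast
    have "x \<in> T (Suc n)" unfolding T_def using S(3)[of "fst (f (Suc n))"] x(2) by auto
    then have "\<kappa> (Suc n) x = cis (e n x)" using \<gamma>T \<phi>(2) eP[OF x(1)] by metis
    with x(3) show False by contradiction
  qed
  then obtain A where A: "finite A" "A \<subseteq> P" "P \<subseteq> S A" by blast
  show ?thesis
  proof (rule that[of "K' A"])
    show "K \<subseteq> K' A" "symmetric_set (K' A)" using K' by auto
    show "compact (K' A)"
      unfolding K'_def using finite_imp_compact[of A] finite_imp_compact[of "uminus ` A"] K(1) A(1)
      by (intro compact_Un) auto
    show "pure_subset (generated (K' A))"
      unfolding pure_subset_def
    proof (intro allI impI)
      fix n :: nat and x assume "n \<ge> 1" and x: "multiple n x \<in> generated (K' A)"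
      then have "multiple n x \<in> P" using SP[OF A(2)] unfolding S_def by blast
      then obtain m where "m \<ge> 1" "multiple m (multiple n x) \<in> H" unfolding P_def by blast
      then have "x \<in> P"
        unfolding P_def using \<open>n \<ge> 1\<close> \<open>m \<ge> 1\<close> by (intro CollectI exI[of _ "m * n"]) (simp add: multiple_mult)
      with A(3) show "x \<in> generated (K' A)" unfolding S_def by blast
    qed
  qed
qed

text \<open>
  This replaces local path connectedness of the dual group: a character \<open>\<gamma>\<close> that is close to 1 on a
  large compact set is joined to 1 by the path \<open>cis (t \<phi>)\<close>, which stays close to 1 on \<open>C\<close>. An arbitrary
  lift of \<open>\<gamma>\<close> is corrected by \<open>2 pi\<close> times an integer-valued homomorphism on the whole group.
\<close>
lemma small_lifts:
  fixes C :: "'a::{topological_ab_group_add, t2_space} set"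
  assumes lc: "locally_compact_space (euclidean :: 'a topology)"
    and lift: "characters \<subseteq> (\<lambda>\<phi> x. cis (\<phi> x)) ` (real_homs :: ('a \<Rightarrow> real) set)"
    and C: "compact C" and \<epsilon>: "0 < \<epsilon>"
  obtains C' \<delta> where "compact C'" "\<delta> > 0"
    "\<And>\<gamma>. \<gamma> \<in> characters \<Longrightarrow> (\<And>x. x \<in> C' \<Longrightarrow> norm (\<gamma> x - 1) < \<delta>) \<Longrightarrow>
      \<exists>\<phi>\<in>real_homs. (\<forall>x. \<gamma> x = cis (\<phi> x)) \<and> (\<forall>x\<in>C. \<bar>\<phi> x\<bar> \<le> \<epsilon>)"
proof -
  have "\<forall>x::'a. \<exists>U. open U \<and> (\<exists>V. compact V \<and> x \<in> U \<and> U \<subseteq> V)"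
    using lc unfolding locally_compact_space_def by simp
  from spec[OF this, of 0] obtain U V :: "'a set" where "open U" "compact V" "0 \<in> U" "U \<subseteq> V"
    by (elim exE conjE)
  then have V: "compact V" "0 \<in> interior V" by (auto intro: interiorI)
  define K where "K = (C \<union> V) \<union> uminus ` (C \<union> V)"
  have K: "compact K" "symmetric_set K" "0 \<in> interior K" "C \<subseteq> K"
  proof -
    have "compact (uminus ` (C \<union> V))"
      by (rule compact_continuous_image) (use C V in \<open>auto intro!: continuous_intros\<close>)
    then show "compact K" unfolding K_def using C V by auto
    show "0 \<in> interior K" using V(2) interior_mono[of V K] by (auto simp: K_def)
    then have "0 \<in> K" using interior_subset by blast
    then show "symmetric_set K" by (auto simp: K_def symmetric_set_def)
    show "C \<subseteq> K" by (auto simp: K_def)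
  qed
  obtain K' where K': "K \<subseteq> K'" "compact K'" "symmetric_set K'" "pure_subset (generated K')"
    using enlarge_to_pure[OF lift K(1-3)] .
  have int: "0 \<in> interior K'" using K(3) interior_mono[OF K'(1)] by blast
  define \<epsilon>' where "\<epsilon>' = min \<epsilon> 1"
  have \<epsilon>': "0 < \<epsilon>'" "\<epsilon>' \<le> 1" "\<epsilon>' \<le> \<epsilon>" using \<epsilon> by (auto simp: \<epsilon>'_def)
  obtain J where J: "\<And>\<phi>. \<phi> \<in> real_homs \<Longrightarrow> (\<And>x. x \<in> sumset K' J \<Longrightarrow> norm (cis (\<phi> x) - 1) < \<epsilon>' / 2) \<Longrightarrow>
    \<exists>g. additive_on (generated K') g \<and> continuous_on (generated K') g \<and> (\<forall>x\<in>generated K'. g x \<in> \<int>) \<and>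
      (\<forall>x\<in>K'. \<bar>\<phi> x - 2 * pi * g x\<bar> \<le> \<epsilon>')"
    using small_character_integer_part[OF K'(2,3) int \<epsilon>'(1,2)] by metis
  show ?thesis
  proof (rule that[of "sumset K' J" "\<epsilon>' / 2"])
    show "compact (sumset K' J)" by (rule compact_sumset[OF K'(2)])
    show "\<epsilon>' / 2 > 0" using \<epsilon>' by simp
    fix \<gamma> :: "'a \<Rightarrow> complex"
    assume \<gamma>: "\<gamma> \<in> characters" and small: "\<And>x. x \<in> sumset K' J \<Longrightarrow> norm (\<gamma> x - 1) < \<epsilon>' / 2"
    obtain \<phi> where \<phi>: "\<phi> \<in> real_homs" "\<And>x. \<gamma> x = cis (\<phi> x)" using character_lift[OF lift \<gamma>] by blast
    obtain g where g: "additive_on (generated K') g" "continuous_on (generated K') g"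
      "\<forall>x\<in>generated K'. g x \<in> \<int>" "\<And>x. x \<in> K' \<Longrightarrow> \<bar>\<phi> x - 2 * pi * g x\<bar> \<le> \<epsilon>'"
      using J[OF \<phi>(1)] small unfolding \<phi>(2) by blast
    obtain \<nu> where \<nu>: "\<nu> \<in> real_homs" "\<And>x. \<nu> x \<in> \<int>" "\<And>x. x \<in> generated K' \<Longrightarrow> \<nu> x = g x"
      using integer_homs_extend[OF lift K'(2,3)  int K'(4) g(1-3)] by metis
    have "(\<lambda>x. \<phi> x - 2 * pi * \<nu> x) \<in> real_homs"
      using real_homs_lincomb[OF \<phi>(1) \<nu>(1), of 1 "- (2 * pi)"] by simp
    moreover have "\<gamma> x = cis (\<phi> x - 2 * pi * \<nu> x)" for x
      using cis_add_Ints[of "- \<nu> x" "\<phi> x"] \<nu>(2) \<phi>(2) by simp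
    moreover have "\<bar>\<phi> x - 2 * pi * \<nu> x\<bar> \<le> \<epsilon>" if "x \<in> C" for x
    proof -
      have "x \<in> K'" using that K(4) K'(1) by blast
      then show ?thesis using g(4)[of x] \<nu>(3)[of x] subset_generated[of K'] \<epsilon>'(3) by auto
    qed
    ultimately show "\<exists>\<phi>\<in>real_homs. (\<forall>x. \<gamma> x = cis (\<phi> x)) \<and> (\<forall>x\<in>C. \<bar>\<phi> x\<bar> \<le> \<epsilon>)"
      by (intro bexI[of _ "\<lambda>x. \<phi> x - 2 * pi * \<nu> x"] conjI allI ballI)
  qed
qed

section \<open>Winding numbers of paths in the punctured plane\<close>

lemma pathin_punctured_plane: "pathin punctured_plane c \<longleftrightarrow> path c \<and> 0 \<notin> path_image c"
  by (auto simp: pathin_def path_def path_image_def)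

lemma winding_number_exp_path:
  assumes "path q" and "\<And>t. t \<in> {0..1} \<Longrightarrow> c t = exp (q t)"
  shows "winding_number c 0 = (pathfinish q - pathstart q) / (2 * of_real pi * \<i>)"
proof -
  have "winding_number c 0 = winding_number (exp \<circ> q) 0"
    by (rule winding_number_cong) (use assms(2) in auto)
  then show ?thesis using winding_number_compose_exp[OF assms(1)] by simp
qed

lemma winding_number_mult:
  assumes c: "path c" "0 \<notin> path_image c" and d: "path d" "0 \<notin> path_image d"
  shows "winding_number (\<lambda>t. c t * d t) 0 = winding_number c 0 + winding_number d 0"
proof -
  obtain p where p: "path p" "pathfinish p - pathstart p = 2 * of_real pi * \<i> * winding_number c 0"
    "\<And>t. t \<in> {0..1} \<Longrightarrow> c t = 0 + exp (p t)"
    using winding_number_as_continuous_log[OF c] by metis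
  obtain q where q: "path q" "pathfinish q - pathstart q = 2 * of_real pi * \<i> * winding_number d 0"
    "\<And>t. t \<in> {0..1} \<Longrightarrow> d t = 0 + exp (q t)"
    using winding_number_as_continuous_log[OF d] by metis
  have "winding_number (\<lambda>t. c t * d t) 0 =
      (pathfinish (\<lambda>t. p t + q t) - pathstart (\<lambda>t. p t + q t)) / (2 * of_real pi * \<i>)"
    using p(1,3) q(1,3) by (intro winding_number_exp_path) (auto simp: path_def exp_add intro!: continuous_intros)
  also have "pathfinish (\<lambda>t. p t + q t) - pathstart (\<lambda>t. p t + q t) =
      2 * of_real pi * \<i> * (winding_number c 0 + winding_number d 0)"
    using p(2) q(2) by (simp add: pathfinish_def pathstart_def algebra_simps)
  finally show ?thesis by simp
qed

lemma winding_number_power: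
  assumes c: "path c" "0 \<notin> path_image c"
  shows "winding_number (\<lambda>t. c t ^ n) 0 = of_nat n * winding_number c 0"
proof (induction n)
  case 0
  show ?case using winding_number_constI[of 1 0 "\<lambda>t. c t ^ 0"] by simp
next
  case (Suc n)
  have "path (\<lambda>t. c t ^ n)" "0 \<notin> path_image (\<lambda>t. c t ^ n)"
    using c by (auto simp: path_def path_image_def intro!: continuous_intros)
  from winding_number_mult[OF c this] Suc show ?case by (simp add: algebra_simps)
qed

text \<open>
  The quotient \<open>c t / c 0\<close> stays in the right half plane, where the principal logarithm is continuous.
\<close>
lemma winding_number_near_start:
  assumes c: "path c" and a: "c 0 \<noteq> 0" and near: "\<And>t. t \<in> {0..1} \<Longrightarrow> norm (c t - c 0) < norm (c 0)"
  shows "2 * of_real pi * \<i> * winding_number c 0 = Ln (c 1 / c 0)"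
proof -
  let ?q = "\<lambda>t. Ln (c t / c 0) + Ln (c 0)"
  have re: "Re (c t / c 0) > 0" if "t \<in> {0..1}" for t
  proof -
    have "norm (c t / c 0 - 1) = norm (c t - c 0) / norm (c 0)"
      using a by (simp add: norm_divide[symmetric] diff_divide_distrib)
    also have "\<dots> < 1" using near[OF that] a by simp
    finally have "\<bar>Re (c t / c 0 - 1)\<bar> < 1" using abs_Re_le_cmod le_less_trans by blast
    then show ?thesis by simp
  qed
  have "path ?q"
    unfolding path_def
  proof (intro continuous_intros)
    show "continuous_on {0..1} c" using c by (simp add: path_def)
    show "c t / c 0 \<notin> \<real>\<^sub>\<le>\<^sub>0" if "t \<in> {0..1}" for t
      using re[OF that] by (auto simp: complex_nonpos_Reals_iff)
  qed (use a in auto)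
  moreover have "c t = exp (?q t)" if "t \<in> {0..1}" for t
  proof -
    have "c t / c 0 \<noteq> 0" using re[OF that] by auto
    then show ?thesis using a by (simp add: exp_add)
  qed
  ultimately have "winding_number c 0 = (pathfinish ?q - pathstart ?q) / (2 * of_real pi * \<i>)"
    by (rule winding_number_exp_path)
  then show ?thesis using a by (simp add: pathfinish_def pathstart_def)
qed

section \<open>Paths in the dual group\<close>

text \<open>
  A subbasic open set only confines the image of one compact set to one open set. So \<open>K\<close> is covered by
  finitely many compact pieces \<open>L a\<close> on which \<open>\<gamma>\<^sub>0\<close> is nearly constant.
\<close>
lemma dual_topology_neighbourhood:
  fixes \<gamma>\<^sub>0 :: "'a::topological_ab_group_add \<Rightarrow> complex"
  assumes \<gamma>\<^sub>0: "\<gamma>\<^sub>0 \<in> characters" and K: "compact K" and \<epsilon>: "\<epsilon> > 0"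
  obtains U where "openin dual_topology U" "\<gamma>\<^sub>0 \<in> U" "U \<subseteq> characters"
    "\<And>\<gamma> x. \<gamma> \<in> U \<Longrightarrow> x \<in> K \<Longrightarrow> norm (\<gamma> x - \<gamma>\<^sub>0 x) < \<epsilon>"
proof -
  have cont: "continuous_on UNIV \<gamma>\<^sub>0" using \<gamma>\<^sub>0 by (simp add: characters_def)
  have "open (\<gamma>\<^sub>0 -` ball (\<gamma>\<^sub>0 a) (\<epsilon> / 3))" for a
    using open_vimage[OF _ cont] by blast
  moreover have "K \<subseteq> (\<Union>a\<in>K. \<gamma>\<^sub>0 -` ball (\<gamma>\<^sub>0 a) (\<epsilon> / 3))" using \<epsilon> by auto
  ultimately obtain A where A: "A \<subseteq> K" "finite A" "K \<subseteq> (\<Union>a\<in>A. \<gamma>\<^sub>0 -` ball (\<gamma>\<^sub>0 a) (\<epsilon> / 3))"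
    using compactE_image[OF K] by metis
  define L where "L a = K \<inter> \<gamma>\<^sub>0 -` cball (\<gamma>\<^sub>0 a) (\<epsilon> / 3)" for a
  define W where "W a = {f. continuous_on UNIV f \<and> f ` L a \<subseteq> ball (\<gamma>\<^sub>0 a) (\<epsilon> / 2)}" for a
  define U where "U = (\<Inter>a\<in>A. characters \<inter> W a) \<inter> characters"
  have "compact (L a)" for a
    unfolding L_def using closed_vimage[OF _ cont] by (intro compact_Int_closed K) auto
  then have "openin compact_open_topology (W a)" for a
    unfolding compact_open_topology_def W_def by (intro topology_generated_by_Basis) blast
  then have "openin dual_topology (characters \<inter> W a)" for a
    unfolding dual_topology_def by (metis openin_subtopology_Int2)
  then have "openin dual_topology U"
    unfolding U_def using openin_INT[OF A(2), of dual_topology "\<lambda>a. characters \<inter> W a"] by simp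
  moreover have "\<gamma>\<^sub>0 \<in> U"
    unfolding U_def W_def L_def using \<gamma>\<^sub>0 cont \<epsilon> by auto
  moreover have "U \<subseteq> characters" by (auto simp: U_def)
  moreover have "norm (\<gamma> x - \<gamma>\<^sub>0 x) < \<epsilon>" if "\<gamma> \<in> U" "x \<in> K" for \<gamma> x
  proof -
    from A(3) that(2) obtain a where a: "a \<in> A" "dist (\<gamma>\<^sub>0 a) (\<gamma>\<^sub>0 x) < \<epsilon> / 3" by auto
    then have "x \<in> L a" using that(2) by (simp add: L_def)
    moreover have "\<gamma> \<in> W a" using that(1) a(1) unfolding U_def by blast
    ultimately have "dist (\<gamma>\<^sub>0 a) (\<gamma> x) < \<epsilon> / 2" unfolding W_def by auto
    then have "dist (\<gamma> x) (\<gamma>\<^sub>0 x) < \<epsilon> / 2 + \<epsilon> / 3"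
      using a(2) dist_triangle[of "\<gamma> x" "\<gamma>\<^sub>0 x" "\<gamma>\<^sub>0 a"] by (simp add: dist_commute)
    then show ?thesis using \<epsilon> by (simp add: dist_norm)
  qed
  ultimately show ?thesis using that by blast
qed

lemma continuous_map_dualI:
  fixes f :: "('a::topological_ab_group_add \<Rightarrow> complex) \<Rightarrow> complex"
  assumes "\<And>\<gamma>\<^sub>0 \<epsilon>. \<gamma>\<^sub>0 \<in> characters \<Longrightarrow> \<epsilon> > 0 \<Longrightarrow> \<exists>K \<delta>. compact K \<and> \<delta> > 0 \<and>
    (\<forall>\<gamma>\<in>characters. (\<forall>x\<in>K. norm (\<gamma> x - \<gamma>\<^sub>0 x) < \<delta>) \<longrightarrow> norm (f \<gamma> - f \<gamma>\<^sub>0) < \<epsilon>)"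
  shows "continuous_map dual_topology euclidean f"
  unfolding continuous_map_def
proof (intro conjI allI impI)
  fix V :: "complex set" assume "openin euclidean V"
  then have V: "open V" by simp
  show "openin dual_topology {\<gamma> \<in> topspace dual_topology. f \<gamma> \<in> V}"
  proof (subst openin_subopen, intro ballI)
    fix \<gamma>\<^sub>0 :: "'a \<Rightarrow> complex" assume "\<gamma>\<^sub>0 \<in> {\<gamma> \<in> topspace dual_topology. f \<gamma> \<in> V}"
    then have \<gamma>\<^sub>0: "\<gamma>\<^sub>0 \<in> characters" "f \<gamma>\<^sub>0 \<in> V" by auto
    obtain \<epsilon> where \<epsilon>: "\<epsilon> > 0" "ball (f \<gamma>\<^sub>0) \<epsilon> \<subseteq> V" using V \<gamma>\<^sub>0(2) open_contains_ball by blast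
    obtain K \<delta> where K: "compact K" "\<delta> > 0" and close: "\<And>\<gamma>. \<gamma> \<in> characters \<Longrightarrow>
        (\<And>x. x \<in> K \<Longrightarrow> norm (\<gamma> x - \<gamma>\<^sub>0 x) < \<delta>) \<Longrightarrow> norm (f \<gamma> - f \<gamma>\<^sub>0) < \<epsilon>"
      using assms[OF \<gamma>\<^sub>0(1) \<epsilon>(1)] by metis
    obtain U where U: "openin dual_topology U" "\<gamma>\<^sub>0 \<in> U" "U \<subseteq> characters"
      "\<And>\<gamma> x. \<gamma> \<in> U \<Longrightarrow> x \<in> K \<Longrightarrow> norm (\<gamma> x - \<gamma>\<^sub>0 x) < \<delta>"
      using dual_topology_neighbourhood[OF \<gamma>\<^sub>0(1) K] by metis
    have "f \<gamma> \<in> V" if "\<gamma> \<in> U" for \<gamma>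
    proof -
      have "norm (f \<gamma> - f \<gamma>\<^sub>0) < \<epsilon>" using close U(3,4) that by blast
      then show ?thesis using \<epsilon>(2) by (auto simp: dist_norm norm_minus_commute)
    qed
    then show "\<exists>T. openin dual_topology T \<and> \<gamma>\<^sub>0 \<in> T \<and> T \<subseteq> {\<gamma> \<in> topspace dual_topology. f \<gamma> \<in> V}"
      using U by (intro exI[of _ U]) auto
  qed
qed simp

lemma evaluation_continuous:
  "continuous_map dual_topology euclidean (\<lambda>\<gamma>::'a::topological_ab_group_add \<Rightarrow> complex. \<gamma> x)"
proof (rule continuous_map_dualI)
  fix \<gamma>\<^sub>0 :: "'a \<Rightarrow> complex" and \<epsilon> :: real assume "\<epsilon> > 0"
  then show "\<exists>K \<delta>. compact K \<and> \<delta> > 0 \<and>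
    (\<forall>\<gamma>\<in>characters. (\<forall>x\<in>K. norm (\<gamma> x - \<gamma>\<^sub>0 x) < \<delta>) \<longrightarrow> norm (\<gamma> x - \<gamma>\<^sub>0 x) < \<epsilon>)"
    by (intro exI[of _ "{x}"] exI[of _ \<epsilon>]) auto
qed

lemma pathin_dualI:
  fixes p :: "real \<Rightarrow> 'a::topological_ab_group_add \<Rightarrow> complex"
  assumes p: "\<And>t. t \<in> {0..1} \<Longrightarrow> p t \<in> characters"
    and unif: "\<And>K s \<epsilon>. compact K \<Longrightarrow> s \<in> {0..1} \<Longrightarrow> \<epsilon> > 0 \<Longrightarrow>
      \<exists>\<delta>>0. \<forall>t\<in>{0..1}. \<bar>t - s\<bar> < \<delta> \<longrightarrow> (\<forall>x\<in>K. norm (p t x - p s x) < \<epsilon>)"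
  shows "pathin dual_topology p"
proof -
  have cont: "continuous_on UNIV (p t)" if "t \<in> {0..1}" for t
    using p[OF that] by (simp add: characters_def)
  have "continuous_map (top_of_set {0..1}) compact_open_topology p"
    unfolding compact_open_topology_def
  proof (rule continuous_on_generated_topo)
    fix W assume "W \<in> {{f :: 'a \<Rightarrow> complex. continuous_on UNIV f \<and> f ` K \<subseteq> U} | K U. compact K \<and> open U}"
    then obtain K U where W: "W = {f :: 'a \<Rightarrow> complex. continuous_on UNIV f \<and> f ` K \<subseteq> U}"
      and K: "compact K" and U: "open U" by blast
    show "openin (top_of_set {0..1}) (p -` W \<inter> topspace (top_of_set {0..1}))"
      unfolding openin_euclidean_subtopology_iff
    proof (intro conjI ballI)
      fix s assume "s \<in> p -` W \<inter> topspace (top_of_set {0..1})"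
      then have s: "s \<in> {0..1}" "p s ` K \<subseteq> U" by (auto simp: W)
      have "compact (p s ` K)"
        by (rule compact_continuous_image[OF continuous_on_subset[OF cont[OF s(1)]] K]) simp
      then obtain \<epsilon> where \<epsilon>: "\<epsilon> > 0" "(\<Union>x\<in>p s ` K. ball x \<epsilon>) \<subseteq> U"
        using compact_subset_open_imp_ball_epsilon_subset[OF _ U s(2)] by metis
      obtain \<delta> where \<delta>: "\<delta> > 0" "\<And>t x. t \<in> {0..1} \<Longrightarrow> \<bar>t - s\<bar> < \<delta> \<Longrightarrow> x \<in> K \<Longrightarrow> norm (p t x - p s x) < \<epsilon>"
        using unif[OF K s(1) \<epsilon>(1)] by metis
      have "t \<in> p -` W \<inter> topspace (top_of_set {0..1})" if t: "t \<in> {0..1}" "dist t s < \<delta>" for t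
      proof -
        have "p t x \<in> U" if "x \<in> K" for x
        proof -
          have "norm (p t x - p s x) < \<epsilon>" using \<delta>(2)[OF t(1) _ that] t(2) by (simp add: dist_real_def)
          then have "p t x \<in> ball (p s x) \<epsilon>" by (simp add: dist_norm norm_minus_commute)
          with \<epsilon>(2) that show ?thesis by blast
        qed
        then show ?thesis using cont[OF t(1)] t(1) by (auto simp: W)
      qed
      then show "\<exists>e>0. \<forall>t\<in>{0..1}. dist t s < e \<longrightarrow> t \<in> p -` W \<inter> topspace (top_of_set {0..1})"
        using \<delta>(1) by blast
    qed auto
  next
    have "{f :: 'a \<Rightarrow> complex. continuous_on UNIV f} \<in>
        {{f. continuous_on UNIV f \<and> f ` K \<subseteq> U} | K U. compact K \<and> open U}"
      by (rule CollectI, rule exI[of _ "{}"], rule exI[of _ UNIV]) auto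
    moreover have "p ` topspace (top_of_set {0..1}) \<subseteq> {f. continuous_on UNIV f}" using cont by auto
    ultimately show "p ` topspace (top_of_set {0..1}) \<subseteq>
        \<Union> {{f. continuous_on UNIV f \<and> f ` K \<subseteq> U} | K U. compact K \<and> open U}"
      by blast
  qed
  then show ?thesis
    unfolding pathin_def dual_topology_def continuous_map_in_subtopology using p by auto
qed

lemma pathin_one_parameter:
  fixes \<gamma> :: "'a::topological_ab_group_add \<Rightarrow> complex"
  assumes \<gamma>: "\<gamma> \<in> characters" and \<phi>: "\<phi> \<in> real_homs"
  shows "pathin dual_topology (\<lambda>t x. \<gamma> x * cis (t * \<phi> x))"
proof (rule pathin_dualI)
  have t\<phi>: "(\<lambda>x. t * \<phi> x) \<in> real_homs" for t using real_homs_lincomb[OF \<phi> \<phi>, of t 0] by simp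
  show "(\<lambda>x. \<gamma> x * cis (t * \<phi> x)) \<in> characters" for t
    by (rule characters_mult[OF \<gamma> cis_real_homs[OF t\<phi>]])
  fix K :: "'a set" and s \<epsilon> :: real assume K: "compact K" and \<epsilon>: "\<epsilon> > 0"
  obtain B where B: "\<And>x. x \<in> K \<Longrightarrow> \<bar>\<phi> x\<bar> \<le> B" using real_homs_bounded[OF \<phi> K] by blast
  have "norm (\<gamma> x * cis (t * \<phi> x) - \<gamma> x * cis (s * \<phi> x)) < \<epsilon>"
    if "\<bar>t - s\<bar> < \<epsilon> / (\<bar>B\<bar> + 1)" "x \<in> K" for t x
  proof -
    have "\<gamma> x * cis (t * \<phi> x) - \<gamma> x * cis (s * \<phi> x) = \<gamma> x * (cis (s * \<phi> x) * (cis ((t - s) * \<phi> x) - 1))"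
      by (simp add: algebra_simps cis_mult)
    also have "norm \<dots> = norm (cis ((t - s) * \<phi> x) - 1)"
      using \<gamma> by (simp add: norm_mult characters_def)
    also have "\<dots> \<le> \<bar>(t - s) * \<phi> x\<bar>" by (rule norm_cis_minus_1_le)
    also have "\<dots> \<le> \<bar>t - s\<bar> * (\<bar>B\<bar> + 1)"
      unfolding abs_mult using B[OF that(2)] by (intro mult_left_mono) auto
    also have "\<dots> < \<epsilon>" using that(1) by (simp add: pos_less_divide_eq)
    finally show ?thesis .
  qed
  then show "\<exists>\<delta>>0. \<forall>t\<in>{0..1}. \<bar>t - s\<bar> < \<delta> \<longrightarrow> (\<forall>x\<in>K. norm (\<gamma> x * cis (t * \<phi> x) - \<gamma> x * cis (s * \<phi> x)) < \<epsilon>)"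
    using \<epsilon> by (intro exI[of _ "\<epsilon> / (\<bar>B\<bar> + 1)"]) (auto intro!: divide_pos_pos)
qed

lemma pathin_join:
  assumes "pathin X p" "pathin X q" "p 1 = q 0"
  shows "pathin X (p +++ q)"
proof -
  let ?I = "top_of_set {0..1::real}"
  have "continuous_map ?I X (\<lambda>x. if x \<le> 1/2 then (p \<circ> (\<lambda>t. 2 * t)) x else (q \<circ> (\<lambda>t. 2 * t - 1)) x)"
  proof (intro continuous_map_cases_le continuous_map_compose, force, force)
    show "continuous_map (subtopology ?I {x \<in> topspace ?I. x \<le> 1/2}) ?I ((*) 2)"
      by (auto simp: continuous_map_in_subtopology continuous_map_from_subtopology)
    have "continuous_map (subtopology ?I {x. 0 \<le> x \<and> x \<le> 1 \<and> 1 \<le> x * 2}) euclideanreal (\<lambda>t. 2 * t - 1)"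
      by (intro continuous_intros) (force intro: continuous_map_from_subtopology)
    then show "continuous_map (subtopology ?I {x \<in> topspace ?I. 1/2 \<le> x}) ?I (\<lambda>t. 2 * t - 1)"
      by (force simp: continuous_map_in_subtopology)
    show "(p \<circ> (*) 2) x = (q \<circ> (\<lambda>t. 2 * t - 1)) x" if "x \<in> topspace ?I" "x = 1/2" for x
      unfolding that(2) using assms(3) by simp
  qed (use assms in \<open>auto simp: pathin_def\<close>)
  moreover have "(\<lambda>x. if x \<le> 1/2 then (p \<circ> (\<lambda>t. 2 * t)) x else (q \<circ> (\<lambda>t. 2 * t - 1)) x) = p +++ q"
    by (auto simp: joinpaths_def)
  ultimately show ?thesis by (simp add: pathin_def)
qed

lemma pathin_reversepath:
  assumes "pathin X p" shows "pathin X (reversepath p)"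
proof -
  have "continuous_map (top_of_set {0..1}) (top_of_set {0..1}) (\<lambda>t::real. 1 - t)"
    by (auto simp: continuous_map_in_subtopology continuous_on_op_minus)
  then have "continuous_map (top_of_set {0..1}) X (p \<circ> (\<lambda>t. 1 - t))"
    using assms continuous_map_compose unfolding pathin_def by blast
  then show ?thesis by (simp add: pathin_def reversepath_def o_def)
qed

section \<open>Path-connected dual groups\<close>

text \<open>
  Let \<open>p\<close> be a path from 1 to \<open>\<gamma>\<close>. For each \<open>x\<close> the number \<open>p t x\<close> moves on the unit circle from 1 to
  \<open>\<gamma> x\<close>, and the angle that it covers is a lift \<open>\<phi> x\<close> of \<open>\<gamma> x\<close>. As winding numbers are additive for
  products of paths, \<open>\<phi>\<close> is a homomorphism. The path is a compact set of characters and hence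
  equicontinuous, so for \<open>x\<close> near 0 the number \<open>p t x\<close> stays near 1 for all \<open>t\<close>, and then \<open>\<phi> x\<close> is
  the principal argument of \<open>\<gamma> x\<close>; this gives the continuity of \<open>\<phi>\<close>.
\<close>
theorem characters_lift_if_path_connected:
  assumes lc: "locally_compact_space (euclidean :: 'a::{topological_ab_group_add, t2_space} topology)"
    and pc: "path_connected_space (dual_topology :: ('a \<Rightarrow> complex) topology)"
  shows "characters \<subseteq> (\<lambda>\<phi> x. cis (\<phi> x)) ` (real_homs :: ('a \<Rightarrow> real) set)"
proof
  fix \<gamma> :: "'a \<Rightarrow> complex" assume \<gamma>: "\<gamma> \<in> characters"
  have "trivial_character \<in> (characters :: ('a \<Rightarrow> complex) set)"
    by (simp add: trivial_character_def characters_def)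
  with \<gamma> pc obtain p :: "real \<Rightarrow> 'a \<Rightarrow> complex" where p: "pathin dual_topology p" "p 0 = trivial_character" "p 1 = \<gamma>"
    unfolding path_connected_space_def topspace_dual_topology by blast
  have p_char: "p t \<in> characters" if "t \<in> {0..1}" for t
    using p(1) that unfolding pathin_def continuous_map_def topspace_dual_topology by auto
  define c where "c x t = p t x" for x t
  have c0: "c x 0 = 1" and c1: "c x 1 = \<gamma> x" for x by (simp_all add: c_def p trivial_character_def)
  have c_norm: "norm (c x t) = 1" if "t \<in> {0..1}" for x t
    using p_char[OF that] by (simp add: c_def characters_def)
  have c_path: "path (c x)" "0 \<notin> path_image (c x)" for x
  proof -
    have "pathin euclidean ((\<lambda>\<gamma>. \<gamma> x) \<circ> p)" by (rule pathin_compose[OF p(1) evaluation_continuous])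
    then show "path (c x)" by (simp add: c_def[abs_def] o_def pathin_def path_def)
    show "0 \<notin> path_image (c x)" using c_norm[of _ x] by (force simp: path_image_def)
  qed
  define \<phi> where "\<phi> x = 2 * pi * Re (winding_number (c x) 0)" for x
  have lift: "\<gamma> x = cis (\<phi> x)" and \<phi>_wn: "of_real (\<phi> x) = 2 * of_real pi * winding_number (c x) 0" for x
  proof -
    let ?w = "winding_number (c x) 0"
    have "\<gamma> x = exp (2 * of_real pi * \<i> * ?w)"
      using winding_number_exp_2pi[OF c_path[of x]] c0[of x] c1[of x] by (simp add: pathstart_def pathfinish_def)
    moreover have "norm (\<gamma> x) = 1" using \<gamma> by (simp add: characters_def)
    ultimately have "exp (Re (2 * of_real pi * \<i> * ?w)) = 1" by (metis norm_exp_eq_Re)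
    then have Im: "Im ?w = 0" by simp
    then show \<phi>_wn: "of_real (\<phi> x) = 2 * of_real pi * ?w" by (simp add: \<phi>_def complex_eq_iff)
    have "2 * of_real pi * \<i> * ?w = \<i> * of_real (\<phi> x)" unfolding \<phi>_wn by (simp only: ac_simps)
    then show "\<gamma> x = cis (\<phi> x)" using \<open>\<gamma> x = _\<close> by (simp only: cis_conv_exp)
  qed
  have add: "\<phi> (x + y) = \<phi> x + \<phi> y" for x y
  proof -
    have "winding_number (c (x + y)) 0 = winding_number (\<lambda>t. c x t * c y t) 0"
      by (rule winding_number_cong) (use p_char in \<open>auto simp: c_def characters_def\<close>)
    then show ?thesis
      using winding_number_mult[OF c_path[of x] c_path[of y]] by (simp add: \<phi>_def distrib_left)
  qed
  have "\<forall>x::'a. \<exists>U. open U \<and> (\<exists>V. compact V \<and> x \<in> U \<and> U \<subseteq> V)"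
    using lc unfolding locally_compact_space_def by simp
  from spec[OF this, of 0] obtain U V :: "'a set" where V: "open U" "compact V" "0 \<in> U" "U \<subseteq> V"
    by (elim exE conjE)
  have "\<exists>T. open T \<and> s \<in> T \<and> (\<forall>t\<in>T \<inter> {0..1}. \<forall>x\<in>V. norm (p t x - p s x) < 1 / 2)" if s: "s \<in> {0..1}" for s
  proof -
    have half: "(0::real) < 1 / 2" by simp
    obtain W where W: "openin dual_topology W" "p s \<in> W" "W \<subseteq> characters"
      "\<And>\<gamma> x. \<gamma> \<in> W \<Longrightarrow> x \<in> V \<Longrightarrow> norm (\<gamma> x - p s x) < 1 / 2"
      using dual_topology_neighbourhood[OF p_char[OF s] V(2) half] by metis
    have "openin (top_of_set {0..1}) {t \<in> {0..1}. p t \<in> W}"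
      using openin_continuous_map_preimage[OF p(1)[unfolded pathin_def] W(1)] by simp
    then obtain T where T: "open T" "{t \<in> {0..1}. p t \<in> W} = {0..1} \<inter> T"
      unfolding openin_open by blast
    have "s \<in> T" using T(2) s W(2) by blast
    moreover have "norm (p t x - p s x) < 1 / 2" if "t \<in> T \<inter> {0..1}" "x \<in> V" for t x
      using T(2) W(4) that by blast
    ultimately show ?thesis using T(1) by blast
  qed
  then have "\<forall>s\<in>{0..1}. \<exists>T. open T \<and> s \<in> T \<and> (\<forall>t\<in>T \<inter> {0..1}. \<forall>x\<in>V. norm (p t x - p s x) < 1 / 2)"
    by blast
  from bchoice[OF this] obtain T where T_all:
    "\<forall>s\<in>{0..1}. open (T s) \<and> s \<in> T s \<and> (\<forall>t\<in>T s \<inter> {0..1}. \<forall>x\<in>V. norm (p t x - p s x) < 1 / 2)"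
    by blast
  then have T: "\<And>s. s \<in> {0..1} \<Longrightarrow> open (T s)" "\<And>s. s \<in> {0..1} \<Longrightarrow> s \<in> T s"
    "\<And>s t x. s \<in> {0..1} \<Longrightarrow> t \<in> T s \<inter> {0..1} \<Longrightarrow> x \<in> V \<Longrightarrow> norm (p t x - p s x) < 1 / 2"
    by blast+
  have "{0..1} \<subseteq> (\<Union>s\<in>{0..1}. T s)" using T(2) by blast
  then obtain A where A: "A \<subseteq> {0..1::real}" "finite A" "{0..1} \<subseteq> (\<Union>s\<in>A. T s)"
    using compactE_image[of "{0..1::real}" "{0..1}" T] T(1) by auto
  define N where "N = U \<inter> (\<Inter>s\<in>A. p s -` ball 1 (1 / 2))"
  have "open (p s -` ball 1 (1 / 2))" if "s \<in> A" for s
    using open_vimage[of "ball 1 (1 / 2)" "p s"] p_char[of s] that A(1) by (auto simp: characters_def)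
  then have "open N" unfolding N_def using V(1) A(2) by (intro open_Int open_INT) auto
  moreover have "0 \<in> N"
  proof -
    have "p s 0 = 1" if "s \<in> A" for s
      using character_on_0 p_char[of s] that A(1) unfolding characters_iff by blast
    then show ?thesis using V(3) by (simp add: N_def)
  qed
  moreover have near: "norm (c x t - 1) < 1" if "x \<in> N" "t \<in> {0..1}" for x t
  proof -
    from A(3) that(2) obtain s where s: "s \<in> A" "t \<in> T s" by blast
    have "x \<in> V" using that(1) V(4) by (auto simp: N_def)
    then have "norm (p t x - p s x) < 1 / 2" using T(3)[of s t x] s A(1) that(2) by blast
    moreover have "norm (p s x - 1) < 1 / 2"
      using that(1) s(1) by (auto simp: N_def dist_norm norm_minus_commute)
    ultimately show ?thesis
      unfolding c_def using norm_triangle_ineq[of "p t x - p s x" "p s x - 1"] by simp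
  qed
  have \<phi>_Ln: "\<phi> x = Im (Ln (\<gamma> x))" if "x \<in> N" for x
  proof -
    have "2 * of_real pi * \<i> * winding_number (c x) 0 = Ln (c x 1 / c x 0)"
      using near[OF that] by (intro winding_number_near_start[OF c_path(1)]) (auto simp: c0)
    then have "\<i> * of_real (\<phi> x) = Ln (\<gamma> x)" unfolding \<phi>_wn by (simp add: c0 c1 algebra_simps)
    then show ?thesis by (metis Im_i_times Re_complex_of_real)
  qed
  have "isCont (\<lambda>x. Im (Ln (\<gamma> x))) 0"
  proof -
    have "isCont \<gamma> 0" using \<gamma> continuous_on_eq_continuous_at[of UNIV \<gamma>] by (simp add: characters_def)
    moreover have "\<gamma> 0 = 1" using \<gamma> character_on_0 unfolding characters_iff by blast
    then have "isCont Ln (\<gamma> 0)" by (simp add: continuous_at_Ln)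
    ultimately have "isCont (\<lambda>x. Ln (\<gamma> x)) 0" by (rule isCont_o2)
    then show ?thesis by (rule continuous_Im)
  qed
  moreover have "\<forall>\<^sub>F x in nhds 0. \<phi> x = Im (Ln (\<gamma> x))"
    unfolding eventually_nhds using \<open>open N\<close> \<open>0 \<in> N\<close> \<phi>_Ln by blast
  ultimately have "isCont \<phi> 0" using isCont_cong by metis
  then have "continuous_on UNIV \<phi>"
    by (intro continuous_on_additive_on) (simp_all add: additive_subgroup_def additive_on_def add)
  with add have "\<phi> \<in> real_homs" by (simp add: real_homs_def)
  moreover have "\<gamma> = (\<lambda>x. cis (\<phi> x))" using lift by blast
  ultimately show "\<gamma> \<in> (\<lambda>\<phi> x. cis (\<phi> x)) ` real_homs" by blast
qed

section \<open>Fourier transforms\<close>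

text \<open>
  Outside a compact set of mass close to 1 the trivial bound 2 for \<open>norm (\<gamma> x - \<kappa> x)\<close> suffices. The
  set \<open>K\<close> is chosen before the characters, so the estimate applies to whole paths of characters.
\<close>
lemma fourier_close:
  fixes M :: "'a::{topological_ab_group_add, t2_space} measure"
  assumes M: "borel_probability M" and \<epsilon>: "\<epsilon> > 0"
  obtains K where "compact K" "\<And>\<gamma> \<kappa> \<delta>. \<gamma> \<in> characters \<Longrightarrow> \<kappa> \<in> characters \<Longrightarrow> 0 \<le> \<delta> \<Longrightarrow>
    (\<And>x. x \<in> K \<Longrightarrow> norm (\<gamma> x - \<kappa> x) \<le> \<delta>) \<Longrightarrow> norm (fourier M \<gamma> - fourier M \<kappa>) \<le> \<delta> + \<epsilon>"
proof -
  interpret prob_space M using M by (simp add: borel_probability_def)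
  have sets: "sets M = sets borel" using M by (simp add: borel_probability_def)
  obtain K where K: "compact K" "measure M (space M - K) < \<epsilon> / 2"
    using M \<epsilon> unfolding borel_probability_def by (meson half_gt_zero)
  have space: "space M = UNIV" using sets_eq_imp_space_eq[OF sets] by simp
  have K_sets: "space M - K \<in> sets M"
    unfolding sets space using compact_imp_closed[OF K(1)] by (auto simp: Compl_eq_Diff_UNIV[symmetric])
  have int: "integrable M \<gamma>" if "\<gamma> \<in> characters" for \<gamma> :: "'a \<Rightarrow> complex"
  proof (rule integrable_const_bound[where B = 1])
    show "\<gamma> \<in> borel_measurable M"
      using that borel_measurable_continuous_onI[of \<gamma>] measurable_cong_sets[OF sets refl]
      unfolding characters_def by blast
  qed (use that in \<open>simp add: characters_def\<close>)
  show ?thesis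
  proof (rule that[OF K(1)])
    fix \<gamma> \<kappa> :: "'a \<Rightarrow> complex" and \<delta> :: real
    assume \<gamma>: "\<gamma> \<in> characters" and \<kappa>: "\<kappa> \<in> characters" and \<delta>: "0 \<le> \<delta>"
      and close: "\<And>x. x \<in> K \<Longrightarrow> norm (\<gamma> x - \<kappa> x) \<le> \<delta>"
    have "fourier M \<gamma> - fourier M \<kappa> = (\<integral>x. \<gamma> x - \<kappa> x \<partial>M)"
      unfolding fourier_def using int \<gamma> \<kappa> by simp
    also have "norm \<dots> \<le> (\<integral>x. norm (\<gamma> x - \<kappa> x) \<partial>M)" by (rule integral_norm_bound)
    also have "\<dots> \<le> (\<integral>x. \<delta> + 2 * indicator (space M - K) x \<partial>M)"
    proof (rule integral_mono)
      show "integrable M (\<lambda>x. norm (\<gamma> x - \<kappa> x))" using int \<gamma> \<kappa> by simp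
      show "integrable M (\<lambda>x. \<delta> + 2 * indicator (space M - K) x :: real)"
        using K_sets by (intro Bochner_Integration.integrable_add integrable_const integrable_mult_right)
          (auto intro: integrable_real_indicator simp: emeasure_eq_measure)
      fix x assume "x \<in> space M"
      show "norm (\<gamma> x - \<kappa> x) \<le> \<delta> + 2 * indicator (space M - K) x"
      proof (cases "x \<in> K")
        case True
        then show ?thesis using close by simp
      next
        case False
        have "norm (\<gamma> x - \<kappa> x) \<le> norm (\<gamma> x) + norm (\<kappa> x)" by (rule norm_triangle_ineq4)
        also have "\<dots> = 2" using \<gamma> \<kappa> by (simp add: characters_def)
        finally show ?thesis using False \<delta> \<open>x \<in> space M\<close> by simp
      qed
    qed
    also have "\<dots> = \<delta> + 2 * measure M (space M - K)"
      using K_sets by (subst Bochner_Integration.integral_add) (auto simp: prob_space emeasure_eq_measure)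
    also have "\<dots> \<le> \<delta> + \<epsilon>" using K(2) by simp
    finally show "norm (fourier M \<gamma> - fourier M \<kappa>) \<le> \<delta> + \<epsilon>" .
  qed
qed

lemma fourier_trivial: "borel_probability M \<Longrightarrow> fourier M trivial_character = 1"
  by (simp add: borel_probability_def fourier_def trivial_character_def prob_space.prob_space)

lemma trivial_in_characters: "trivial_character \<in> characters"
  by (simp add: trivial_character_def characters_def)

lemma fourier_continuous:
  fixes M :: "'a::{topological_ab_group_add, t2_space} measure"
  assumes M: "borel_probability M"
  shows "continuous_map dual_topology euclidean (fourier M)"
proof (rule continuous_map_dualI)
  fix \<gamma>\<^sub>0 :: "'a \<Rightarrow> complex" and \<epsilon> :: real assume \<gamma>\<^sub>0: "\<gamma>\<^sub>0 \<in> characters" and \<epsilon>: "\<epsilon> > 0"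
  then have "\<epsilon> / 3 > 0" by simp
  then obtain K where K: "compact K" "\<And>\<gamma> \<kappa> \<delta>. \<gamma> \<in> characters \<Longrightarrow> \<kappa> \<in> characters \<Longrightarrow> 0 \<le> \<delta> \<Longrightarrow>
    (\<And>x. x \<in> K \<Longrightarrow> norm (\<gamma> x - \<kappa> x) \<le> \<delta>) \<Longrightarrow> norm (fourier M \<gamma> - fourier M \<kappa>) \<le> \<delta> + \<epsilon> / 3"
    using fourier_close[OF M] by metis
  have "norm (fourier M \<gamma> - fourier M \<gamma>\<^sub>0) < \<epsilon>"
    if "\<gamma> \<in> characters" "\<forall>x\<in>K. norm (\<gamma> x - \<gamma>\<^sub>0 x) < \<epsilon> / 3" for \<gamma>
  proof -
    have "norm (\<gamma> x - \<gamma>\<^sub>0 x) \<le> \<epsilon> / 3" if "x \<in> K" for x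
      using \<open>\<forall>x\<in>K. _\<close> that by (simp add: less_imp_le)
    from K(2)[OF \<open>\<gamma> \<in> characters\<close> \<gamma>\<^sub>0 _ this] \<epsilon> show ?thesis by simp
  qed
  then show "\<exists>K \<delta>. compact K \<and> \<delta> > 0 \<and>
    (\<forall>\<gamma>\<in>characters. (\<forall>x\<in>K. norm (\<gamma> x - \<gamma>\<^sub>0 x) < \<delta>) \<longrightarrow> norm (fourier M \<gamma> - fourier M \<gamma>\<^sub>0) < \<epsilon>)"
    using K(1) \<epsilon> by (intro exI[of _ K] exI[of _ "\<epsilon> / 3"]) simp
qed

lemma fourier_path:
  fixes M :: "'a::{topological_ab_group_add, t2_space} measure"
  assumes M: "borel_probability M" and nz: "\<forall>\<gamma>\<in>characters. fourier M \<gamma> \<noteq> 0"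
    and p: "pathin dual_topology p"
  shows "path (fourier M \<circ> p)" "0 \<notin> path_image (fourier M \<circ> p)"
proof -
  have "continuous_map dual_topology punctured_plane (fourier M)"
    using fourier_continuous[OF M] nz by (auto simp: continuous_map_in_subtopology)
  from pathin_compose[OF p this] show "path (fourier M \<circ> p)" "0 \<notin> path_image (fourier M \<circ> p)"
    by (simp_all add: pathin_punctured_plane)
qed

text \<open>
  Composition with the Fourier transform is compatible with homotopies of loops, so a class can be
  represented by any of its loops.
\<close>
lemma fourier_pi1_image_eq:
  fixes M :: "'a::{topological_ab_group_add, t2_space} measure"
  assumes M: "borel_probability M" and nz: "\<forall>\<gamma>\<in>characters. fourier M \<gamma> \<noteq> 0"
  shows "fourier_pi1_image M =
    {z. \<exists>p\<in>loops dual_topology trivial_character. winding_number (fourier M \<circ> p) 0 = of_int z}"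
proof -
  let ?R = "loop_homotopy (dual_topology :: ('a \<Rightarrow> complex) topology) trivial_character"
  let ?L = "loops (dual_topology :: ('a \<Rightarrow> complex) topology) trivial_character"
  let ?w = "\<lambda>A. winding_class (induced_map punctured_plane 1 (fourier M) A)"
  have cont: "continuous_map dual_topology punctured_plane (fourier M)"
    using fourier_continuous[OF M] nz by (auto simp: continuous_map_in_subtopology)
  have comp: "(fourier M \<circ> p, fourier M \<circ> q) \<in> loop_homotopy punctured_plane 1" if "(p, q) \<in> ?R" for p q
    using homotopic_with_compose_continuous_map_left[OF that[unfolded loop_homotopy_def, simplified] cont]
    by (simp add: loop_homotopy_def fourier_trivial[OF M])
  have refl: "(p, p) \<in> ?R" if "p \<in> ?L" for p
    using that by (simp add: loop_homotopy_def loops_def pathin_def)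
  have w: "of_int (?w (?R `` {p})) = winding_number (fourier M \<circ> p) 0" if p: "p \<in> ?L" for p
  proof -
    have loop: "fourier M \<circ> p \<in> loops punctured_plane 1"
      using comp[OF refl[OF p]] by (simp add: loop_homotopy_punctured_plane)
    have "induced_map punctured_plane 1 (fourier M) (?R `` {p}) =
        loop_homotopy punctured_plane 1 `` {fourier M \<circ> p}"
      unfolding induced_map_def
    proof (rule subset_antisym; rule subsetI)
      fix r assume "r \<in> loop_homotopy punctured_plane 1 `` ((\<circ>) (fourier M) ` (?R `` {p}))"
      then obtain q where q: "(p, q) \<in> ?R" "(fourier M \<circ> q, r) \<in> loop_homotopy punctured_plane 1" by blast
      from comp[OF q(1)] q(2) show "r \<in> loop_homotopy punctured_plane 1 `` {fourier M \<circ> p}"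
        by (simp add: loop_homotopy_punctured_plane)
    next
      fix r assume "r \<in> loop_homotopy punctured_plane 1 `` {fourier M \<circ> p}"
      with refl[OF p] show "r \<in> loop_homotopy punctured_plane 1 `` ((\<circ>) (fourier M) ` (?R `` {p}))" by blast
    qed
    then show ?thesis using winding_class_Image[OF loop] by simp
  qed
  have "fourier_pi1_image M = (\<lambda>p. ?w (?R `` {p})) ` ?L"
    unfolding fourier_pi1_image_def fundamental_group_def quotient_def by (auto simp: image_image)
  also have "\<dots> = {z. \<exists>p\<in>?L. winding_number (fourier M \<circ> p) 0 = of_int z}"
  proof (rule subset_antisym; rule subsetI)
    fix z assume "z \<in> (\<lambda>p. ?w (?R `` {p})) ` ?L"
    then show "z \<in> {z. \<exists>p\<in>?L. winding_number (fourier M \<circ> p) 0 = of_int z}" using w by force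
  next
    fix z assume "z \<in> {z. \<exists>p\<in>?L. winding_number (fourier M \<circ> p) 0 = of_int z}"
    then obtain p where p: "p \<in> ?L" "winding_number (fourier M \<circ> p) 0 = of_int z" by blast
    then have "complex_of_int (?w (?R `` {p})) = of_int z" using w by simp
    then have "?w (?R `` {p}) = z" using of_int_eq_iff by blast
    with p(1) show "z \<in> (\<lambda>p. ?w (?R `` {p})) ` ?L" by blast
  qed
  finally show ?thesis .
qed

section \<open>Logarithms of Fourier transforms\<close>

text \<open>
  For a path \<open>p\<close> from 1 to \<open>\<gamma>\<close> the number \<open>2 pi \<i>\<close> times the winding number of \<open>fourier M \<circ> p\<close> is a
  logarithm of \<open>fourier M \<gamma>\<close>, and it does not depend on \<open>p\<close> because loops have winding number 0. For
  the continuity at \<open>\<gamma>\<^sub>0\<close>, a path to \<open>\<gamma>\<^sub>0\<close> is continued to a nearby \<open>\<gamma>\<close> by \<open>\<gamma>\<^sub>0 cis (t \<phi>)\<close>, where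
  \<open>\<phi>\<close> is a small lift of \<open>\<gamma> / \<gamma>\<^sub>0\<close>. The Fourier transform stays close to its value at \<open>\<gamma>\<^sub>0\<close> along
  this piece, which therefore adds only a small principal logarithm.
\<close>
lemma admissible_if_no_winding:
  fixes M :: "'a::{topological_ab_group_add, t2_space} measure"
  assumes lc: "locally_compact_space (euclidean :: 'a topology)"
    and pc: "path_connected_space (dual_topology :: ('a \<Rightarrow> complex) topology)"
    and M: "borel_probability M" and nz: "\<forall>\<gamma>\<in>characters. fourier M \<gamma> \<noteq> 0"
    and no_winding: "\<And>p. p \<in> loops dual_topology trivial_character \<Longrightarrow> winding_number (fourier M \<circ> p) 0 = 0"
  shows "admissible M"
proof -
  let ?f = "fourier M" and ?X = "dual_topology :: ('a \<Rightarrow> complex) topology"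
  note path = fourier_path[OF M nz]
  have "\<forall>\<gamma>\<in>characters. \<exists>p. pathin ?X p \<and> p 0 = trivial_character \<and> p 1 = \<gamma>"
    using pc trivial_in_characters unfolding path_connected_space_def topspace_dual_topology by blast
  from bchoice[OF this] obtain P where P_all:
    "\<forall>\<gamma>\<in>characters. pathin ?X (P \<gamma>) \<and> P \<gamma> 0 = trivial_character \<and> P \<gamma> 1 = \<gamma>" by blast
  then have P: "pathin ?X (P \<gamma>)" "P \<gamma> 0 = trivial_character" "P \<gamma> 1 = \<gamma>" if "\<gamma> \<in> characters" for \<gamma>
    using that by blast+
  define \<psi> where "\<psi> \<gamma> = 2 * of_real pi * \<i> * winding_number (?f \<circ> P \<gamma>) 0" for \<gamma>
  have \<psi>: "\<psi> \<gamma> = 2 * of_real pi * \<i> * winding_number (?f \<circ> p) 0"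
    if \<gamma>: "\<gamma> \<in> characters" and p: "pathin ?X p" "p 0 = trivial_character" "p 1 = \<gamma>" for \<gamma> p
  proof -
    note q = pathin_reversepath[OF P(1)[OF \<gamma>]]
    have join: "p 1 = reversepath (P \<gamma>) 0" using p(3) P(3)[OF \<gamma>] by (simp add: reversepath_def)
    have "p +++ reversepath (P \<gamma>) \<in> loops ?X trivial_character"
      using pathin_join[OF p(1) q join] p(2) P(2)[OF \<gamma>]
      by (simp add: loops_def joinpaths_def reversepath_def)
    from no_winding[OF this]
    have "winding_number ((?f \<circ> p) +++ reversepath (?f \<circ> P \<gamma>)) 0 = 0"
      by (simp add: path_compose_join path_compose_reversepath)
    also have "winding_number ((?f \<circ> p) +++ reversepath (?f \<circ> P \<gamma>)) 0 =
        winding_number (?f \<circ> p) 0 + winding_number (reversepath (?f \<circ> P \<gamma>)) 0"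
    proof (rule winding_number_join[OF path[OF p(1)]])
      show "path (reversepath (?f \<circ> P \<gamma>))" "0 \<notin> path_image (reversepath (?f \<circ> P \<gamma>))"
        using path[OF P(1)[OF \<gamma>]] by simp_all
      show "pathfinish (?f \<circ> p) = pathstart (reversepath (?f \<circ> P \<gamma>))"
        using p(3) P(3)[OF \<gamma>] by (simp add: pathfinish_def pathstart_def reversepath_def)
    qed
    also have "winding_number (reversepath (?f \<circ> P \<gamma>)) 0 = - winding_number (?f \<circ> P \<gamma>) 0"
      by (rule winding_number_reversepath[OF path[OF P(1)[OF \<gamma>]]])
    finally have "winding_number (?f \<circ> P \<gamma>) 0 = winding_number (?f \<circ> p) 0" by (simp add: o_def)
    then show ?thesis by (simp only: \<psi>_def)
  qed
  have exp_\<psi>: "?f \<gamma> = exp (\<psi> \<gamma>)" if \<gamma>: "\<gamma> \<in> characters" for \<gamma>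
    using winding_number_exp_2pi[OF path[OF P(1)[OF \<gamma>]]] P(2,3)[OF \<gamma>] fourier_trivial[OF M]
    by (simp add: \<psi>_def pathstart_def pathfinish_def)
  have "\<psi> trivial_character = 0"
  proof -
    have "pathin ?X (\<lambda>t. trivial_character)" using trivial_in_characters by simp
    from \<psi>[OF trivial_in_characters this] show ?thesis
      using winding_number_constI[of 1 0 "?f \<circ> (\<lambda>t. trivial_character)"] fourier_trivial[OF M] by simp
  qed
  moreover have "continuous_map ?X euclidean \<psi>"
  proof (rule continuous_map_dualI)
    fix \<gamma>\<^sub>0 :: "'a \<Rightarrow> complex" and \<epsilon> :: real assume \<gamma>\<^sub>0: "\<gamma>\<^sub>0 \<in> characters" and \<epsilon>: "\<epsilon> > 0"
    define a where "a = ?f \<gamma>\<^sub>0"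
    have a: "a \<noteq> 0" using nz \<gamma>\<^sub>0 by (simp add: a_def)
    \<comment> \<open>The first bound keeps the path away from 0, the second one makes the added logarithm, which is
      at most \<open>2 \<rho> / norm a\<close>, smaller than \<open>\<epsilon>\<close>.\<close>
    define \<rho> where "\<rho> = min (norm a / 4) (norm a * \<epsilon> / 4)"
    have \<rho>: "\<rho> > 0" "\<rho> \<le> norm a / 4" "\<rho> \<le> norm a * \<epsilon> / 4" using a \<epsilon> by (auto simp: \<rho>_def)
    have "\<rho> / 4 > 0" "\<rho> / 2 > 0" using \<rho>(1) by simp_all
    then obtain K where K: "compact K" "\<And>\<gamma> \<kappa> \<delta>. \<gamma> \<in> characters \<Longrightarrow> \<kappa> \<in> characters \<Longrightarrow> 0 \<le> \<delta> \<Longrightarrow>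
      (\<And>x. x \<in> K \<Longrightarrow> norm (\<gamma> x - \<kappa> x) \<le> \<delta>) \<Longrightarrow> norm (?f \<gamma> - ?f \<kappa>) \<le> \<delta> + \<rho> / 2"
      using fourier_close[OF M] by metis
    obtain C \<delta> where C: "compact C" "\<delta> > 0" "\<And>\<gamma>. \<gamma> \<in> characters \<Longrightarrow> (\<And>x. x \<in> C \<Longrightarrow> norm (\<gamma> x - 1) < \<delta>) \<Longrightarrow>
      \<exists>\<phi>\<in>real_homs. (\<forall>x. \<gamma> x = cis (\<phi> x)) \<and> (\<forall>x\<in>K. \<bar>\<phi> x\<bar> \<le> \<rho> / 4)"
      using small_lifts[OF lc characters_lift_if_path_connected[OF lc pc] K(1) \<open>\<rho> / 4 > 0\<close>] by metis
    have "norm (\<psi> \<gamma> - \<psi> \<gamma>\<^sub>0) < \<epsilon>" if \<gamma>: "\<gamma> \<in> characters" and near: "\<forall>x\<in>C. norm (\<gamma> x - \<gamma>\<^sub>0 x) < \<delta>" for \<gamma>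
    proof -
      have \<gamma>\<^sub>0_norm: "norm (\<gamma>\<^sub>0 x) = 1" for x using \<gamma>\<^sub>0 by (simp add: characters_def)
      then have \<gamma>\<^sub>0_nz: "\<gamma>\<^sub>0 x \<noteq> 0" for x by (metis norm_zero zero_neq_one)
      have "norm (\<gamma> x / \<gamma>\<^sub>0 x - 1) < \<delta>" if "x \<in> C" for x
      proof -
        have "\<gamma> x / \<gamma>\<^sub>0 x - 1 = (\<gamma> x - \<gamma>\<^sub>0 x) / \<gamma>\<^sub>0 x" using \<gamma>\<^sub>0_nz by (simp add: field_simps)
        then show ?thesis using near that by (simp add: norm_divide \<gamma>\<^sub>0_norm)
      qed
      then obtain \<phi> where \<phi>: "\<phi> \<in> real_homs" "\<And>x. \<gamma> x / \<gamma>\<^sub>0 x = cis (\<phi> x)" "\<And>x. x \<in> K \<Longrightarrow> \<bar>\<phi> x\<bar> \<le> \<rho> / 4"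
        using C(3)[OF characters_divide[OF \<gamma> \<gamma>\<^sub>0]] by blast
      define r where "r t x = \<gamma>\<^sub>0 x * cis (t * \<phi> x)" for t x
      have r: "pathin ?X r" using pathin_one_parameter[OF \<gamma>\<^sub>0 \<phi>(1)] by (simp add: r_def[abs_def])
      have r0: "r 0 = \<gamma>\<^sub>0" by (simp add: r_def fun_eq_iff)
      have r1: "r 1 = \<gamma>"
      proof
        fix x show "r 1 x = \<gamma> x" using \<phi>(2)[of x] \<gamma>\<^sub>0_nz[of x] by (simp add: r_def field_simps)
      qed
      have r_char: "r t \<in> characters" if "t \<in> {0..1}" for t
        using r that unfolding pathin_def continuous_map_def topspace_dual_topology by auto
      have r_near: "norm (?f (r t) - a) \<le> \<rho>" if t: "t \<in> {0..1}" for t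
      proof -
        have "norm (r t x - \<gamma>\<^sub>0 x) \<le> \<rho> / 2" if "x \<in> K" for x
        proof -
          have "r t x - \<gamma>\<^sub>0 x = \<gamma>\<^sub>0 x * (cis (t * \<phi> x) - 1)" by (simp add: r_def algebra_simps)
          then have "norm (r t x - \<gamma>\<^sub>0 x) \<le> \<bar>t * \<phi> x\<bar>"
            using norm_cis_minus_1_le[of "t * \<phi> x"] by (simp add: norm_mult \<gamma>\<^sub>0_norm)
          also have "\<dots> \<le> 1 * \<bar>\<phi> x\<bar>" unfolding abs_mult using t by (intro mult_right_mono) auto
          finally show ?thesis using \<phi>(3)[OF that] \<rho>(1) by simp
        qed
        from K(2)[OF r_char[OF t] \<gamma>\<^sub>0 _ this] \<rho>(1) show ?thesis by (simp add: a_def)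
      qed
      have join: "P \<gamma>\<^sub>0 1 = r 0" using P(3)[OF \<gamma>\<^sub>0] r0 by simp
      have "\<psi> \<gamma> = 2 * of_real pi * \<i> * winding_number (?f \<circ> (P \<gamma>\<^sub>0 +++ r)) 0"
        using P(2)[OF \<gamma>\<^sub>0] r1
        by (intro \<psi>[OF \<gamma> pathin_join[OF P(1)[OF \<gamma>\<^sub>0] r join]]) (simp_all add: joinpaths_def)
      also have "winding_number (?f \<circ> (P \<gamma>\<^sub>0 +++ r)) 0 =
          winding_number (?f \<circ> P \<gamma>\<^sub>0) 0 + winding_number (?f \<circ> r) 0"
        unfolding path_compose_join using path[OF P(1)[OF \<gamma>\<^sub>0]] path[OF r] join
        by (intro winding_number_join) (simp_all add: pathfinish_def pathstart_def)
      finally have "\<psi> \<gamma> - \<psi> \<gamma>\<^sub>0 = 2 * of_real pi * \<i> * winding_number (?f \<circ> r) 0"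
        by (simp add: \<psi>_def algebra_simps)
      also have "\<dots> = Ln ((?f \<circ> r) 1 / (?f \<circ> r) 0)"
      proof (rule winding_number_near_start[OF path(1)[OF r]])
        show "(?f \<circ> r) 0 \<noteq> 0" using a by (simp add: r0 a_def)
        fix t :: real assume "t \<in> {0..1}"
        from r_near[OF this] show "norm ((?f \<circ> r) t - (?f \<circ> r) 0) < norm ((?f \<circ> r) 0)"
          using \<rho> by (simp add: r0 flip: a_def)
      qed
      also have "(?f \<circ> r) 1 / (?f \<circ> r) 0 = 1 + (?f \<gamma> - a) / a"
        using a by (simp add: r0 r1 field_simps flip: a_def)
      finally have eq: "\<psi> \<gamma> - \<psi> \<gamma>\<^sub>0 = Ln (1 + (?f \<gamma> - a) / a)" .
      have "norm (?f \<gamma> - a) \<le> \<rho>" using r_near[of 1] by (simp add: r1)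
      then have small: "norm ((?f \<gamma> - a) / a) \<le> \<rho> / norm a" by (simp add: norm_divide divide_right_mono)
      have \<rho>a: "\<rho> / norm a \<le> 1 / 4" "\<rho> / norm a \<le> \<epsilon> / 4"
        using \<rho>(2,3) a by (simp_all add: divide_le_eq mult.commute)
      have "norm (Ln (1 + (?f \<gamma> - a) / a)) \<le> 2 * norm ((?f \<gamma> - a) / a)"
        by (rule norm_Ln_le) (use small \<rho>a in linarith)
      also have "\<dots> < \<epsilon>" using small \<rho>a \<epsilon> by linarith
      finally show ?thesis unfolding eq .
    qed
    then show "\<exists>K \<delta>. compact K \<and> \<delta> > 0 \<and>
      (\<forall>\<gamma>\<in>characters. (\<forall>x\<in>K. norm (\<gamma> x - \<gamma>\<^sub>0 x) < \<delta>) \<longrightarrow> norm (\<psi> \<gamma> - \<psi> \<gamma>\<^sub>0) < \<epsilon>)"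
      using C(1,2) by (intro exI[of _ C] exI[of _ \<delta>]) blast
  qed
  ultimately show ?thesis unfolding admissible_def using exp_\<psi> by (intro exI[of _ \<psi>]) blast
qed

text \<open>
  Winding numbers along a loop turn the equation between powers into \<open>m z = n k\<close>, where \<open>k\<close> is the
  winding number of the second Fourier transform.
\<close>
lemma denominator_dvd_winding:
  fixes M :: "'a::{topological_ab_group_add, t2_space} measure"
  assumes M: "borel_probability M" and nz: "\<forall>\<gamma>\<in>characters. fourier M \<gamma> \<noteq> 0"
    and mn: "n \<ge> 1" "coprime m n" and g: "characteristic_function g"
    and eq: "\<forall>\<gamma>\<in>characters. fourier M \<gamma> ^ m = g \<gamma> ^ n"
    and z: "z \<in> fourier_pi1_image M"
  shows "int n dvd z"
proof -
  obtain N where N: "borel_probability N" and gN: "\<And>\<gamma>. \<gamma> \<in> characters \<Longrightarrow> g \<gamma> = fourier N \<gamma>"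
    using g unfolding characteristic_function_def by blast
  have nzN: "\<forall>\<gamma>\<in>characters. fourier N \<gamma> \<noteq> 0"
  proof
    fix \<gamma> :: "'a \<Rightarrow> complex" assume \<gamma>: "\<gamma> \<in> characters"
    then have "fourier M \<gamma> ^ m = fourier N \<gamma> ^ n" using eq gN by simp
    moreover have "fourier M \<gamma> ^ m \<noteq> 0" using nz \<gamma> by simp
    ultimately show "fourier N \<gamma> \<noteq> 0" using mn(1) by (metis power_0_left not_one_le_zero)
  qed
  obtain p where p: "p \<in> loops dual_topology trivial_character"
    "winding_number (fourier M \<circ> p) 0 = of_int z"
    using z unfolding fourier_pi1_image_eq[OF M nz] by blast
  have pin: "pathin dual_topology p" using p(1) by (simp add: loops_def)
  note path = fourier_path[OF M nz pin] and pathN = fourier_path[OF N nzN pin]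
  have p_char: "p t \<in> characters" if "t \<in> {0..1}" for t
    using pin that unfolding pathin_def continuous_map_def topspace_dual_topology by auto
  have "winding_number (fourier N \<circ> p) 0 \<in> \<int>"
    using p(1) by (intro integer_winding_number[OF pathN(1) _ pathN(2)]) (simp add: loops_def pathstart_def pathfinish_def)
  then obtain k where k: "winding_number (fourier N \<circ> p) 0 = of_int k" by (auto elim: Ints_cases)
  have "of_nat m * winding_number (fourier M \<circ> p) 0 = winding_number (\<lambda>t. (fourier M \<circ> p) t ^ m) 0"
    by (rule winding_number_power[OF path, symmetric])
  also have "\<dots> = winding_number (\<lambda>t. (fourier N \<circ> p) t ^ n) 0"
    by (rule winding_number_cong) (use eq gN p_char in auto)
  also have "\<dots> = of_nat n * winding_number (fourier N \<circ> p) 0" by (rule winding_number_power[OF pathN])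
  finally have "complex_of_int (int m * z) = of_int (int n * k)" by (simp add: p(2) k)
  then have "int m * z = int n * k" using of_int_eq_iff by blast
  then have "int n dvd int m * z" by simp
  moreover have "coprime (int n) (int m)" using mn(2) by (simp add: coprime_commute)
  ultimately show ?thesis using coprime_dvd_mult_right_iff by blast
qed

section \<open>Rational powers of a non-admissible measure\<close>

theorem theorem3p1:
  fixes M :: "'a::{topological_ab_group_add, t2_space} measure"
  assumes "locally_compact_space (euclidean :: 'a topology)"
    and "path_connected_space (dual_topology :: ('a \<Rightarrow> complex) topology)"
    and "borel_probability M"
    and "\<not> admissible M"
    and "\<forall>\<gamma>\<in>characters. fourier M \<gamma> \<noteq> 0"
  shows "Lambda_alg M \<subseteq>
           (\<Union>n\<in>{n. n \<ge> 1 \<and> (\<forall>z\<in>fourier_pi1_image M. \<exists>l. z = int n * l)}. unit_multiples n)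
       \<and> Lambda_alg M \<subseteq> (\<Inter>z\<in>fourier_pi1_image M - {0}. unit_multiples (nat \<bar>z\<bar>))
       \<and> (\<exists>d. d \<in> abs ` (fourier_pi1_image M - {0})
            \<and> (\<forall>z\<in>fourier_pi1_image M - {0}. d \<le> \<bar>z\<bar>)
            \<and> (\<forall>q\<in>Lambda_alg M. 1 / real_of_int d \<le> q))"
proof -
  let ?Z = "fourier_pi1_image M"
  have q: "\<exists>m n. q = real m / real n \<and> m \<ge> 1 \<and> n \<ge> 1 \<and> (\<forall>z\<in>?Z. int n dvd z)" if "q \<in> Lambda_alg M" for q
    using that denominator_dvd_winding[OF assms(3,5)] unfolding Lambda_alg_def by blast
  have i: "Lambda_alg M \<subseteq> (\<Union>n\<in>{n. n \<ge> 1 \<and> (\<forall>z\<in>?Z. \<exists>l. z = int n * l)}. unit_multiples n)"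
  proof
    fix q assume "q \<in> Lambda_alg M"
    from q[OF this] obtain m n where mn: "q = real m / real n" "m \<ge> 1" "n \<ge> 1" "\<forall>z\<in>?Z. int n dvd z" by blast
    then have "q \<in> unit_multiples n" unfolding unit_multiples_def by blast
    with mn(3,4) show "q \<in> (\<Union>n\<in>{n. n \<ge> 1 \<and> (\<forall>z\<in>?Z. \<exists>l. z = int n * l)}. unit_multiples n)"
      unfolding dvd_def by blast
  qed
  have ii: "q \<in> unit_multiples (nat \<bar>z\<bar>)" if "q \<in> Lambda_alg M" "z \<in> ?Z - {0}" for q z
  proof -
    from q[OF that(1)] obtain m n where mn: "q = real m / real n" "m \<ge> 1" "n \<ge> 1" "\<forall>z\<in>?Z. int n dvd z" by blast
    with that(2) have "int n dvd z" "z \<noteq> 0" by auto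
    then obtain l where l: "nat \<bar>z\<bar> = n * l" "l \<ge> 1"
      by (metis One_nat_def Suc_leI dvd_def dvd_nat_abs_iff gr0I mult_0_right nat_0_iff zero_less_abs_iff linorder_not_less)
    have "q = real (m * l) / real (nat \<bar>z\<bar>)" using l mn by simp
    moreover have "m * l \<ge> 1" using l(2) mn(2) by simp
    ultimately show ?thesis unfolding unit_multiples_def by blast
  qed
  have "\<exists>z. z \<in> ?Z - {0}"
  proof (rule ccontr)
    assume none: "\<not> (\<exists>z. z \<in> ?Z - {0})"
    have "winding_number (fourier M \<circ> p) 0 = 0" if p: "p \<in> loops dual_topology trivial_character" for p
    proof -
      have pin: "pathin dual_topology p" using p by (simp add: loops_def)
      have "winding_number (fourier M \<circ> p) 0 \<in> \<int>"
        using p fourier_path[OF assms(3,5) pin]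
        by (intro integer_winding_number) (simp_all add: loops_def pathstart_def pathfinish_def)
      then obtain k where k: "winding_number (fourier M \<circ> p) 0 = of_int k" by (auto elim: Ints_cases)
      then have "k \<in> ?Z" using p unfolding fourier_pi1_image_eq[OF assms(3,5)] by blast
      with none k show ?thesis by simp
    qed
    with admissible_if_no_winding[OF assms(1-3,5)] assms(4) show False by blast
  qed
  then obtain z\<^sub>0 where "z\<^sub>0 \<in> ?Z - {0}" by blast
  then obtain z where z: "z \<in> ?Z - {0}" "\<And>y. y \<in> ?Z - {0} \<Longrightarrow> nat \<bar>z\<bar> \<le> nat \<bar>y\<bar>"
    using ex_has_least_nat[of "\<lambda>z. z \<in> ?Z - {0}" z\<^sub>0 "\<lambda>z. nat \<bar>z\<bar>"] by blast
  have "1 / real_of_int \<bar>z\<bar> \<le> q" if q: "q \<in> Lambda_alg M" for q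
  proof -
    obtain j where j: "q = real j / real (nat \<bar>z\<bar>)" "j \<ge> 1"
      using ii[OF q z(1)] unfolding unit_multiples_def by blast
    then show ?thesis by (simp add: divide_right_mono)
  qed
  moreover have "\<forall>y\<in>?Z - {0}. \<bar>z\<bar> \<le> \<bar>y\<bar>" using z(2) by force
  ultimately have "\<exists>d. d \<in> abs ` (?Z - {0}) \<and> (\<forall>z\<in>?Z - {0}. d \<le> \<bar>z\<bar>) \<and>
      (\<forall>q\<in>Lambda_alg M. 1 / real_of_int d \<le> q)"
    using z(1) by (intro exI[of _ "\<bar>z\<bar>"] conjI imageI ballI) auto
  with i ii show ?thesis by blast
qed

end
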